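(* Let $\mathfrak{R}$ be an expansion of $(\mathbb{R},<)$. If $\mathfrak{R}$ is locally o-minimal, then $\mathfrak{R}$ is PCC if and only if it is CC, if and only if it is QCC.
   Context: "Definable" means definable in $\mathfrak{R}$ with parameters; definable sets are subsets of $\mathbb{R}^n$ for arbitrary $n$. Each $\mathbb{R}^n$ has its usual topology and subsets carry the subspace topology. $\mathfrak{R}$ is locally o-minimal if for each definable $E\subseteq\mathbb{R}$ and each $x\in\mathbb{R}$ there is an open neighborhood $U$ of $x$ such that $E\cap U$ is a finite union of points and open intervals. A structure on $\mathbb{R}$ is PCC (path-component closed) if for every definable set $E$, each path component of $E$ is definable; it is CC (component closed) if for every definable set $E$, each connected component of $E$ is definable; it is QCC (quasicomponent closed) if for every definable set $E$, each quasicomponent of $E$ is definable. (The quasicomponent of a point $x$ in a space $E$ is the intersection of all clopen subsets of $E$ containing $x$.) *)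

theory Defs
  imports "HOL-Analysis.Analysis"
begin

text \<open>
  First-order structures with universe \<^typ>\<open>real\<close>. A symbol is a pair of a name and an
  arity; \<open>funs\<close> and \<open>rels\<close> are the sets of function and relation symbols
  (constants have arity 0), so the language may be empty, finite or infinite of any cardinality.
  The interpretation of a symbol of arity \<open>k\<close> is only relevant on lists of length
  \<open>k\<close>.
\<close>

record ('f, 'r) real_structure =
  funs :: "('f \<times> nat) set"
  rels :: "('r \<times> nat) set"
  fun_interp :: "'f \<Rightarrow> real list \<Rightarrow> real"
  rel_interp :: "'r \<Rightarrow> real list \<Rightarrow> bool"

datatype 'f fo_term =
    Var nat
  | Fun 'f "'f fo_term list"

datatype ('f, 'r) fo_formula =
    Eq "'f fo_term" "'f fo_term"
  | Rel 'r "'f fo_term list"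
  | Neg "('f, 'r) fo_formula"
  | Conj "('f, 'r) fo_formula" "('f, 'r) fo_formula"
  | Ex nat "('f, 'r) fo_formula"

primrec term_of_language :: "('f, 'r) real_structure \<Rightarrow> 'f fo_term \<Rightarrow> bool" where
  "term_of_language M (Var i) \<longleftrightarrow> True"
| "term_of_language M (Fun f ts) \<longleftrightarrow>
     (f, length ts) \<in> funs M \<and> list_all (\<lambda>b. b) (map (term_of_language M) ts)"

primrec formula_of_language :: "('f, 'r) real_structure \<Rightarrow> ('f, 'r) fo_formula \<Rightarrow> bool" where
  "formula_of_language M (Eq s t) \<longleftrightarrow> term_of_language M s \<and> term_of_language M t"
| "formula_of_language M (Rel r ts) \<longleftrightarrow>
     (r, length ts) \<in> rels M \<and> list_all (term_of_language M) ts"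
| "formula_of_language M (Neg \<phi>) \<longleftrightarrow> formula_of_language M \<phi>"
| "formula_of_language M (Conj \<phi> \<psi>) \<longleftrightarrow> formula_of_language M \<phi> \<and> formula_of_language M \<psi>"
| "formula_of_language M (Ex i \<phi>) \<longleftrightarrow> formula_of_language M \<phi>"

primrec term_value :: "('f, 'r) real_structure \<Rightarrow> (nat \<Rightarrow> real) \<Rightarrow> 'f fo_term \<Rightarrow> real" where
  "term_value M v (Var i) = v i"
| "term_value M v (Fun f ts) = fun_interp M f (map (term_value M v) ts)"

primrec satisfies :: "('f, 'r) real_structure \<Rightarrow> (nat \<Rightarrow> real) \<Rightarrow> ('f, 'r) fo_formula \<Rightarrow> bool" where
  "satisfies M v (Eq s t) \<longleftrightarrow> term_value M v s = term_value M v t"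
| "satisfies M v (Rel r ts) \<longleftrightarrow> rel_interp M r (map (term_value M v) ts)"
| "satisfies M v (Neg \<phi>) \<longleftrightarrow> \<not> satisfies M v \<phi>"
| "satisfies M v (Conj \<phi> \<psi>) \<longleftrightarrow> satisfies M v \<phi> \<and> satisfies M v \<psi>"
| "satisfies M v (Ex i \<phi>) \<longleftrightarrow> (\<exists>a. satisfies M (v(i := a)) \<phi>)"

definition expansion_of_real_order :: "('f, 'r) real_structure \<Rightarrow> bool" where
  "expansion_of_real_order M \<longleftrightarrow>
     (\<exists>r. (r, 2) \<in> rels M \<and> (\<forall>x y. rel_interp M r [x, y] \<longleftrightarrow> x < y))"

text \<open>
  Definability with parameters of subsets of $n$-dimensional space, whose points are the
  functions \<^typ>\<open>nat \<Rightarrow> real\<close> vanishing from \<open>n\<close> on, as in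
  \<^const>\<open>Euclidean_space\<close>. The variables with index below \<open>n\<close> are the coordinates; the
  other free variables of the formula, finitely many, hold the parameters supplied by
  \<open>p\<close>.
\<close>

definition definable :: "('f, 'r) real_structure \<Rightarrow> nat \<Rightarrow> (nat \<Rightarrow> real) set \<Rightarrow> bool" where
  "definable M n E \<longleftrightarrow>
     (\<exists>\<phi> p. formula_of_language M \<phi> \<and>
        E = {x \<in> topspace (Euclidean_space n). satisfies M (\<lambda>i. if i < n then x i else p i) \<phi>})"

text \<open>
  The image under \<^term>\<open>\<lambda>x::nat \<Rightarrow> real. x 0\<close> identifies subsets of 1-dimensional space
  with sets of reals. Open intervals may be unbounded (and empty).
\<close>

definition locally_o_minimal :: "('f, 'r) real_structure \<Rightarrow> bool" where
  "locally_o_minimal M \<longleftrightarrow>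
     (\<forall>E. definable M 1 E \<longrightarrow>
        (\<forall>x::real. \<exists>U. open U \<and> x \<in> U \<and>
           (\<exists>F. finite F \<and> (\<forall>I\<in>F. (\<exists>a. I = {a}) \<or> (open I \<and> is_interval I)) \<and>
              (\<lambda>e. e 0) ` E \<inter> U = \<Union>F)))"

definition PCC :: "('f, 'r) real_structure \<Rightarrow> bool" where
  "PCC M \<longleftrightarrow>
     (\<forall>n E. definable M n E \<longrightarrow>
        (\<forall>C \<in> path_components_of (subtopology (Euclidean_space n) E). definable M n C))"

definition CC :: "('f, 'r) real_structure \<Rightarrow> bool" where
  "CC M \<longleftrightarrow>
     (\<forall>n E. definable M n E \<longrightarrow>
        (\<forall>C \<in> connected_components_of (subtopology (Euclidean_space n) E). definable M n C))"

definition QCC :: "('f, 'r) real_structure \<Rightarrow> bool" where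
  "QCC M \<longleftrightarrow>
     (\<forall>n E. definable M n E \<longrightarrow>
        (\<forall>C \<in> quasi_components_of (subtopology (Euclidean_space n) E). definable M n C))"

end

theory Submission
  imports Defs
begin

text \<open>
  Every definable set of a locally o-minimal expansion of the real order is locally path connected,
  so its path components, components and quasicomponents are the same sets and the three closure
  conditions coincide.

  The point is that a bounded definable set is a finite union of path-connected definable sets.
  Over the real numbers the Baire category theorem replaces much of the o-minimal dimension theory:
  the frontier of a definable set is nowhere dense, countably many conditions with rational parameters
  hold off a meagre set, and a definable meagre set is nowhere dense. So definable functions are
  generically continuous and finite fibres generically have locally constant cardinality; on the
  exceptional set one coordinate is piecewise a function of the others, which permits induction on
  the number of coordinates.

  Subsets of $n$-dimensional space are replaced by their inverse images in the space of all sequences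
  (cylinders), so that no statement depends on the dimension: being a cylinder over the coordinates
  in \<open>I\<close> is \<open>dep I\<close>, and projecting a coordinate away stays within the same space.
\<close>

section \<open>Coordinates and finite support\<close>

text \<open>Inside the structure only the order is available: definable choice may fail, and local
  o-minimality yields finiteness on bounded intervals only. The decomposition theorem is therefore
  stated for bounded sets, and a box around a point reduces the local question to it. Finitely many
  path-connected pieces do not settle that question yet: a piece that accumulates at
  \<open>x\<close> has to be joined to \<open>x\<close>, and in place of a definable curve a
  continuous one is assembled from infinitely many paths. Category arguments ask for countably many
  conditions, whereas an exceptional set must be definable before the induction applies to it. So
  the good sets are defined by quantifiers over all real levels or windows, and rational ones are
  used only to bound their complements. For such a set to be definable, the frontiers of the members
  of a family must be definable jointly with the parameters of the family; \<open>cint\<close>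
  serves this purpose. Bounds on finite fibres, graph pieces, continuity and path connectedness rest
  on each other across dimensions, which forces a single simultaneous induction.\<close>

lemma Baire_fun:
  fixes \<G> :: "(nat \<Rightarrow> real) set set"
  assumes "countable \<G>" "\<And>T. T \<in> \<G> \<Longrightarrow> closed T \<and> interior T = {}"
  shows "interior (\<Union>\<G>) = {}"
proof -
  \<comment> \<open>Countability of the set of coordinates enters here: an uncountable power of the
    line is not metrizable.\<close>
  have "completely_metrizable_space (powertop_real (UNIV::nat set))"
    by (simp add: completely_metrizable_space_euclidean completely_metrizable_space_product_topology)
  then have "completely_metrizable_space (euclidean :: (nat \<Rightarrow> real) topology)"
    by (simp add: euclidean_product_topology)
  then have "euclidean interior_of \<Union>\<G> = {}"
    using assms by (intro Baire_category_alt) auto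
  then show ?thesis by simp
qed

lemma Baire_nowhere_dense:
  fixes \<G> :: "(nat \<Rightarrow> real) set set"
  assumes "countable \<G>" "\<And>T. T \<in> \<G> \<Longrightarrow> interior (closure T) = {}" "S \<subseteq> \<Union>\<G>"
  shows "interior S = {}"
proof -
  have "interior (\<Union>(closure ` \<G>)) = {}"
  proof (rule Baire_fun)
    show "countable (closure ` \<G>)" using assms(1) by simp
    show "closed T \<and> interior T = {}" if "T \<in> closure ` \<G>" for T
      using that assms(2) by auto
  qed
  moreover have "S \<subseteq> \<Union>(closure ` \<G>)"
  proof
    fix x assume "x \<in> S"
    then obtain T where "T \<in> \<G>" "x \<in> T" using assms(3) by blast
    then show "x \<in> \<Union>(closure ` \<G>)" using closure_subset[of T] by blast
  qed
  ultimately show ?thesis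
    using interior_mono by blast
qed

text \<open>For finite \<open>I\<close> and positive \<open>e\<close> these are the basic
  neighbourhoods of \<open>v\<close> in the product topology.\<close>

definition cbox_on :: "nat set \<Rightarrow> real \<Rightarrow> (nat \<Rightarrow> real) \<Rightarrow> (nat \<Rightarrow> real) set" where
  "cbox_on I e v = {w. \<forall>i\<in>I. \<bar>w i - v i\<bar> < e}"

lemma continuous_on_coord [continuous_intros]: "continuous_on S (\<lambda>v::nat \<Rightarrow> real. v i)"
  by (rule continuous_on_subset[OF continuous_on_product_coordinates]) auto

lemma continuous_on_fun_upd:
  assumes "continuous_on S f" "continuous_on S g"
  shows "continuous_on S (\<lambda>x. (f x)(i := g x) :: nat \<Rightarrow> real)"
proof (rule continuous_on_coordinatewise_then_product)
  fix k
  show "continuous_on S (\<lambda>x. ((f x)(i := g x)) k)"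
    using assms by (cases "k = i") (auto intro: continuous_on_product_then_coordinatewise)
qed

lemma open_cbox_on:
  assumes "finite I" shows "open (cbox_on I e v)"
proof -
  have "cbox_on I e v = (\<Inter>i\<in>I. {w. \<bar>w i - v i\<bar> < e})"
    by (auto simp: cbox_on_def)
  then show ?thesis
    using assms by (auto intro!: open_Collect_less continuous_intros)
qed

lemma centre_in_cbox_on: "0 < e \<Longrightarrow> v \<in> cbox_on I e v"
  by (simp add: cbox_on_def)

lemma open_contains_cbox_on:
  fixes U :: "(nat \<Rightarrow> real) set"
  assumes "open U" "v \<in> U"
  obtains F e where "finite F" "0 < e" "cbox_on F e v \<subseteq> U"
proof -
  have "openin (powertop_real UNIV) U"
    using assms by (simp add: euclidean_product_topology)
  from product_topology_open_contains_basis[OF this \<open>v \<in> U\<close>]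
  obtain X where X: "v \<in> (\<Pi>\<^sub>E i\<in>UNIV. X i)" "\<And>i. open (X i)" "finite {i. X i \<noteq> UNIV}"
      "(\<Pi>\<^sub>E i\<in>UNIV. X i) \<subseteq> U"
    by auto
  define F where "F = {i. X i \<noteq> UNIV}"
  have "\<exists>e>0. \<forall>y. dist y (v i) < e \<longrightarrow> y \<in> X i" for i
    using X(1) X(2)[of i] by (auto simp: open_dist PiE_iff)
  then obtain e where e: "\<And>i. e i > 0" "\<And>i y. dist y (v i) < e i \<Longrightarrow> y \<in> X i"
    by metis
  define d where "d = Min (insert 1 (e ` F))"
  have "finite F" using X(3) by (simp add: F_def)
  then have d: "d > 0" "\<And>i. i \<in> F \<Longrightarrow> d \<le> e i"
    using e(1) by (auto simp: d_def)
  have "cbox_on F d v \<subseteq> U"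
  proof
    fix w assume w: "w \<in> cbox_on F d v"
    have "w i \<in> X i" for i
    proof (cases "i \<in> F")
      case True
      then show ?thesis
        using w d(2)[OF True] e(2)[of "w i" i] by (auto simp: cbox_on_def dist_real_def)
    qed (simp add: F_def)
    then show "w \<in> U" using X(4) by auto
  qed
  then show ?thesis using that \<open>finite F\<close> d(1) by blast
qed

section \<open>Sets and functions that depend on given coordinates only\<close>

definition dep :: "nat set \<Rightarrow> ((nat \<Rightarrow> real) \<Rightarrow> 'a) \<Rightarrow> bool" where
  "dep I f \<longleftrightarrow> (\<forall>v w. (\<forall>i\<in>I. v i = w i) \<longrightarrow> f v = f w)"

lemma depD: "dep I f \<Longrightarrow> (\<And>i. i \<in> I \<Longrightarrow> v i = w i) \<Longrightarrow> f v = f w"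
  by (auto simp: dep_def)

lemma dep_mono: "dep I f \<Longrightarrow> I \<subseteq> J \<Longrightarrow> dep J f"
  by (auto simp: dep_def subset_iff)

lemma dep_upd: "dep I f \<Longrightarrow> i \<notin> I \<Longrightarrow> f (v(i := a)) = f v"
  by (rule depD) auto

lemma dep_simple [intro]:
  "dep I (\<lambda>v. c)"
  "i \<in> I \<Longrightarrow> dep I (\<lambda>v. v i)"
  by (auto simp: dep_def)

lemma dep_comp: "dep I f \<Longrightarrow> dep I (\<lambda>v. F (f v))"
  unfolding dep_def by metis

lemma dep_comp2: "dep I f \<Longrightarrow> dep I g \<Longrightarrow> dep I (\<lambda>v. F (f v) (g v))"
  unfolding dep_def by metis

lemma dep_lambda: "(\<And>b. dep I (\<lambda>v. R v b)) \<Longrightarrow> dep I R"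
  unfolding dep_def by blast

lemma dep_intros:
  "dep I P \<Longrightarrow> dep I (\<lambda>v. \<not> P v)"
  "dep I P \<Longrightarrow> dep I Q \<Longrightarrow> dep I (\<lambda>v. P v \<and> Q v)"
  "dep I P \<Longrightarrow> dep I Q \<Longrightarrow> dep I (\<lambda>v. P v \<or> Q v)"
  "dep I P \<Longrightarrow> dep I Q \<Longrightarrow> dep I (\<lambda>v. P v \<longrightarrow> Q v)"
  "(\<And>b. dep I (\<lambda>v. R v b)) \<Longrightarrow> dep I (\<lambda>v. \<exists>b. R v b)"
  "(\<And>b. dep I (\<lambda>v. R v b)) \<Longrightarrow> dep I (\<lambda>v. \<forall>b. R v b)"
  "dep I f \<Longrightarrow> dep I g \<Longrightarrow> dep I (\<lambda>v. f v < (g v :: real))"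
  "dep I f \<Longrightarrow> dep I g \<Longrightarrow> dep I (\<lambda>v. f v \<le> (g v :: real))"
  "dep I f \<Longrightarrow> dep I g \<Longrightarrow> dep I (\<lambda>v. f v = (g v :: real))"
  by (rule dep_comp[where F = Not] dep_comp2[where F = "(\<and>)"] dep_comp2[where F = "(\<or>)"]
      dep_comp2[where F = "(\<longrightarrow>)"] dep_comp[where F = HOL.Ex, OF dep_lambda]
      dep_comp[where F = HOL.All, OF dep_lambda] dep_comp2[where F = "(<)"]
      dep_comp2[where F = "(\<le>)"] dep_comp2[where F = "(=)"]; assumption)+

lemma dep_fun_upd:
  assumes "dep (insert j I) f" "dep I g"
  shows "dep I (\<lambda>v. f (v(j := g v)))"
  unfolding dep_def
proof (intro allI impI)
  fix v w :: "nat \<Rightarrow> real" assume eq: "\<forall>i\<in>I. v i = w i"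
  then have "g v = g w" using depD[OF assms(2)] by blast
  then show "f (v(j := g v)) = f (w(j := g w))"
    using eq by (intro depD[OF assms(1)]) auto
qed

lemma dep_upd_mem:
  "dep (insert j I) (\<lambda>v. v \<in> A) \<Longrightarrow> dep I g \<Longrightarrow> dep I (\<lambda>v. v(j := g v) \<in> A)"
  by (rule dep_fun_upd)

text \<open>The translation that carries \<open>w\<close> to \<open>v\<close> fixes the coordinates
  in \<open>I\<close>, hence maps \<open>X\<close> onto itself; being continuous, it pulls the
  interior of \<open>X\<close> back to an open subset of \<open>X\<close>.\<close>

lemma dep_interior:
  fixes X :: "(nat \<Rightarrow> real) set"
  assumes "dep I (\<lambda>v. v \<in> X)" shows "dep I (\<lambda>v. v \<in> interior X)"
proof -
  have *: "w \<in> interior X" if "v \<in> interior X" and eq: "\<forall>i\<in>I. v i = w i" for v w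
  proof -
    define t where "t x = (\<lambda>k. x k + (v k - w k))" for x
    have cont: "continuous_on UNIV t"
      unfolding t_def by (intro continuous_on_coordinatewise_then_product continuous_intros)
    have "t x \<in> X \<longleftrightarrow> x \<in> X" for x
      using eq by (intro depD[OF assms]) (auto simp: t_def)
    then have "t -` interior X \<subseteq> X"
      using interior_subset by blast
    moreover have "open (t -` interior X)"
      using cont by (simp add: open_vimage)
    moreover have "w \<in> t -` interior X"
      using that by (simp add: t_def)
    ultimately show ?thesis
      by (meson interiorI)
  qed
  show ?thesis
    unfolding dep_def using * by metis
qed

lemma dep_closure:
  fixes X :: "(nat \<Rightarrow> real) set"
  assumes "dep I (\<lambda>v. v \<in> X)" shows "dep I (\<lambda>v. v \<in> closure X)"
proof -
  have "dep I (\<lambda>v. v \<in> - X)" using assms by (auto intro: dep_intros)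
  from dep_intros(1)[OF dep_interior[OF this]] show ?thesis
    by (simp add: closure_interior)
qed

lemma dep_frontier:
  fixes X :: "(nat \<Rightarrow> real) set"
  assumes "dep I (\<lambda>v. v \<in> X)" shows "dep I (\<lambda>v. v \<in> frontier X)"
  unfolding frontier_def
  using dep_intros(2)[OF dep_closure[OF assms] dep_intros(1)[OF dep_interior[OF assms]]] by simp

lemma dep_cbox_on: "I \<subseteq> J \<Longrightarrow> dep J (\<lambda>w. w \<in> cbox_on I e v)"
  by (auto simp: dep_def cbox_on_def subset_iff)

text \<open>The basic neighbourhood may constrain coordinates outside \<open>I\<close>. Resetting
  those to the values of \<open>v\<close> does not affect membership in \<open>U\<close>, so only
  the constraints in \<open>I\<close> remain.\<close>

lemma dep_open_contains_cbox_on: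
  fixes U :: "(nat \<Rightarrow> real) set"
  assumes "open U" "dep I (\<lambda>v. v \<in> U)" "v \<in> U"
  obtains e where "0 < e" "cbox_on I e v \<subseteq> U"
proof -
  obtain F e where Fe: "finite F" "0 < e" "cbox_on F e v \<subseteq> U"
    using open_contains_cbox_on[OF assms(1,3)] by blast
  have "cbox_on I e v \<subseteq> U"
  proof
    fix w assume w: "w \<in> cbox_on I e v"
    define w' where "w' = (\<lambda>k. if k \<in> I then w k else v k)"
    have "w' \<in> cbox_on F e v" using w Fe(2) by (auto simp: cbox_on_def w'_def)
    then have "w' \<in> U" using Fe(3) by blast
    then show "w \<in> U"
      using depD[OF assms(2), of w w'] by (simp add: w'_def)
  qed
  with Fe(2) show ?thesis using that by blast
qed

text \<open>The interior in the directions \<open>I\<close>, the other coordinates being fixed: these can then serve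
  as parameters of a family of sets.\<close>

definition cint :: "nat set \<Rightarrow> (nat \<Rightarrow> real) set \<Rightarrow> (nat \<Rightarrow> real) set" where
  "cint I X = {v. \<exists>l u. (\<forall>i\<in>I. l i < v i \<and> v i < u i) \<and>
     (\<forall>w. (\<forall>k. k \<notin> I \<longrightarrow> w k = v k) \<and> (\<forall>i\<in>I. l i < w i \<and> w i < u i) \<longrightarrow> w \<in> X)}"

text \<open>\<open>cint\<close> quantifies over boxes and can be turned into a formula; this
  identifies it with a topological interior, namely that of the section through
  \<open>v\<close>.\<close>

lemma cint_interior_section:
  assumes "finite I"
  shows "v \<in> cint I X \<longleftrightarrow> v \<in> interior {w. (\<lambda>k. if k \<in> I then w k else v k) \<in> X}"
    (is "_ \<longleftrightarrow> v \<in> interior ?S")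
proof
  assume "v \<in> cint I X"
  then obtain l u where lu: "\<forall>i\<in>I. l i < v i \<and> v i < u i"
     "\<And>w. (\<forall>k. k \<notin> I \<longrightarrow> w k = v k) \<and> (\<forall>i\<in>I. l i < w i \<and> w i < u i) \<Longrightarrow> w \<in> X"
    unfolding cint_def by blast
  let ?U = "\<Inter>i\<in>I. {w. l i < w i} \<inter> {w. w i < u i}"
  have "open ?U"
    using assms by (auto intro!: open_INT open_Int open_Collect_less continuous_intros)
  moreover have "?U \<subseteq> ?S" by (auto intro!: lu(2))
  moreover have "v \<in> ?U" using lu(1) by auto
  ultimately show "v \<in> interior ?S" by (meson interiorI)
next
  assume v: "v \<in> interior ?S"
  have "dep I (\<lambda>w. w \<in> ?S)"
    unfolding dep_def by (auto intro!: arg_cong[where f = "\<lambda>w. w \<in> X"])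
  then obtain e where e: "0 < e" "cbox_on I e v \<subseteq> interior ?S"
    using dep_open_contains_cbox_on[OF open_interior dep_interior v] by blast
  show "v \<in> cint I X"
    unfolding cint_def mem_Collect_eq
  proof (rule exI[of _ "\<lambda>i. v i - e"], rule exI[of _ "\<lambda>i. v i + e"], intro conjI allI impI)
    show "\<forall>i\<in>I. v i - e < v i \<and> v i < v i + e" using e(1) by simp
    fix w assume w: "(\<forall>k. k \<notin> I \<longrightarrow> w k = v k) \<and> (\<forall>i\<in>I. v i - e < w i \<and> w i < v i + e)"
    then have "w \<in> cbox_on I e v" by (auto simp: cbox_on_def abs_less_iff)
    then have "w \<in> ?S" using e(2) interior_subset by blast
    moreover have "(\<lambda>k. if k \<in> I then w k else v k) = w" using w by auto
    ultimately show "w \<in> X" by simp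
  qed
qed

text \<open>What the geometric argument takes from first-order logic. Projection is quantification
  over the value of one coordinate; \<open>dfn_dep\<close> guarantees that fresh coordinates exist;
  the last assumption is local o-minimality after compactness has been applied to a bounded
  interval.\<close>

locale tame_definability =
  fixes dfn :: "((nat \<Rightarrow> real) \<Rightarrow> bool) \<Rightarrow> bool"
  assumes dfn_conj: "dfn P \<Longrightarrow> dfn Q \<Longrightarrow> dfn (\<lambda>v. P v \<and> Q v)"
    and dfn_not: "dfn P \<Longrightarrow> dfn (\<lambda>v. \<not> P v)"
    and dfn_ex_upd: "dfn P \<Longrightarrow> dfn (\<lambda>v. \<exists>a. P (v(i := a)))"
    and dfn_less: "dfn (\<lambda>v. v i < v j)"
    and dfn_less_const: "dfn (\<lambda>v. v i < c)"
    and dfn_const_less: "dfn (\<lambda>v. c < v i)"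
    and dfn_dep: "dfn P \<Longrightarrow> \<exists>I. finite I \<and> dep I P"
    and finite_frontier_fibre: "dfn P \<Longrightarrow> finite (frontier {a. P (v(i := a))} \<inter> {-r..r})"
begin

lemma dfn_disj:
  assumes "dfn P" "dfn Q" shows "dfn (\<lambda>v. P v \<or> Q v)"
  using dfn_not[OF dfn_conj[OF dfn_not[OF assms(1)] dfn_not[OF assms(2)]]] by simp

lemma dfn_imp:
  assumes "dfn P" "dfn Q" shows "dfn (\<lambda>v. P v \<longrightarrow> Q v)"
  using dfn_disj[OF dfn_not[OF assms(1)] assms(2)] by (simp only: imp_conv_disj)

lemma dfn_le: "dfn (\<lambda>v. v i \<le> v j)" "dfn (\<lambda>v. v i \<le> c)" "dfn (\<lambda>v. c \<le> v i)"
  using dfn_not[OF dfn_less] dfn_not[OF dfn_less_const] dfn_not[OF dfn_const_less]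
  by (simp_all add: not_less)

lemma dfn_eq: "dfn (\<lambda>v. v i = v j)" "dfn (\<lambda>v. v i = c)" "dfn (\<lambda>v. c = v i)"
  using dfn_conj[OF dfn_le(1)[of i j] dfn_le(1)[of j i]] dfn_conj[OF dfn_le(2)[of i c] dfn_le(3)[of c i]]
  by (simp_all add: eq_iff conj_commute)

lemma dfn_const: "dfn (\<lambda>v. c)"
  using dfn_eq(1)[of 0 0] dfn_not[OF dfn_eq(1)[of 0 0]] by (cases c) simp_all

lemma dfn_mem:
  "dfn (\<lambda>v. v \<in> A) \<Longrightarrow> dfn (\<lambda>v. v \<in> B) \<Longrightarrow> dfn (\<lambda>v. v \<in> A \<inter> B)"
  "dfn (\<lambda>v. v \<in> A) \<Longrightarrow> dfn (\<lambda>v. v \<in> B) \<Longrightarrow> dfn (\<lambda>v. v \<in> A \<union> B)"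
  "dfn (\<lambda>v. v \<in> A) \<Longrightarrow> dfn (\<lambda>v. v \<in> B) \<Longrightarrow> dfn (\<lambda>v. v \<in> A - B)"
  "dfn (\<lambda>v. v \<in> A) \<Longrightarrow> dfn (\<lambda>v. v \<in> - A)"
  "dfn P \<Longrightarrow> dfn (\<lambda>v. v \<in> Collect P)"
  unfolding Int_iff Un_iff Diff_iff Compl_iff mem_Collect_eq
  by (rule dfn_conj dfn_disj dfn_not; assumption | (rule dfn_conj, assumption, rule dfn_not) | assumption)+

lemma dfn_ball_finite:
  assumes "finite S" "\<And>i. i \<in> S \<Longrightarrow> dfn (P i)"
  shows "dfn (\<lambda>v. \<forall>i\<in>S. P i v)"
  using assms by (induction S) (auto intro: dfn_const dfn_conj)

text \<open>The bound value is stored in a coordinate \<open>m\<close> outside \<open>I\<close>, on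
  which \<open>Q\<close> does not depend, and that coordinate is then projected away.\<close>

lemma dfn_ex:
  assumes "finite I" "\<And>b. dep I (\<lambda>v. Q v b)" "\<And>m. m \<notin> I \<Longrightarrow> dfn (\<lambda>v. Q v (v m))"
  shows "dfn (\<lambda>v. \<exists>b. Q v b)"
proof -
  obtain m where m: "m \<notin> I" using assms(1) ex_new_if_finite infinite_UNIV_nat by blast
  have "Q (v(m := a)) b = Q v b" for v a b
    using dep_upd[OF assms(2) m] .
  then show ?thesis
    using dfn_ex_upd[OF assms(3)[OF m], of m] by simp
qed

lemma dfn_all:
  assumes "finite I" "\<And>b. dep I (\<lambda>v. Q v b)" "\<And>m. m \<notin> I \<Longrightarrow> dfn (\<lambda>v. Q v (v m))"
  shows "dfn (\<lambda>v. \<forall>b. Q v b)"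
proof -
  have "dfn (\<lambda>v. \<exists>b. \<not> Q v b)"
    by (rule dfn_ex[OF assms(1)]) (auto intro: dep_intros(1) assms(2) dfn_not[OF assms(3)])
  from dfn_not[OF this] show ?thesis by simp
qed

lemma dfn_subst:
  assumes "dfn P" shows "dfn (\<lambda>v. P (v(i := v m)))"
proof (cases "m = i")
  case False
  then have "(\<exists>a. (v(i := a)) i = (v(i := a)) m \<and> P (v(i := a))) \<longleftrightarrow> P (v(i := v m))" for v
    by simp
  then show ?thesis
    using dfn_ex_upd[OF dfn_conj[OF dfn_eq(1) assms], of i i m] by simp
qed (use assms in simp)

lemma dfn_subst_const:
  assumes "dfn P" shows "dfn (\<lambda>v. P (v(i := c)))"
  using dfn_ex_upd[OF dfn_conj[OF dfn_eq(2)[of i c] assms], of i] by simp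

lemma dfn_subst_mem:
  "dfn (\<lambda>v. v \<in> A) \<Longrightarrow> dfn (\<lambda>v. v(i := v m) \<in> A)"
  "dfn (\<lambda>v. v \<in> A) \<Longrightarrow> dfn (\<lambda>v. v(i := c) \<in> A)"
  by (rule dfn_subst dfn_subst_const; assumption)+

lemmas dfn_basic = dfn_conj dfn_disj dfn_not dfn_imp dfn_less dfn_less_const dfn_const_less
  dfn_le dfn_eq dfn_const dfn_subst_mem

lemma dfn_block_ex:
  assumes "finite S" "dfn (\<lambda>v. v \<in> A)"
  shows "dfn (\<lambda>v. \<exists>w. (\<forall>k. k \<notin> S \<longrightarrow> w k = v k) \<and> w \<in> A)"
  using assms(1)
proof induction
  case empty
  have "(\<exists>w. (\<forall>k. k \<notin> {} \<longrightarrow> w k = v k) \<and> w \<in> A) \<longleftrightarrow> v \<in> A" for v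
    by (metis empty_iff ext)
  then show ?case using assms(2) by simp
next
  case (insert i S)
  have "(\<exists>w. (\<forall>k. k \<notin> insert i S \<longrightarrow> w k = v k) \<and> w \<in> A) \<longleftrightarrow>
        (\<exists>a w. (\<forall>k. k \<notin> S \<longrightarrow> w k = (v(i := a)) k) \<and> w \<in> A)" for v
  proof
    assume "\<exists>w. (\<forall>k. k \<notin> insert i S \<longrightarrow> w k = v k) \<and> w \<in> A"
    then obtain w where "\<forall>k. k \<notin> insert i S \<longrightarrow> w k = v k" "w \<in> A" by blast
    then show "\<exists>a w. (\<forall>k. k \<notin> S \<longrightarrow> w k = (v(i := a)) k) \<and> w \<in> A"
      by (intro exI[of _ "w i"] exI[of _ w]) auto
  next
    assume "\<exists>a w. (\<forall>k. k \<notin> S \<longrightarrow> w k = (v(i := a)) k) \<and> w \<in> A"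
    then show "\<exists>w. (\<forall>k. k \<notin> insert i S \<longrightarrow> w k = v k) \<and> w \<in> A"
      by (metis fun_upd_other insert_iff)
  qed
  then show ?case using dfn_ex_upd[OF insert.IH, of i] by simp
qed

lemma dfn_block_all:
  assumes "finite S" "dfn (\<lambda>v. v \<in> A)"
  shows "dfn (\<lambda>v. \<forall>w. (\<forall>k. k \<notin> S \<longrightarrow> w k = v k) \<longrightarrow> w \<in> A)"
proof -
  have *: "dfn (\<lambda>v. \<exists>w. (\<forall>k. k \<notin> S \<longrightarrow> w k = v k) \<and> w \<in> - A)"
    using dfn_mem(4)[OF assms(2)] by (rule dfn_block_ex[OF assms(1)])
  have eq: "(\<not> (\<exists>w. (\<forall>k. k \<notin> S \<longrightarrow> w k = v k) \<and> w \<in> - A)) \<longleftrightarrow>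
      (\<forall>w. (\<forall>k. k \<notin> S \<longrightarrow> w k = v k) \<longrightarrow> w \<in> A)" for v
    by blast
  show ?thesis using dfn_not[OF *] unfolding eq .
qed

text \<open>The end points \<open>l\<close> and \<open>u\<close> are functions, but only their
  finitely many values on \<open>I\<close> matter. These are stored in fresh coordinates, which are
  then quantified as one block.\<close>

lemma dfn_cint:
  assumes "finite I" "dfn (\<lambda>v. v \<in> X)"
  shows "dfn (\<lambda>v. v \<in> cint I X)"
proof -
  obtain J where J: "finite J" "dep J (\<lambda>v. v \<in> X)" using dfn_dep[OF assms(2)] by blast
  obtain M where M: "\<And>k. k \<in> I \<union> J \<Longrightarrow> k < M"
    using finite_nat_set_iff_bounded[of "I \<union> J"] assms(1) J(1) by auto
  \<comment> \<open>Even and odd offsets from \<open>M\<close> keep the coordinates for lower and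
    upper end points apart; starting at \<open>M\<close> they avoid \<open>I\<close> and
    \<open>J\<close>.\<close>
  define a b where "a i = M + 2 * i" and "b i = M + 2 * i + 1" for i :: nat
  define S where "S = a ` I \<union> b ` I"
  have Sge: "k \<ge> M" if "k \<in> S" for k using that by (auto simp: S_def a_def b_def)
  let ?between = "\<lambda>w. \<forall>i\<in>I. w (a i) < w i \<and> w i < w (b i)"
  let ?Z = "{w. ?between w \<longrightarrow> w \<in> X}"
  let ?Y = "{w. ?between w \<and> (\<forall>w'. (\<forall>k. k \<notin> I \<longrightarrow> w' k = w k) \<longrightarrow> w' \<in> ?Z)}"
  have between: "dfn ?between"
    by (intro dfn_ball_finite assms(1) dfn_basic)
  then have "dfn (\<lambda>v. v \<in> ?Z)"
    by (rule dfn_mem(5)[OF dfn_imp[OF _ assms(2)]])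
  then have "dfn (\<lambda>v. v \<in> ?Y)"
    by (rule dfn_mem(5)[OF dfn_conj[OF between dfn_block_all[OF assms(1)]]])
  then have *: "dfn (\<lambda>v. \<exists>w. (\<forall>k. k \<notin> S \<longrightarrow> w k = v k) \<and> w \<in> ?Y)"
    using assms(1) by (intro dfn_block_ex) (auto simp: S_def)
  have "v \<in> cint I X \<longleftrightarrow> (\<exists>w. (\<forall>k. k \<notin> S \<longrightarrow> w k = v k) \<and> w \<in> ?Y)" for v
  proof
    assume "v \<in> cint I X"
    then obtain l u where lu: "\<forall>i\<in>I. l i < v i \<and> v i < u i"
     "\<And>w. (\<forall>k. k \<notin> I \<longrightarrow> w k = v k) \<and> (\<forall>i\<in>I. l i < w i \<and> w i < u i) \<Longrightarrow> w \<in> X"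
      unfolding cint_def by blast
    define w where "w k = (if k \<notin> S then v k else if even (k - M) then l ((k - M) div 2)
       else u ((k - M) div 2))" for k
    have wa: "w (a i) = l i" and wb: "w (b i) = u i" and wi: "w i = v i" if "i \<in> I" for i
      using that Sge[of i] M[of i] by (auto simp: w_def S_def a_def b_def)
    have "w' \<in> X" if w': "\<forall>k. k \<notin> I \<longrightarrow> w' k = w k" "?between w'" for w'
    proof -
      define w'' where "w'' = (\<lambda>k. if k \<in> I then w' k else v k)"
      have "w' (a i) = w (a i)" "w' (b i) = w (b i)" if "i \<in> I" for i
        using w'(1) M[of "a i"] M[of "b i"] by (auto simp: a_def b_def)
      then have "w'' \<in> X"
        using w'(2) wa wb by (intro lu(2)) (auto simp: w''_def)
      moreover have "w'' k = w' k" if "k \<in> J" for k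
        using w'(1) M[of k] Sge[of k] that by (auto simp: w''_def w_def)
      ultimately show ?thesis using depD[OF J(2), of w'' w'] by blast
    qed
    then have "w \<in> ?Y" using lu(1) wa wb wi by auto
    moreover have "\<forall>k. k \<notin> S \<longrightarrow> w k = v k" by (simp add: w_def)
    ultimately show "\<exists>w. (\<forall>k. k \<notin> S \<longrightarrow> w k = v k) \<and> w \<in> ?Y" by blast
  next
    assume "\<exists>w. (\<forall>k. k \<notin> S \<longrightarrow> w k = v k) \<and> w \<in> ?Y"
    then obtain w where w: "\<forall>k. k \<notin> S \<longrightarrow> w k = v k" "?between w"
      "\<And>w'. (\<forall>k. k \<notin> I \<longrightarrow> w' k = w k) \<Longrightarrow> ?between w' \<Longrightarrow> w' \<in> X" by blast
    have wv: "w k = v k" if "k \<in> I \<union> J" for k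
      using w(1) M[OF that] Sge[of k] by force
    have nI: "a i \<notin> I" "b i \<notin> I" for i using M[of "a i"] M[of "b i"] by (auto simp: a_def b_def)
    show "v \<in> cint I X"
      unfolding cint_def mem_Collect_eq
    proof (rule exI[of _ "w \<circ> a"], rule exI[of _ "w \<circ> b"], intro conjI allI impI)
      show "\<forall>i\<in>I. (w \<circ> a) i < v i \<and> v i < (w \<circ> b) i" using w(2) wv by auto
      fix x assume x: "(\<forall>k. k \<notin> I \<longrightarrow> x k = v k) \<and> (\<forall>i\<in>I. (w \<circ> a) i < x i \<and> x i < (w \<circ> b) i)"
      define w' where "w' = (\<lambda>k. if k \<in> I then x k else w k)"
      have "w' \<in> X" using x nI by (intro w(3)) (auto simp: w'_def)
      moreover have "w' k = x k" if "k \<in> J" for k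
        using x wv[of k] that by (auto simp: w'_def)
      ultimately show "x \<in> X" using depD[OF J(2), of w' x] by blast
    qed
  qed
  with * show ?thesis by simp
qed

end

section \<open>Definable sets without interior are nowhere dense\<close>

lemma interior_eq_empty_box:
  fixes X :: "(nat \<Rightarrow> real) set"
  assumes "dep I (\<lambda>v. v \<in> interior X)" "interior X \<noteq> {}"
  obtains v e where "0 < e" "cbox_on I e v \<subseteq> interior X"
  using assms dep_open_contains_cbox_on[OF open_interior assms(1)] by blast

text \<open>A thin set is the graph of a partial function that expresses coordinate \<open>j\<close>
  through the others.\<close>

definition thin :: "nat \<Rightarrow> (nat \<Rightarrow> real) set \<Rightarrow> bool" where
  "thin j A \<longleftrightarrow> (\<forall>v b. v \<in> A \<and> v(j := b) \<in> A \<longrightarrow> b = v j)"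

abbreviation fibre :: "nat \<Rightarrow> (nat \<Rightarrow> real) set \<Rightarrow> (nat \<Rightarrow> real) \<Rightarrow> real set" where
  "fibre j A v \<equiv> {b. v(j := b) \<in> A}"

definition peel :: "nat \<Rightarrow> (nat \<Rightarrow> real) set \<Rightarrow> (nat \<Rightarrow> real) set" where
  "peel j A = {v \<in> A. \<exists>b. b < v j \<and> v(j := b) \<in> A}"

lemma thin_subset: "thin j A \<Longrightarrow> B \<subseteq> A \<Longrightarrow> thin j B"
  unfolding thin_def by blast

lemma thin_unique: "thin j A \<Longrightarrow> v(j := b) \<in> A \<Longrightarrow> v(j := c) \<in> A \<Longrightarrow> b = c"
  unfolding thin_def by (metis fun_upd_same fun_upd_upd)

lemma thin_diff_peel: "thin j (A - peel j A)"
  unfolding thin_def peel_def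
  by (auto, metis fun_upd_same fun_upd_triv fun_upd_upd linorder_neqE_linordered_idom)

lemma peel_subset: "peel j A \<subseteq> A"
  by (auto simp: peel_def)

lemma card_fibre_peel:
  assumes "finite (fibre j A v)" "card (fibre j A v) \<le> Suc k"
  shows "finite (fibre j (peel j A) v) \<and> card (fibre j (peel j A) v) \<le> k"
proof (cases "fibre j A v = {}")
  case True
  then have "fibre j (peel j A) v = {}" using peel_subset by auto
  then show ?thesis by (metis card.empty finite.emptyI zero_le)
next
  case False
  let ?m = "Min (fibre j A v)"
  have m: "?m \<in> fibre j A v" using Min_in[OF assms(1) False] .
  have "fibre j (peel j A) v \<subseteq> fibre j A v - {?m}"
  proof
    fix b assume "b \<in> fibre j (peel j A) v"
    then obtain c where "v(j := b) \<in> A" "c < b" "v(j := c) \<in> A"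
      by (auto simp: peel_def)
    moreover from this(3) have "?m \<le> c" using assms(1) by simp
    ultimately show "b \<in> fibre j A v - {?m}" by auto
  qed
  moreover have "card (fibre j A v - {?m}) \<le> k"
    using m assms by (simp add: card_Diff_singleton)
  ultimately show ?thesis
    using assms(1) by (meson card_mono finite_Diff finite_subset le_trans)
qed

text \<open>Replaces a bound on cardinality, which is not itself a formula, by emptiness of a fibre
  of a definable set.\<close>

lemma fibre_peel_funpow_empty:
  "finite (fibre j A v) \<Longrightarrow> card (fibre j A v) \<le> k \<Longrightarrow> fibre j ((peel j ^^ k) A) v = {}"
proof (induction k arbitrary: A)
  case 0
  then show ?case by simp
next
  case (Suc k)
  have "fibre j ((peel j ^^ k) (peel j A)) v = {}"
    using Suc.IH card_fibre_peel[OF Suc.prems] by blast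
  then show ?case by (simp only: funpow_Suc_right o_apply)
qed

section \<open>Peeling, and nowhere density by induction on the coordinates\<close>

context tame_definability
begin

lemma dfn_peel:
  assumes "dfn (\<lambda>v. v \<in> A)" shows "dfn (\<lambda>v. v \<in> peel j A)"
proof -
  obtain I where I: "finite I" "dep I (\<lambda>v. v \<in> A)" using dfn_dep[OF assms] by blast
  have "dfn (\<lambda>v. \<exists>b. b < v j \<and> v(j := b) \<in> A)"
  proof (rule dfn_ex)
    show "finite (insert j I)" using I by simp
    have "dep (insert j I) (\<lambda>v. v \<in> A)" using dep_mono[OF I(2)] by blast
    then show "dep (insert j I) (\<lambda>v. b < v j \<and> v(j := b) \<in> A)" for b
      by (intro dep_intros dep_upd_mem dep_simple) simp_all
    show "dfn (\<lambda>v. v m < v j \<and> v(j := v m) \<in> A)" for m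
      by (intro dfn_basic assms)
  qed
  then show ?thesis unfolding peel_def using dfn_conj[OF assms] by simp
qed

lemma dep_peel:
  assumes "dep J (\<lambda>v. v \<in> A)" "j \<in> J" shows "dep J (\<lambda>v. v \<in> peel j A)"
  unfolding peel_def mem_Collect_eq
  using assms by (intro dep_intros dep_upd_mem dep_simple) (simp_all add: insert_absorb)

lemma dfn_peel_funpow: "dfn (\<lambda>v. v \<in> A) \<Longrightarrow> dfn (\<lambda>v. v \<in> (peel j ^^ k) A)"
  by (induction k) (simp_all add: dfn_peel)

lemma dep_peel_funpow:
  "dep J (\<lambda>v. v \<in> A) \<Longrightarrow> j \<in> J \<Longrightarrow> dep J (\<lambda>v. v \<in> (peel j ^^ k) A)"
  by (induction k) (simp_all add: dep_peel)

text \<open>Each step of peeling removes the least points of the fibres, and these form a thin set.\<close>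

lemma peel_decomposition:
  assumes "dfn (\<lambda>v. v \<in> A)" "dep J (\<lambda>v. v \<in> A)" "j \<in> J"
  shows "\<exists>\<A>. finite \<A> \<and> A = \<Union>\<A> \<union> (peel j ^^ k) A \<and>
    (\<forall>L\<in>\<A>. dfn (\<lambda>v. v \<in> L) \<and> dep J (\<lambda>v. v \<in> L) \<and> thin j L)"
proof (induction k)
  case 0
  show ?case by (intro exI[of _ "{}"]) simp
next
  case (Suc k)
  then obtain \<A> where \<A>: "finite \<A>" "A = \<Union>\<A> \<union> (peel j ^^ k) A"
    "\<forall>L\<in>\<A>. dfn (\<lambda>v. v \<in> L) \<and> dep J (\<lambda>v. v \<in> L) \<and> thin j L" by blast
  let ?P = "(peel j ^^ k) A"
  let ?L = "?P - peel j ?P"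
  have "dfn (\<lambda>v. v \<in> ?L)"
    by (intro dfn_mem dfn_peel dfn_peel_funpow assms)
  moreover have "dep J (\<lambda>v. v \<in> ?L)"
    unfolding Diff_iff by (intro dep_intros dep_peel dep_peel_funpow assms)
  moreover have "thin j ?L" by (rule thin_diff_peel)
  moreover have "A = \<Union>(insert ?L \<A>) \<union> (peel j ^^ Suc k) A"
    using \<A>(2) peel_subset[of j ?P] by auto
  ultimately show ?case
    using \<A>(1,3) by (intro exI[of _ "insert ?L \<A>"]) auto
qed

lemma dfn_dep_fibre_ex:
  assumes "dfn (\<lambda>v. v \<in> A)" "dep (insert j I) (\<lambda>v. v \<in> A)"
  shows "dfn (\<lambda>v. \<exists>b. v(j := b) \<in> A)" "dep I (\<lambda>v. \<exists>b. v(j := b) \<in> A)"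
  using assms dfn_ex_upd[OF assms(1)] by (auto intro!: dep_intros dep_upd_mem dep_simple)

lemma dfn_cbox_on: "finite I \<Longrightarrow> dfn (\<lambda>w. w \<in> cbox_on I e v)"
proof -
  have "w \<in> cbox_on I e v \<longleftrightarrow> (\<forall>i\<in>I. w i < v i + e \<and> v i - e < w i)" for w
    by (auto simp: cbox_on_def abs_less_iff algebra_simps)
  moreover assume "finite I"
  then have "dfn (\<lambda>w. \<forall>i\<in>I. w i < v i + e \<and> v i - e < w i)"
    by (intro dfn_ball_finite dfn_basic)
  ultimately show ?thesis by simp
qed

text \<open>False for arbitrary sets, such as a dense set with dense complement. The coordinate set
  is a parameter because the property is proved by adding one coordinate at a time.\<close>

definition nowhere_dense_property :: "nat set \<Rightarrow> bool" where
  "nowhere_dense_property I \<longleftrightarrow>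
    (\<forall>A. dfn (\<lambda>v. v \<in> A) \<and> dep I (\<lambda>v. v \<in> A) \<and> interior A = {} \<longrightarrow> interior (closure A) = {})"

lemma nowhere_dense_propertyD:
  "nowhere_dense_property I \<Longrightarrow> dfn (\<lambda>v. v \<in> A) \<Longrightarrow> dep I (\<lambda>v. v \<in> A) \<Longrightarrow>
    interior A = {} \<Longrightarrow> interior (closure A) = {}"
  by (auto simp: nowhere_dense_property_def)

text \<open>A box inside the frontier would meet \<open>X\<close> in a set that is dense in the box
  but has no interior, and the property excludes this.\<close>

lemma interior_frontier_empty:
  assumes "nowhere_dense_property I" "finite I" "dfn (\<lambda>v. v \<in> X)" "dep I (\<lambda>v. v \<in> X)"
  shows "interior (frontier X) = {}"
proof (rule ccontr)
  assume "interior (frontier X) \<noteq> {}"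
  then obtain v e where ve: "0 < e" "cbox_on I e v \<subseteq> interior (frontier X)"
    using interior_eq_empty_box[OF dep_interior[OF dep_frontier[OF assms(4)]]] by blast
  let ?W = "cbox_on I e v"
  have W: "open ?W" "?W \<subseteq> closure X" "?W \<inter> interior X = {}"
    using ve(2) interior_subset[of "frontier X"] open_cbox_on[OF assms(2)]
    by (auto simp: frontier_def)
  have "interior (X \<inter> ?W) = {}"
    using W(3) interior_mono[of "X \<inter> ?W" X] interior_subset[of "X \<inter> ?W"] by blast
  moreover have "dfn (\<lambda>v. v \<in> X \<inter> ?W)"
    by (intro dfn_mem assms dfn_cbox_on)
  moreover have "dep I (\<lambda>v. v \<in> X \<inter> ?W)"
    unfolding Int_iff by (intro dep_intros assms dep_cbox_on) simp
  ultimately have "interior (closure (X \<inter> ?W)) = {}"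
    using nowhere_dense_propertyD[OF assms(1)] by blast
  moreover have "?W \<subseteq> closure (X \<inter> ?W)"
    using W(1,2) open_Int_closure_subset[OF W(1), of X] by (auto simp: Int_commute)
  ultimately show False
    using interior_maximal[OF _ W(1)] centre_in_cbox_on[OF ve(1), of v I] by blast
qed

text \<open>At a point off the frontiers of the domain and of all sublevel sets with rational bound, a thin
  set is locally the graph of a continuous function.\<close>

lemma thin_nowhere_dense:
  assumes N: "nowhere_dense_property I" and "finite I" and L: "dfn (\<lambda>v. v \<in> L)"
    "dep (insert j I) (\<lambda>v. v \<in> L)" "thin j L" and j: "j \<notin> I"
  shows "interior (closure L) = {}"
proof (rule ccontr)
  assume ne: "interior (closure L) \<noteq> {}"
  define Dm where "Dm = {v. \<exists>b. v(j := b) \<in> L}"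
  define Lc where "Lc c = {v. \<exists>b. v(j := b) \<in> L \<inter> {v. v j < c}}" for c
  have "dfn (\<lambda>v. v \<in> L \<inter> {v. v j < c})" "dep (insert j I) (\<lambda>v. v \<in> L \<inter> {v. v j < c})" for c
    using L by (auto intro!: dfn_basic dep_intros)
  from dfn_dep_fibre_ex[OF this]
  have Lc: "dfn (\<lambda>v. v \<in> Lc c)" "dep I (\<lambda>v. v \<in> Lc c)" for c
    by (simp_all add: Lc_def)
  have Dm: "dfn (\<lambda>v. v \<in> Dm)" "dep I (\<lambda>v. v \<in> Dm)"
    using dfn_dep_fibre_ex[OF L(1,2)] by (simp_all add: Dm_def)
  let ?\<F> = "insert (frontier Dm) (range (\<lambda>q::rat. frontier (Lc (of_rat q))))"
  have "interior (\<Union>?\<F>) = {}"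
  proof (rule Baire_fun)
    show "countable ?\<F>" by simp
    show "closed T \<and> interior T = {}" if "T \<in> ?\<F>" for T
      using that interior_frontier_empty[OF N \<open>finite I\<close>] Lc Dm by auto
  qed
  then obtain v0 where v0: "v0 \<in> interior (closure L)" "v0 \<notin> \<Union>?\<F>"
    using ne interior_maximal[OF _ open_interior, of "closure L" "\<Union>?\<F>"] by blast
  have fr: "v0(j := b) \<notin> frontier Dm" "v0(j := b) \<notin> frontier (Lc (of_rat q))" for b q
    using v0(2) dep_upd[OF dep_frontier[OF Dm(2)] j] dep_upd[OF dep_frontier[OF Lc(2)] j] by auto
  show False
  proof (cases "v0 \<in> Dm")
    case False
    then have "v0 \<notin> closure Dm"
      using fr(1)[of "v0 j"] interior_subset[of Dm] by (auto simp: frontier_def)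
    moreover have "L \<subseteq> Dm" by (auto simp: Dm_def) (metis fun_upd_triv)
    ultimately show False
      using closure_mono v0(1) interior_subset by blast
  next
    case True
    then obtain b0 where b0: "v0(j := b0) \<in> L" by (auto simp: Dm_def)
    obtain e where e: "0 < e" "cbox_on (insert j I) e v0 \<subseteq> interior (closure L)"
      using dep_open_contains_cbox_on[OF open_interior dep_interior[OF dep_closure[OF L(2)]] v0(1)]
      by blast
    \<comment> \<open>The interior of \<open>closure L\<close> contains a segment in direction
      \<open>j\<close> around \<open>v0\<close>. So \<open>closure L\<close> has a point over the
      same base point at a height \<open>b1\<close> other than the value \<open>b0\<close>; a
      rational level between the two heights produces the contradiction.\<close>
    have "\<exists>b1. b1 \<noteq> b0 \<and> \<bar>b1 - v0 j\<bar> < e"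
      using e(1) by (cases "b0 = v0 j") (auto intro: exI[of _ "v0 j + e / 2"] exI[of _ "v0 j"])
    then obtain b1 where b1: "b1 \<noteq> b0" "\<bar>b1 - v0 j\<bar> < e" by blast
    define v1 where "v1 = v0(j := b1)"
    have "v1 \<in> cbox_on (insert j I) e v0" using b1 e(1) by (simp add: v1_def cbox_on_def)
    then have v1: "v1 \<in> closure L" using e(2) interior_subset by blast
    show False
    proof (cases "b0 < b1")
      case True
      then obtain q where q: "b0 < of_rat q" "of_rat q < b1" using of_rat_dense by blast
      have "v1 \<in> Lc (of_rat q)" using b0 q(1) by (auto simp: Lc_def v1_def)
      then have "v1 \<in> interior (Lc (of_rat q))"
        using fr(2)[of b1 q] closure_subset[of "Lc (of_rat q)"]
        by (auto simp: frontier_def v1_def)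
      moreover have "open (interior (Lc (of_rat q)) \<inter> {v. of_rat q < v j})"
        by (intro open_Int open_Collect_less continuous_intros open_interior)
      ultimately have "interior (Lc (of_rat q)) \<inter> {v. of_rat q < v j} \<inter> L \<noteq> {}"
        using v1 q(2) open_Int_closure_eq_empty[of "interior (Lc (of_rat q)) \<inter> {v. of_rat q < v j}" L]
        by (auto simp: v1_def)
      then obtain w where "w \<in> L" "w \<in> Lc (of_rat q)" "of_rat q < w j"
        using interior_subset by blast
      then show False
        using L(3) unfolding thin_def Lc_def by (auto, fastforce)
    next
      case False
      then have "b1 < b0" using b1 by simp
      then obtain q where q: "b1 < of_rat q" "of_rat q < b0" using of_rat_dense by blast
      have "v1 \<notin> Lc (of_rat q)"
      proof
        assume "v1 \<in> Lc (of_rat q)"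
        then obtain c where "v0(j := c) \<in> L" "c < of_rat q" by (auto simp: Lc_def v1_def)
        then show False using thin_unique[OF L(3) b0] q(2) by force
      qed
      then have "v1 \<notin> closure (Lc (of_rat q))"
        using fr(2)[of b1 q] interior_subset[of "Lc (of_rat q)"]
        by (auto simp: frontier_def v1_def)
      moreover have "open (- closure (Lc (of_rat q)) \<inter> {v. v j < of_rat q})"
        by (intro open_Int open_Collect_less continuous_intros) auto
      ultimately have "- closure (Lc (of_rat q)) \<inter> {v. v j < of_rat q} \<inter> L \<noteq> {}"
        using v1 q(1) open_Int_closure_eq_empty[of "- closure (Lc (of_rat q)) \<inter> {v. v j < of_rat q}" L]
        by (auto simp: v1_def)
      then obtain w where w: "w \<in> L" "w \<notin> Lc (of_rat q)" "w j < of_rat q"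
        using closure_subset by blast
      then have "w(j := w j) \<in> L \<inter> {v. v j < of_rat q}" by simp
      then show False using w(2) unfolding Lc_def by blast
    qed
  qed
qed

text \<open>A set without interior is contained in its frontier, which is finite within a bounded
  interval.\<close>

lemma finite_fibre_of_interior_empty:
  assumes "dfn (\<lambda>v. v \<in> A)" "fibre j A v \<subseteq> {-r..r}" "interior (fibre j A v) = {}"
  shows "finite (fibre j A v)"
proof -
  have "fibre j A v \<subseteq> frontier (fibre j A v) \<inter> {-r..r}"
    using assms(2,3) closure_subset by (fastforce simp: frontier_def)
  then show ?thesis
    using finite_frontier_fibre[OF assms(1)] finite_subset by blast
qed

definition fat :: "nat \<Rightarrow> (nat \<Rightarrow> real) set \<Rightarrow> (nat \<Rightarrow> real) set" where
  "fat j A = {v. interior (fibre j A v) \<noteq> {}}"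

lemma fat_eq: "fat j A = {v. \<exists>p q. p < q \<and> (\<forall>b. p < b \<and> b < q \<longrightarrow> v(j := b) \<in> A)}"
proof -
  have "interior S \<noteq> {} \<longleftrightarrow> (\<exists>p q. p < q \<and> {p<..<q} \<subseteq> S)" for S :: "real set"
  proof
    assume "interior S \<noteq> {}"
    then obtain x where "x \<in> interior S" by blast
    then obtain e where "0 < e" "ball x e \<subseteq> S" using mem_interior by blast
    then show "\<exists>p q. p < q \<and> {p<..<q} \<subseteq> S"
      by (intro exI[of _ "x - e"] exI[of _ "x + e"]) (auto simp: ball_eq_greaterThanLessThan)
  next
    assume "\<exists>p q. p < q \<and> {p<..<q} \<subseteq> S"
    then obtain p q where "p < q" "{p<..<q} \<subseteq> S" by blast
    moreover from this(1) obtain x where "p < x" "x < q" using dense by blast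
    ultimately show "interior S \<noteq> {}"
      using interiorI[of "{p<..<q}" x S] by auto
  qed
  then show ?thesis by (auto simp: fat_def subset_iff)
qed

lemma dfn_fat:
  assumes "dfn (\<lambda>v. v \<in> A)" shows "dfn (\<lambda>v. v \<in> fat j A)"
proof -
  obtain I where I: "finite I" "dep I (\<lambda>v. v \<in> A)" using dfn_dep[OF assms] by blast
  have dep: "dep (insert j (J \<union> I)) (\<lambda>v. v \<in> A)" for J by (rule dep_mono[OF I(2)]) blast
  have 1: "dfn (\<lambda>v. \<forall>b. v m < b \<and> b < v m' \<longrightarrow> v(j := b) \<in> A)" for m m'
  proof (rule dfn_all)
    show "finite ({m, m'} \<union> I)" using I by simp
    show "dep ({m, m'} \<union> I) (\<lambda>v. v m < b \<and> b < v m' \<longrightarrow> v(j := b) \<in> A)" for b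
      by (intro dep_intros dep_upd_mem dep dep_simple) simp_all
    show "dfn (\<lambda>v. v m < v m'' \<and> v m'' < v m' \<longrightarrow> v(j := v m'') \<in> A)" for m''
      by (intro dfn_basic assms)
  qed
  have 2: "dfn (\<lambda>v. \<exists>q. v m < q \<and> (\<forall>b. v m < b \<and> b < q \<longrightarrow> v(j := b) \<in> A))" for m
  proof (rule dfn_ex)
    show "finite ({m} \<union> I)" using I by simp
    show "dep ({m} \<union> I) (\<lambda>v. v m < q \<and> (\<forall>b. v m < b \<and> b < q \<longrightarrow> v(j := b) \<in> A))" for q
      by (intro dep_intros dep_upd_mem dep dep_simple) simp_all
    show "dfn (\<lambda>v. v m < v m' \<and> (\<forall>b. v m < b \<and> b < v m' \<longrightarrow> v(j := b) \<in> A))" for m'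
      by (intro dfn_basic 1)
  qed
  have "dfn (\<lambda>v. \<exists>p q. p < q \<and> (\<forall>b. p < b \<and> b < q \<longrightarrow> v(j := b) \<in> A))"
  proof (rule dfn_ex)
    show "dep I (\<lambda>v. \<exists>q. p < q \<and> (\<forall>b. p < b \<and> b < q \<longrightarrow> v(j := b) \<in> A))" for p
      using dep[of "{}"] by (intro dep_intros dep_upd_mem dep_simple) simp_all
  qed (rule I 2)+
  then show ?thesis by (simp add: fat_eq)
qed

lemma dep_fat:
  assumes "dep (insert j I) (\<lambda>v. v \<in> A)" shows "dep I (\<lambda>v. v \<in> fat j A)"
  unfolding fat_eq mem_Collect_eq
  using assms by (intro dep_intros dep_upd_mem dep_simple) simp_all

text \<open>An interval in a fibre contains one with rational end points, so countably many sets
  \<open>B p q\<close> cover \<open>fat j A\<close>. If one of them had interior, \<open>A\<close>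
  would contain an open product; so each is nowhere dense by the property for \<open>I\<close>, and
  the category theorem applies.\<close>

lemma interior_fat_empty:
  assumes N: "nowhere_dense_property I" and "finite I" and A: "dfn (\<lambda>v. v \<in> A)"
    "dep (insert j I) (\<lambda>v. v \<in> A)" "interior A = {}" and j: "j \<notin> I"
  shows "interior (fat j A) = {}"
proof -
  define B where "B p q = {v. \<forall>b. p < b \<and> b < q \<longrightarrow> v(j := b) \<in> A}" for p q
  have B: "dfn (\<lambda>v. v \<in> B p q)" "dep I (\<lambda>v. v \<in> B p q)" for p q
  proof -
    have "dfn (\<lambda>v. \<not> (p < v j \<and> v j < q \<longrightarrow> v \<in> A))"
      by (intro dfn_basic A)
    from dfn_not[OF dfn_ex_upd[OF this, of j]]
    moreover have "(\<not> (\<exists>a. \<not> (p < (v(j := a)) j \<and> (v(j := a)) j < q \<longrightarrow> v(j := a) \<in> A))) \<longleftrightarrow>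
        v \<in> B p q" for v
      by (simp add: B_def) blast
    ultimately show "dfn (\<lambda>v. v \<in> B p q)" by (simp only:)
    show "dep I (\<lambda>v. v \<in> B p q)"
      unfolding B_def mem_Collect_eq using A(2) by (intro dep_intros dep_upd_mem dep_simple)
  qed
  let ?\<G> = "(\<lambda>(p, q). B (of_rat p) (of_rat q)) ` {(p, q). p < q}"
  have "interior (B p q) = {}" if "p < q" for p q
  proof (rule ccontr)
    assume "interior (B p q) \<noteq> {}"
    then obtain v where v: "v \<in> interior (B p q)" by blast
    obtain b where b: "p < b" "b < q" using dense[OF \<open>p < q\<close>] by blast
    let ?U = "interior (B p q) \<inter> ({v. p < v j} \<inter> {v. v j < q})"
    have "open ?U"
      by (intro open_Int open_Collect_less continuous_intros open_interior)
    moreover have "v(j := b) \<in> ?U"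
      using v b dep_upd[OF dep_interior[OF B(2)] j] by simp
    moreover have "?U \<subseteq> A"
    proof
      fix w assume "w \<in> ?U"
      then have "w \<in> B p q" "p < w j" "w j < q" using interior_subset by auto
      then have "w(j := w j) \<in> A" unfolding B_def by blast
      then show "w \<in> A" by simp
    qed
    ultimately show False using A(3) interior_maximal by blast
  qed
  then have "interior (closure T) = {}" if T: "T \<in> ?\<G>" for T
  proof -
    obtain p q where "T = B (of_rat p) (of_rat q)" "p < q" using T by auto
    then show ?thesis
      using nowhere_dense_propertyD[OF N B] \<open>\<And>p q. p < q \<Longrightarrow> interior (B p q) = {}\<close>
      by (simp add: of_rat_less)
  qed
  moreover have "fat j A \<subseteq> \<Union>?\<G>"
  proof
    fix v assume "v \<in> fat j A"
    then obtain p q where pq: "p < q" "\<And>b. p < b \<and> b < q \<Longrightarrow> v(j := b) \<in> A"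
      by (auto simp: fat_eq)
    obtain p' where p': "p < of_rat p'" "of_rat p' < q" using of_rat_dense pq(1) by blast
    obtain q' where q': "of_rat p' < (of_rat q' :: real)" "of_rat q' < q" using of_rat_dense p'(2) by blast
    have "v \<in> B (of_rat p') (of_rat q')" using pq(2) p' q' by (auto simp: B_def)
    then show "v \<in> \<Union>?\<G>" using q'(1) by (auto simp: of_rat_less)
  qed
  moreover have "countable ?\<G>" by simp
  ultimately show ?thesis
    using Baire_nowhere_dense[of ?\<G>] by blast
qed

text \<open>Suppose \<open>closure A\<close> contains a box. Over its base, the fibres of
  \<open>A\<close> in the box are finite except over the nowhere dense set \<open>fat\<close>. By
  the category theorem some fixed number \<open>k\<close> of peelings exhausts the fibres over an
  open set. There \<open>A\<close> is a finite union of thin sets, which are nowhere dense: a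
  contradiction.\<close>

lemma nowhere_dense_property_insert:
  assumes N: "nowhere_dense_property I" and fin: "finite I" and j: "j \<notin> I"
  shows "nowhere_dense_property (insert j I)"
  unfolding nowhere_dense_property_def
proof (intro allI impI, elim conjE, rule ccontr)
  fix A assume A: "dfn (\<lambda>v. v \<in> A)" "dep (insert j I) (\<lambda>v. v \<in> A)" "interior A = {}"
    and "interior (closure A) \<noteq> {}"
  then obtain v0 e where e: "0 < e" "cbox_on (insert j I) e v0 \<subseteq> interior (closure A)"
    using interior_eq_empty_box[OF dep_interior[OF dep_closure[OF A(2)]]] by blast
  let ?W = "cbox_on (insert j I) e v0" and ?V = "cbox_on I e v0"
  have opW: "open ?W" and opV: "open ?V" using open_cbox_on fin by auto
  \<comment> \<open>Truncation to the box makes the fibres bounded, hence finite wherever they have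
    no interior.\<close>
  define A' where "A' = A \<inter> ?W"
  have A': "dfn (\<lambda>v. v \<in> A')" "dep (insert j I) (\<lambda>v. v \<in> A')"
  proof -
    show "dfn (\<lambda>v. v \<in> A')"
      unfolding A'_def using fin by (intro dfn_mem dfn_cbox_on A) simp
    show "dep (insert j I) (\<lambda>v. v \<in> A')"
      unfolding A'_def Int_iff by (intro dep_intros dep_cbox_on A order_refl)
  qed
  have A'_int: "interior A' = {}"
    using A(3) interior_mono[of A' A] by (auto simp: A'_def)
  define C where "C k = {v. \<not> (\<exists>b. v(j := b) \<in> (peel j ^^ k) A')} \<inter> ?V" for k
  have C: "dfn (\<lambda>v. v \<in> C k)" "dep I (\<lambda>v. v \<in> C k)" for k
    unfolding C_def Int_iff mem_Collect_eq
    by (intro dfn_basic dfn_ex_upd dfn_peel_funpow A' dfn_cbox_on fin)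
      (intro dep_intros dep_upd_mem dep_peel_funpow A' dep_cbox_on dep_simple order_refl insertI1)
  have "?V \<subseteq> fat j A' \<union> (\<Union>k. C k)"
  proof
    fix v assume v: "v \<in> ?V"
    show "v \<in> fat j A' \<union> (\<Union>k. C k)"
    proof (cases "v \<in> fat j A'")
      case False
      have bd: "fibre j A' v \<subseteq> {-(\<bar>v0 j\<bar> + e)..\<bar>v0 j\<bar> + e}"
        by (auto simp: A'_def cbox_on_def)
      then have fin': "finite (fibre j A' v)"
        using False by (intro finite_fibre_of_interior_empty[OF A'(1) bd]) (simp add: fat_def)
      have "v \<in> C (card (fibre j A' v))"
        using fibre_peel_funpow_empty[OF fin' order_refl] v by (auto simp: C_def)
      then show ?thesis by blast
    qed simp
  qed
  then have V: "?V \<subseteq> \<Union>(insert (fat j A') (range C))" by auto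
  have "\<exists>k. interior (C k) \<noteq> {}"
  proof (rule ccontr)
    assume "\<nexists>k. interior (C k) \<noteq> {}"
    moreover have "interior (closure (fat j A')) = {}"
      using interior_fat_empty[OF N fin A' A'_int j] dfn_fat[OF A'(1)] dep_fat[OF A'(2)]
      by (intro nowhere_dense_propertyD[OF N])
    ultimately have "interior (closure T) = {}" if "T \<in> insert (fat j A') (range C)" for T
      using that nowhere_dense_propertyD[OF N C] by auto
    moreover have "countable (insert (fat j A') (range C))" by simp
    ultimately have "interior ?V = {}" using Baire_nowhere_dense[OF _ _ V] by blast
    then show False using opV centre_in_cbox_on[OF e(1), of v0 I] by (simp add: interior_open)
  qed
  then obtain k v1 where v1: "v1 \<in> interior (C k)" by blast
  obtain \<A> where \<A>: "finite \<A>" "A' = \<Union>\<A> \<union> (peel j ^^ k) A'"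
    "\<forall>L\<in>\<A>. dfn (\<lambda>v. v \<in> L) \<and> dep (insert j I) (\<lambda>v. v \<in> L) \<and> thin j L"
    using peel_decomposition[OF A' insertI1, of k] by blast
  define G where "G = interior (C k) \<inter> ?W"
  have opO: "open G" unfolding G_def using opW by (intro open_Int open_interior)
  \<comment> \<open>\<open>C k\<close> is a cylinder in direction \<open>j\<close>, so the height of
    \<open>v1\<close> may be changed freely to bring the point into the box
    \<open>?W\<close>.\<close>
  have "v1(j := v0 j) \<in> interior (C k)"
    using v1 dep_upd[OF dep_interior[OF C(2)] j] by simp
  moreover have "v1(j := v0 j) \<in> ?W"
  proof -
    have "v1 \<in> ?V" using v1 interior_subset by (auto simp: C_def)
    then show ?thesis using e(1) by (auto simp: cbox_on_def)
  qed
  ultimately have neO: "G \<noteq> {}" by (auto simp: G_def)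
  have "G \<inter> A \<subseteq> \<Union>\<A>"
  proof
    fix w assume w: "w \<in> G \<inter> A"
    then have "w \<in> C k" using interior_subset by (auto simp: G_def)
    then have "w(j := w j) \<notin> (peel j ^^ k) A'" unfolding C_def by blast
    moreover have "w \<in> A'" using w by (auto simp: G_def A'_def)
    ultimately show "w \<in> \<Union>\<A>" using \<A>(2) by auto
  qed
  moreover have "G \<subseteq> closure (G \<inter> A)"
    using open_Int_closure_subset[OF opO, of A] e(2) interior_subset[of "closure A"]
    by (auto simp: G_def)
  ultimately have "G \<subseteq> closure (\<Union>\<A>)" using closure_mono by blast
  also have "closure (\<Union>\<A>) \<subseteq> \<Union>(closure ` \<A>)"
  proof (rule closure_minimal)
    show "\<Union>\<A> \<subseteq> \<Union>(closure ` \<A>)" by (meson UN_upper Union_least closure_subset order_trans)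
    show "closed (\<Union>(closure ` \<A>))" using \<A>(1) by (intro closed_Union) auto
  qed
  finally have "G \<subseteq> \<Union>(closure ` \<A>)" .
  moreover have "interior (\<Union>(closure ` \<A>)) = {}"
  proof (rule Baire_fun)
    show "countable (closure ` \<A>)" using \<A>(1) by (simp add: countable_finite)
    show "closed T \<and> interior T = {}" if "T \<in> closure ` \<A>" for T
      using that \<A>(3) thin_nowhere_dense[OF N fin _ _ _ j] by auto
  qed
  ultimately show False using interior_maximal[OF _ opO] neO by blast
qed

lemma interior_closure_empty:
  assumes "dfn (\<lambda>v. v \<in> A)" "interior A = {}"
  shows "interior (closure A) = {}"
proof -
  obtain I where I: "finite I" "dep I (\<lambda>v. v \<in> A)" using dfn_dep[OF assms(1)] by blast
  have "nowhere_dense_property I"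
    using I(1)
  proof induction
    case empty
    have "A = {} \<or> A = UNIV" if "dep {} (\<lambda>v. v \<in> A)" for A
      using that unfolding dep_def by auto
    then show ?case unfolding nowhere_dense_property_def by force
  next
    case (insert j I)
    then show ?case using nowhere_dense_property_insert by blast
  qed
  from nowhere_dense_propertyD[OF this assms(1) I(2) assms(2)] show ?thesis .
qed

end

section \<open>Definable sets and functions over finitely many coordinates\<close>

definition ov :: "nat set \<Rightarrow> (nat \<Rightarrow> real) \<Rightarrow> (nat \<Rightarrow> real) \<Rightarrow> nat \<Rightarrow> real" where
  "ov I w v = (\<lambda>k. if k \<in> I then w k else v k)"

definition slab :: "nat set \<Rightarrow> real \<Rightarrow> (nat \<Rightarrow> real) set" where
  "slab I r = {v. \<forall>i\<in>I. \<bar>v i\<bar> \<le> r}"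

lemma slab_mono: "J \<subseteq> I \<Longrightarrow> slab I r \<subseteq> slab J r"
  by (auto simp: slab_def)

lemma frontier_iff: "v \<notin> frontier X \<longleftrightarrow> v \<in> interior X \<or> v \<in> interior (- X)"
  by (auto simp: frontier_def closure_interior)

lemma not_frontierD:
  "v \<notin> frontier X \<Longrightarrow> v \<notin> X \<Longrightarrow> v \<in> interior (- X)"
  "v \<notin> frontier X \<Longrightarrow> v \<in> X \<Longrightarrow> v \<in> interior X"
  using interior_subset unfolding frontier_iff by blast+

lemma frontier_local:
  assumes "open U" "v \<in> U" "\<And>w. w \<in> U \<Longrightarrow> w \<in> X \<longleftrightarrow> w \<in> Y" "v \<notin> frontier Y"
  shows "v \<notin> frontier X"
proof -
  have "U \<inter> interior Y \<subseteq> interior X"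
    using assms(1,3) interior_subset[of Y] by (intro interior_maximal) auto
  moreover have "U \<inter> interior (- Y) \<subseteq> interior (- X)"
    using assms(1,3) interior_subset[of "- Y"] by (intro interior_maximal) auto
  ultimately show ?thesis using assms(2,4) unfolding frontier_iff by blast
qed

text \<open>The frontier in the directions \<open>I\<close> with the remaining coordinates frozen.
  Built from \<open>cint\<close>, it is definable jointly in those frozen coordinates, so they can
  serve as parameters.\<close>

definition cfrontier :: "nat set \<Rightarrow> (nat \<Rightarrow> real) set \<Rightarrow> (nat \<Rightarrow> real) set" where
  "cfrontier I X = - (cint I X \<union> cint I (- X))"

lemma cfrontier_section:
  assumes "finite I"
  shows "v \<in> cfrontier I X \<longleftrightarrow> v \<in> frontier {w. ov I w v \<in> X}"
  using frontier_iff[of v "{w. ov I w v \<in> X}"]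
  unfolding cfrontier_def Compl_iff Un_iff cint_interior_section[OF assms] ov_def[symmetric]
  by (auto simp: Collect_neg_eq)

section \<open>Path connectedness of graphs and of bands between graphs\<close>

lemma thin_graph_image:
  fixes g :: "(nat \<Rightarrow> real) \<Rightarrow> real"
  assumes "path_connected B" "continuous_on B g" "dep I (\<lambda>v. v \<in> B)" "dep I g" "i \<notin> I"
  shows "path_connected {v \<in> B. v i = g v}"
proof -
  have "(\<lambda>v. v(i := g v)) ` B = {v \<in> B. v i = g v}"
  proof
    show "(\<lambda>v. v(i := g v)) ` B \<subseteq> {v \<in> B. v i = g v}"
      using dep_upd[OF assms(3,5)] dep_upd[OF assms(4,5)] by auto
    show "{v \<in> B. v i = g v} \<subseteq> (\<lambda>v. v(i := g v)) ` B"
    proof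
      fix v assume "v \<in> {v \<in> B. v i = g v}"
      moreover from this have "v(i := g v) = v" by (auto simp: fun_eq_iff)
      ultimately show "v \<in> (\<lambda>v. v(i := g v)) ` B"
        by (metis (no_types, lifting) image_eqI mem_Collect_eq)
    qed
  qed
  moreover have "continuous_on B (\<lambda>v. v(i := g v))"
    by (intro continuous_on_fun_upd continuous_on_id assms)
  ultimately show ?thesis using path_connected_continuous_image assms(1) by metis
qed

text \<open>The band is the image of \<open>B\<close> times the open unit interval under affine
  interpolation between the two graphs. The arithmetic in \<open>F\<close> is that of the reals and
  lies outside the structure: the argument is purely topological.\<close>

lemma path_connected_band:
  fixes g h :: "(nat \<Rightarrow> real) \<Rightarrow> real"
  assumes B: "path_connected B" "dep I (\<lambda>v. v \<in> B)" and g: "continuous_on B g" "dep I g"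
    and h: "continuous_on B h" "dep I h" and i: "i \<notin> I" and less: "\<And>v. v \<in> B \<Longrightarrow> g v < h v"
  shows "path_connected {v \<in> B. g v < v i \<and> v i < h v}"
proof -
  define F where "F = (\<lambda>(v, t). v(i := g v + t * (h v - g v)) :: nat \<Rightarrow> real)"
  have "F ` (B \<times> {0<..<1}) = {v \<in> B. g v < v i \<and> v i < h v}"
  proof
    have "g v + t * (h v - g v) < h v" if "v \<in> B" "t < 1" for v t
    proof -
      have "t * (h v - g v) < 1 * (h v - g v)"
        using less[OF that(1)] that(2) by (intro mult_strict_right_mono) auto
      then show ?thesis by simp
    qed
    then show "F ` (B \<times> {0<..<1}) \<subseteq> {v \<in> B. g v < v i \<and> v i < h v}"
      using dep_upd[OF B(2) i] dep_upd[OF g(2) i] dep_upd[OF h(2) i] less by (auto simp: F_def)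
    show "{v \<in> B. g v < v i \<and> v i < h v} \<subseteq> F ` (B \<times> {0<..<1})"
    proof
      fix v assume v: "v \<in> {v \<in> B. g v < v i \<and> v i < h v}"
      define t where "t = (v i - g v) / (h v - g v)"
      have "t \<in> {0<..<1}" using v by (auto simp: t_def divide_simps)
      moreover have "g v + t * (h v - g v) = v i" using v by (auto simp: t_def)
      then have "F (v, t) = v" by (simp add: F_def)
      ultimately show "v \<in> F ` (B \<times> {0<..<1})"
        using v by (intro image_eqI[of _ _ "(v, t)"]) auto
    qed
  qed
  moreover have "continuous_on (B \<times> {0<..<1}) F"
  proof -
    have *: "continuous_on (B \<times> {0<..<1::real}) (\<lambda>x. f (fst x))"
      if "continuous_on B f" for f :: "(nat \<Rightarrow> real) \<Rightarrow> 'b :: topological_space"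
      using that by (rule continuous_on_compose2) (auto intro: continuous_on_fst continuous_on_id)
    show ?thesis
      unfolding F_def case_prod_beta
      by (intro continuous_on_fun_upd *[OF continuous_on_id] continuous_intros *[OF g(1)] *[OF h(1)])
  qed
  moreover have "path_connected (B \<times> {0<..<1::real})"
    using B(1) by (intro path_connected_Times) (auto intro: convex_imp_path_connected)
  ultimately show ?thesis using path_connected_continuous_image by metis
qed

lemma path_connected_UNIV_fun: "path_connected (UNIV :: (nat \<Rightarrow> real) set)"
  unfolding path_connected_def
proof (intro ballI)
  fix x y :: "nat \<Rightarrow> real"
  let ?g = "\<lambda>t k. (1 - t) * x k + t * y k"
  have "path ?g"
    unfolding path_def
    by (intro continuous_on_coordinatewise_then_product continuous_intros)
  moreover have "pathstart ?g = x" "pathfinish ?g = y"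
    by (auto simp: pathstart_def pathfinish_def)
  ultimately show "\<exists>g. path g \<and> path_image g \<subseteq> UNIV \<and> pathstart g = x \<and> pathfinish g = y"
    by blast
qed

text \<open>Boundedness makes the complement of \<open>S\<close> nonempty on both sides of
  \<open>x\<close>; the complement is closed, so its supremum below \<open>x\<close> and its infimum
  above \<open>x\<close> belong to it.\<close>

lemma component_interval_open_real:
  fixes S :: "real set"
  assumes "open S" "S \<subseteq> {-r..r}" "x \<in> S"
  obtains l u where "l < x" "x < u" "l \<notin> S" "u \<notin> S" "{l<..<u} \<subseteq> S"
proof -
  let ?L = "{..x} - S" and ?U = "{x..} - S"
  have x: "-r \<le> x" "x \<le> r" using assms(2,3) by auto
  have L: "closed ?L" "bdd_above ?L" "?L \<noteq> {}"
  proof -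
    show "closed ?L" using assms(1) by (simp add: closed_Diff)
    show "bdd_above ?L" by auto
    have "- r - 1 \<in> ?L" using x assms(2) by auto
    then show "?L \<noteq> {}" by blast
  qed
  have U: "closed ?U" "bdd_below ?U" "?U \<noteq> {}"
  proof -
    show "closed ?U" using assms(1) by (simp add: closed_Diff)
    show "bdd_below ?U" by auto
    have "r + 1 \<in> ?U" using x assms(2) by auto
    then show "?U \<noteq> {}" by blast
  qed
  have l: "Sup ?L \<in> ?L" using closed_contains_Sup[OF L(3,2,1)] .
  have u: "Inf ?U \<in> ?U" using closed_contains_Inf[OF U(3,2,1)] .
  have "{Sup ?L<..<Inf ?U} \<subseteq> S"
  proof
    fix y assume y: "y \<in> {Sup ?L<..<Inf ?U}"
    show "y \<in> S"
    proof (rule ccontr)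
      assume "y \<notin> S"
      then have "y \<in> ?L \<or> y \<in> ?U" by auto
      then show False using y cSup_upper[OF _ L(2)] cInf_lower[OF _ U(2)] by fastforce
    qed
  qed
  moreover have "Sup ?L \<noteq> x" "Inf ?U \<noteq> x" using l u assms(3) by auto
  ultimately show ?thesis using that[of "Sup ?L" "Inf ?U"] l u by auto
qed

section \<open>Definable cylinders, their decompositions, and definable functions\<close>

context tame_definability
begin

definition dset :: "nat set \<Rightarrow> (nat \<Rightarrow> real) set \<Rightarrow> bool" where
  "dset I A \<longleftrightarrow> dfn (\<lambda>v. v \<in> A) \<and> dep I (\<lambda>v. v \<in> A)"

lemma dsetD: "dset I A \<Longrightarrow> dfn (\<lambda>v. v \<in> A)" "dset I A \<Longrightarrow> dep I (\<lambda>v. v \<in> A)"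
  by (simp_all add: dset_def)

lemma dset_mono: "dset I A \<Longrightarrow> I \<subseteq> J \<Longrightarrow> dset J A"
  unfolding dset_def by (auto intro: dep_mono)

lemma dset_Int: "dset I A \<Longrightarrow> dset I B \<Longrightarrow> dset I (A \<inter> B)"
  unfolding dset_def Int_iff by (simp add: dfn_conj dep_intros(2))

lemma dset_Compl: "dset I A \<Longrightarrow> dset I (- A)"
  unfolding dset_def Compl_iff by (simp add: dfn_not dep_intros(1))

lemma dset_Diff: "dset I A \<Longrightarrow> dset I B \<Longrightarrow> dset I (A - B)"
  using dset_Int[OF _ dset_Compl, of I A B] by (simp add: Diff_eq)

lemma dset_Collect: "dfn P \<Longrightarrow> dep I P \<Longrightarrow> dset I {v. P v}"
  by (simp add: dset_def)

lemma dset_fibre_ex: "dset (insert j I) A \<Longrightarrow> dset I {v. \<exists>b. v(j := b) \<in> A}"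
  using dfn_dep_fibre_ex[of A j I] by (simp add: dset_def)

lemma dset_slab: "finite I \<Longrightarrow> dset I (slab I r)"
proof (rule dset_Collect[of "\<lambda>v. \<forall>i\<in>I. \<bar>v i\<bar> \<le> r", folded slab_def])
  assume "finite I"
  then have "dfn (\<lambda>v. \<forall>i\<in>I. v i \<le> r \<and> - r \<le> v i)"
    by (intro dfn_ball_finite dfn_basic)
  then show "dfn (\<lambda>v. \<forall>i\<in>I. \<bar>v i\<bar> \<le> r)"
    by (auto simp: abs_le_iff minus_le_iff)
qed (simp add: dep_def)

lemma dset_no_coordinates: "dset {} A \<Longrightarrow> A = {} \<or> A = UNIV"
  unfolding dset_def dep_def by auto

text \<open>The pieces may overlap, so decompositions combine by plain union.\<close>

definition decomp :: "nat set \<Rightarrow> ((nat \<Rightarrow> real) set \<Rightarrow> bool) \<Rightarrow> (nat \<Rightarrow> real) set \<Rightarrow> bool" where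
  "decomp I Q A \<longleftrightarrow> (\<exists>\<A>. finite \<A> \<and> A = \<Union>\<A> \<and> (\<forall>B\<in>\<A>. dset I B \<and> Q B))"

lemma decomp_empty: "decomp I Q {}"
  unfolding decomp_def by (intro exI[of _ "{}"]) simp

lemma decomp_single: "dset I A \<Longrightarrow> Q A \<Longrightarrow> decomp I Q A"
  unfolding decomp_def by (intro exI[of _ "{A}"]) simp

lemma decomp_Union:
  assumes "finite \<A>" "\<And>B. B \<in> \<A> \<Longrightarrow> decomp I Q B"
  shows "decomp I Q (\<Union>\<A>)"
proof -
  from assms(2) have "\<forall>B\<in>\<A>. \<exists>\<B>. finite \<B> \<and> B = \<Union>\<B> \<and> (\<forall>C\<in>\<B>. dset I C \<and> Q C)"
    by (simp add: decomp_def)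
  then obtain F where F: "\<forall>B\<in>\<A>. finite (F B) \<and> B = \<Union>(F B) \<and> (\<forall>C\<in>F B. dset I C \<and> Q C)"
    by metis
  have "\<Union>\<A> = (\<Union>B\<in>\<A>. \<Union>(F B))"
    using F by (metis (no_types, lifting) SUP_cong image_ident)
  then have "\<Union>\<A> = \<Union>(\<Union>(F ` \<A>))"
    by (simp only: UN_extend_simps UN_UN_flatten) auto
  then show ?thesis
    unfolding decomp_def using assms(1) F by (intro exI[of _ "\<Union>(F ` \<A>)"]) auto
qed

lemma decomp_Un: "decomp I Q A \<Longrightarrow> decomp I Q B \<Longrightarrow> decomp I Q (A \<union> B)"
  using decomp_Union[of "{A, B}" I Q] by auto

text \<open>Used mostly with \<open>I\<close> smaller than \<open>J\<close>: a decomposition of a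
  base set is lifted to the part of \<open>C\<close> that lies over it.\<close>

lemma decomp_refine:
  assumes "decomp I P A" "\<And>B. dset I B \<Longrightarrow> P B \<Longrightarrow> B \<subseteq> A \<Longrightarrow> decomp J Q (B \<inter> C)"
  shows "decomp J Q (A \<inter> C)"
proof -
  obtain \<A> where \<A>: "finite \<A>" "A = \<Union>\<A>" "\<And>B. B \<in> \<A> \<Longrightarrow> dset I B \<and> P B"
    using assms(1) unfolding decomp_def by metis
  have "decomp J Q (\<Union>((\<lambda>B. B \<inter> C) ` \<A>))"
    using \<A> assms(2) by (intro decomp_Union) auto
  moreover have "\<Union>((\<lambda>B. B \<inter> C) ` \<A>) = A \<inter> C" using \<A>(2) by auto
  ultimately show ?thesis by simp
qed

lemma decomp_refine':
  assumes "decomp I P A" "\<And>B. dset I B \<Longrightarrow> P B \<Longrightarrow> B \<subseteq> A \<Longrightarrow> decomp J Q B"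
  shows "decomp J Q A"
  using decomp_refine[OF assms(1), of J Q UNIV] assms(2) by simp

text \<open>The coordinate \<open>z\<close> holds the value. Allowing every \<open>z\<close>, even
  one in \<open>I\<close>, avoids side conditions in later substitutions; \<open>dfunI\<close>
  recovers all of them from a single fresh one.\<close>

definition dfun :: "nat set \<Rightarrow> ((nat \<Rightarrow> real) \<Rightarrow> real) \<Rightarrow> bool" where
  "dfun I f \<longleftrightarrow> dep I f \<and> (\<forall>z. dfn (\<lambda>v. v z = f v))"

lemma dfunD: "dfun I f \<Longrightarrow> dep I f" "dfun I f \<Longrightarrow> dfn (\<lambda>v. v z = f v)"
  by (simp_all add: dfun_def)

lemma dfunI:
  assumes "dep I f" "z \<notin> I" "dfn (\<lambda>v. v z = f v)"
  shows "dfun I f"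
  unfolding dfun_def
proof (intro conjI allI)
  fix z'
  have "dfn (\<lambda>v. (v(z := v z')) z = f (v(z := v z')))"
    by (rule dfn_subst[OF assms(3)])
  then show "dfn (\<lambda>v. v z' = f v)" by (simp add: dep_upd[OF assms(1,2)])
qed (rule assms)

lemma dfn_less_dfun:
  assumes "dfun I f" "dfun I g" "finite I" shows "dfn (\<lambda>v. f v < g v)"
proof -
  have 1: "dfn (\<lambda>v. v m < g v)" for m
  proof -
    have "dfn (\<lambda>v. \<exists>b. b = g v \<and> v m < b)"
    proof (rule dfn_ex)
      show "finite (insert m I)" using assms by simp
      show "dep (insert m I) (\<lambda>v. b = g v \<and> v m < b)" for b
        using dep_mono[OF dfunD(1)[OF assms(2)]] by (intro dep_intros dep_simple) auto
      show "dfn (\<lambda>v. v m' = g v \<and> v m < v m')" for m'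
        by (intro dfn_conj dfn_less dfunD(2)[OF assms(2)])
    qed
    then show ?thesis by simp
  qed
  have "dfn (\<lambda>v. \<exists>b. b = f v \<and> b < g v)"
  proof (rule dfn_ex)
    show "dep I (\<lambda>v. b = f v \<and> b < g v)" for b
      using dfunD(1)[OF assms(1)] dfunD(1)[OF assms(2)] by (intro dep_intros dep_simple)
    show "dfn (\<lambda>v. v m = f v \<and> v m < g v)" for m
      by (intro dfn_conj 1 dfunD(2)[OF assms(1)])
  qed (rule assms)
  then show ?thesis by simp
qed

lemma dfun_coordinate: "i \<in> I \<Longrightarrow> dfun I (\<lambda>v. v i)"
  by (simp add: dfun_def dfn_eq dep_simple)

lemma dfun_const: "dfun I (\<lambda>v. c)"
  by (simp add: dfun_def dfn_eq dep_simple)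

lemma dfun_mono: "dfun I f \<Longrightarrow> I \<subseteq> J \<Longrightarrow> dfun J f"
  unfolding dfun_def by (auto intro: dep_mono)

lemma dset_less_dfun:
  "dfun I f \<Longrightarrow> dfun I g \<Longrightarrow> finite I \<Longrightarrow> dset I {v. f v < g v}"
  by (intro dset_Collect dfn_less_dfun dep_intros dfunD)

lemma dfun_compose_upd:
  assumes f: "dfun (insert j I) f" and g: "dfun I g" and I: "finite I"
  shows "dfun I (\<lambda>v. f (v(j := g v)))"
proof -
  obtain z where z: "z \<notin> insert j I" using ex_new_if_finite[OF infinite_UNIV_nat] I by blast
  have "dfn (\<lambda>v. \<exists>b. b = g v \<and> v z = f (v(j := b)))"
  proof (rule dfn_ex)
    show "finite (insert z I)" using I by simp
    have fz: "dep (insert j (insert z I)) f" by (rule dep_mono[OF dfunD(1)[OF f]]) auto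
    have gz: "dep (insert z I) g" by (rule dep_mono[OF dfunD(1)[OF g]]) auto
    show "dep (insert z I) (\<lambda>v. b = g v \<and> v z = f (v(j := b)))" for b
      by (intro dep_intros gz dep_fun_upd[OF fz] dep_simple insertI1)
    have "dfn (\<lambda>v. v z = f (v(j := v m)))" for m
      using dfn_subst[OF dfunD(2)[OF f, of z], of j m] z by simp
    then show "dfn (\<lambda>v. v m = g v \<and> v z = f (v(j := v m)))" for m
      by (intro dfn_conj dfunD(2)[OF g])
  qed
  moreover have "dep I (\<lambda>v. f (v(j := g v)))"
    by (rule dep_fun_upd[OF dfunD(1)[OF f] dfunD(1)[OF g]])
  ultimately show ?thesis using z by (intro dfunI[of _ _ z]) auto
qed

text \<open>The value 0 off the domain makes the function total while keeping its graph
  definable.\<close>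

definition thin_fun :: "nat \<Rightarrow> (nat \<Rightarrow> real) set \<Rightarrow> (nat \<Rightarrow> real) \<Rightarrow> real" where
  "thin_fun j L v = (if \<exists>b. v(j := b) \<in> L then THE b. v(j := b) \<in> L else 0)"

lemma thin_fun_eq:
  assumes "thin j L" "v(j := b) \<in> L" shows "thin_fun j L v = b"
proof -
  have "(THE b. v(j := b) \<in> L) = b"
    using assms thin_unique[OF assms(1)] by (intro the_equality) blast+
  then show ?thesis using assms(2) by (auto simp: thin_fun_def)
qed

lemma thin_mem_iff:
  assumes "thin j L" shows "v \<in> L \<longleftrightarrow> (\<exists>b. v(j := b) \<in> L) \<and> v j = thin_fun j L v"
proof
  assume v: "v \<in> L"
  then have "v(j := v j) \<in> L" by simp
  then show "(\<exists>b. v(j := b) \<in> L) \<and> v j = thin_fun j L v" using thin_fun_eq[OF assms] by metis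
next
  assume "(\<exists>b. v(j := b) \<in> L) \<and> v j = thin_fun j L v"
  then obtain b where "v(j := b) \<in> L" "v j = b" using thin_fun_eq[OF assms] by metis
  then show "v \<in> L" by auto
qed

lemma dfun_thin_fun:
  assumes L: "dset (insert j I) L" "thin j L" and I: "finite I"
  shows "dfun I (thin_fun j L)"
proof -
  obtain z where z: "z \<notin> insert j I" using ex_new_if_finite[OF infinite_UNIV_nat] I by blast
  have "v z = thin_fun j L v \<longleftrightarrow> v(j := v z) \<in> L \<or> (\<not> (\<exists>b. v(j := b) \<in> L) \<and> v z = 0)" for v
  proof (cases "\<exists>b. v(j := b) \<in> L")
    case True
    then obtain b where b: "v(j := b) \<in> L" by blast
    have "v(j := v z) \<in> L \<longleftrightarrow> b = v z"
      using thin_unique[OF L(2) b, of "v z"] b by blast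
    then show ?thesis using thin_fun_eq[OF L(2) b] True by (simp only:) blast
  qed (simp add: thin_fun_def)
  moreover have "dfn (\<lambda>v. v(j := v z) \<in> L \<or> (\<not> (\<exists>b. v(j := b) \<in> L) \<and> v z = 0))"
    using dsetD[OF L(1)] by (intro dfn_basic dfn_ex_upd)
  ultimately have "dfn (\<lambda>v. v z = thin_fun j L v)" by simp
  moreover have "dep I (thin_fun j L)"
    unfolding dep_def
  proof (intro allI impI)
    fix v w :: "nat \<Rightarrow> real" assume eq: "\<forall>i\<in>I. v i = w i"
    have "v(j := b) \<in> L \<longleftrightarrow> w(j := b) \<in> L" for b
      using eq by (intro depD[OF dsetD(2)[OF L(1)]]) auto
    then show "thin_fun j L v = thin_fun j L w" by (simp only: thin_fun_def)
  qed
  ultimately show ?thesis using z by (intro dfunI[of _ _ z]) auto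
qed

lemma dfn_cfrontier: "finite I \<Longrightarrow> dfn (\<lambda>v. v \<in> X) \<Longrightarrow> dfn (\<lambda>v. v \<in> cfrontier I X)"
  unfolding cfrontier_def by (intro dfn_mem dfn_cint)

lemma interior_frontier_dfn:
  assumes "dfn (\<lambda>v. v \<in> X)" shows "interior (frontier X) = {}"
proof -
  obtain I where I: "finite I" "dep I (\<lambda>v. v \<in> X)" using dfn_dep[OF assms] by blast
  have "nowhere_dense_property I"
    unfolding nowhere_dense_property_def using interior_closure_empty by blast
  from interior_frontier_empty[OF this I(1) assms I(2)] show ?thesis .
qed

text \<open>If \<open>v\<close> is off the frontier of the sublevel set at each level other than
  \<open>f v\<close>, then strict inequalities between \<open>f v\<close> and a constant persist
  near \<open>v\<close>, which is continuity. The level \<open>f v\<close> itself must be left out,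
  as \<open>v\<close> may lie on that frontier even for continuous \<open>f\<close>. A bad level can
  be replaced by a rational one between it and \<open>f v\<close>, so the complement of
  \<open>G\<close> is meagre.\<close>

lemma continuity_set:
  assumes f: "dfun I f" and I: "finite I"
  obtains G where "dset I G" "continuous_on G f" "interior (- G) = {}"
proof -
  define S where "S c = {v. f v < c}" for c
  have S: "dset I (S c)" for c
    unfolding S_def using dset_less_dfun[OF f dfun_const I] .
  have depS: "dep I (\<lambda>v. v \<in> frontier (S c))" for c
    by (rule dep_frontier[OF dsetD(2)[OF S]])
  define G where "G = {v. \<forall>c. c \<noteq> f v \<longrightarrow> v \<notin> frontier (S c)}"
  have "dfn (\<lambda>v. \<forall>c. c \<noteq> f v \<longrightarrow> v \<notin> frontier (S c))"
  proof (rule dfn_all)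
    show "dep I (\<lambda>v. c \<noteq> f v \<longrightarrow> v \<notin> frontier (S c))" for c
      by (intro dep_intros depS dfunD(1)[OF f] dep_simple)
    fix m assume m: "m \<notin> I"
    \<comment> \<open>The level is held in the fresh coordinate \<open>m\<close>. Since
      \<open>cfrontier I\<close> moves only the coordinates in \<open>I\<close>, it computes the
      frontier of the sublevel set at the fixed level \<open>v m\<close>.\<close>
    have "f (ov I w v) = f w" for w v by (rule depD[OF dfunD(1)[OF f]]) (simp add: ov_def)
    then have "{w. ov I w v \<in> {w. f w < w m}} = S (v m)" for v
      using m by (simp add: S_def ov_def)
    then have "v \<in> cfrontier I {w. f w < w m} \<longleftrightarrow> v \<in> frontier (S (v m))" for v
      using cfrontier_section[OF I, of v "{w. f w < w m}"] by simp
    moreover have "dfn (\<lambda>v. v \<in> cfrontier I {w. f w < w m})"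
      using dsetD(1)[OF dset_less_dfun[of "insert m I" f "\<lambda>v. v m"]] dfun_mono[OF f, of "insert m I"] I
      by (intro dfn_cfrontier) (auto simp: dfun_coordinate)
    ultimately have "dfn (\<lambda>v. v \<in> frontier (S (v m)))" by simp
    then show "dfn (\<lambda>v. v m \<noteq> f v \<longrightarrow> v \<notin> frontier (S (v m)))"
      by (intro dfn_imp dfn_not dfunD(2)[OF f])
  qed (rule I)
  moreover have "dep I (\<lambda>v. \<forall>c. c \<noteq> f v \<longrightarrow> v \<notin> frontier (S c))"
    by (intro dep_intros depS dfunD(1)[OF f] dep_simple)
  ultimately have "dset I G" unfolding G_def by (rule dset_Collect)
  moreover have "continuous_on G f"
    unfolding continuous_on_def
  proof (intro ballI order_tendstoI)
    fix v a assume v: "v \<in> G" and a: "a < f v"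
    obtain c where c: "a < c" "c < f v" using dense[OF a] by blast
    have "v \<in> interior (- S c)"
      using v c(2) by (intro not_frontierD) (auto simp: G_def S_def)
    then have "\<forall>\<^sub>F x in nhds v. x \<in> interior (- S c)"
      by (intro eventually_nhds_in_open) auto
    moreover have "interior (- S c) \<subseteq> {x. a < f x}"
      using interior_subset[of "- S c"] c(1) by (auto simp: S_def)
    ultimately have "\<forall>\<^sub>F x in nhds v. a < f x"
      by (auto elim: eventually_mono)
    then show "\<forall>\<^sub>F x in at v within G. a < f x"
      by (rule filter_leD[OF at_within_le_nhds])
  next
    fix v a assume v: "v \<in> G" and a: "f v < a"
    have "v \<in> interior (S a)"
      using v a by (intro not_frontierD) (auto simp: G_def S_def)
    then have "\<forall>\<^sub>F x in nhds v. x \<in> interior (S a)"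
      by (intro eventually_nhds_in_open) auto
    moreover have "interior (S a) \<subseteq> {x. f x < a}"
      using interior_subset[of "S a"] by (auto simp: S_def)
    ultimately have "\<forall>\<^sub>F x in nhds v. f x < a"
      by (auto elim: eventually_mono)
    then show "\<forall>\<^sub>F x in at v within G. f x < a"
      by (rule filter_leD[OF at_within_le_nhds])
  qed
  moreover have "interior (- G) = {}"
  proof -
    let ?\<F> = "range (\<lambda>q::rat. frontier (S (of_rat q)))"
    have "interior (\<Union>?\<F>) = {}"
      using interior_frontier_dfn[OF dsetD(1)[OF S]] by (intro Baire_fun) auto
    moreover have "- G \<subseteq> \<Union>?\<F>"
    proof
      fix v assume "v \<in> - G"
      then obtain c where c: "c \<noteq> f v" "v \<in> frontier (S c)" by (auto simp: G_def)
      show "v \<in> \<Union>?\<F>"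
      proof (rule ccontr)
        assume v: "v \<notin> \<Union>?\<F>"
        show False
        proof (cases "c < f v")
          case True
          then obtain q where q: "c < of_rat q" "of_rat q < f v" using of_rat_dense by blast
          have "v \<notin> frontier (S (of_rat q))" using v by blast
          then have "v \<in> interior (- S (of_rat q))"
            using q(2) by (intro not_frontierD) (auto simp: S_def)
          moreover have "- S (of_rat q) \<subseteq> - S c" using q(1) by (auto simp: S_def)
          ultimately show False
            using c(2) interior_mono frontier_iff by blast
        next
          case False
          with c(1) have "f v < c" by simp
          then obtain q where q: "f v < of_rat q" "of_rat q < c" using of_rat_dense by blast
          have "v \<notin> frontier (S (of_rat q))" using v by blast
          then have "v \<in> interior (S (of_rat q))"
            using q(1) by (intro not_frontierD) (auto simp: S_def)
          moreover have "S (of_rat q) \<subseteq> S c" using q(2) by (auto simp: S_def)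
          ultimately show False
            using c(2) interior_mono frontier_iff by blast
        qed
      qed
    qed
    ultimately show ?thesis using interior_mono[of "- G" "\<Union>?\<F>"] by blast
  qed
  ultimately show ?thesis by (rule that)
qed

end

section \<open>Uniform finiteness, piecewise continuity and path-connected pieces\<close>

context tame_definability
begin

text \<open>The points \<open>v\<close> are good where, for every window with end points outside the fibre, it is locally
  constant whether the window contains at least one, and at least two, points of the fibre. Windows
  with rational end points suffice to detect this, so Baire category applies, and by compactness
  finitely many windows determine the cardinality of nearby fibres.\<close>

lemma window_dense_set:
  assumes A: "dset (insert j I) A" and j: "j \<notin> I" and I: "finite I"
    and bd: "A \<subseteq> slab {j} r" and fin: "\<And>v. finite (fibre j A v)"
  obtains G where "dset I G" "interior (- G) = {}"
    "\<And>v. v \<in> G \<Longrightarrow> \<exists>U. open U \<and> v \<in> U \<and> (\<forall>w\<in>U. card (fibre j A w) = card (fibre j A v))"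
proof -
  define X where "X l u = {v. \<exists>b. l < b \<and> b < u \<and> v(j := b) \<in> A}" for l u
  define Y where "Y l u = {v. \<exists>b c. l < b \<and> b < c \<and> c < u \<and> v(j := b) \<in> A \<and> v(j := c) \<in> A}" for l u
  have depA: "dep (insert j J) (\<lambda>v. v \<in> A)" if "I \<subseteq> J" for J
    using that by (intro dep_mono[OF dsetD(2)[OF A]]) auto
  have dfnX: "dfn (\<lambda>v. \<exists>b. v m < b \<and> b < v n \<and> v(j := b) \<in> A)" for m n
  proof (rule dfn_ex)
    show "finite (I \<union> {m, n})" using I by simp
    show "dep (I \<union> {m, n}) (\<lambda>v. v m < b \<and> b < v n \<and> v(j := b) \<in> A)" for b
      by (intro dep_intros dep_upd_mem depA dep_simple) auto
    show "dfn (\<lambda>v. v m < v k \<and> v k < v n \<and> v(j := v k) \<in> A)" for k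
      by (intro dfn_basic dsetD(1)[OF A])
  qed
  have dfnY: "dfn (\<lambda>v. \<exists>b c. v m < b \<and> b < c \<and> c < v n \<and> v(j := b) \<in> A \<and> v(j := c) \<in> A)" for m n
  proof (rule dfn_ex)
    show "finite (I \<union> {m, n})" using I by simp
    show "dep (I \<union> {m, n}) (\<lambda>v. \<exists>c. v m < b \<and> b < c \<and> c < v n \<and> v(j := b) \<in> A \<and> v(j := c) \<in> A)" for b
      by (intro dep_intros dep_upd_mem depA dep_simple) auto
    show "dfn (\<lambda>v. \<exists>c. v m < v k \<and> v k < c \<and> c < v n \<and> v(j := v k) \<in> A \<and> v(j := c) \<in> A)" for k
    proof (rule dfn_ex)
      show "finite (I \<union> {m, n, k})" using I by simp
      show "dep (I \<union> {m, n, k}) (\<lambda>v. v m < v k \<and> v k < c \<and> c < v n \<and> v(j := v k) \<in> A \<and> v(j := c) \<in> A)" for c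
        by (intro dep_intros dep_upd_mem depA dep_simple) auto
      show "dfn (\<lambda>v. v m < v k \<and> v k < v k' \<and> v k' < v n \<and> v(j := v k) \<in> A \<and> v(j := v k') \<in> A)" for k'
        by (intro dfn_basic dsetD(1)[OF A])
    qed
  qed
  have depX: "dep I (\<lambda>v. v \<in> X l u)" and depY: "dep I (\<lambda>v. v \<in> Y l u)" for l u
    unfolding X_def Y_def mem_Collect_eq
    by (intro dep_intros dep_upd_mem depA dep_simple order_refl)+
  have dfnXY: "dfn (\<lambda>v. v \<in> X l u)" "dfn (\<lambda>v. v \<in> Y l u)" for l u
  proof -
    obtain m where m: "m \<notin> insert j I" using ex_new_if_finite[OF infinite_UNIV_nat] I by blast
    obtain n where n: "n \<notin> insert m (insert j I)"
      using ex_new_if_finite[OF infinite_UNIV_nat] I by (metis finite_insert)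
    have "v(m := l, n := u, j := b) \<in> A \<longleftrightarrow> v(j := b) \<in> A" for v b
      using m n by (intro depD[OF depA[OF order_refl]]) auto
    moreover have "(v(m := l, n := u)) m = l" "(v(m := l, n := u)) n = u" for v
      using m n by auto
    ultimately show "dfn (\<lambda>v. v \<in> X l u)" "dfn (\<lambda>v. v \<in> Y l u)"
      using dfn_subst_const[OF dfn_subst_const[OF dfnX[of m n], of n u], of m l]
        dfn_subst_const[OF dfn_subst_const[OF dfnY[of m n], of n u], of m l]
      by (simp_all only: X_def Y_def mem_Collect_eq)
  qed
  have fr: "dfn (\<lambda>v. v \<in> frontier (X (v m) (v n)))" "dfn (\<lambda>v. v \<in> frontier (Y (v m) (v n)))"
    if "m \<notin> insert j I" "n \<notin> insert j I" for m n
  proof -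
    have mem: "(ov I w v)(j := b) \<in> A \<longleftrightarrow> w(j := b) \<in> A" for w v b
      by (intro depD[OF depA[OF order_refl]]) (auto simp: ov_def)
    have ov: "ov I w v m = v m" "ov I w v n = v n" for w v
      using that by (auto simp: ov_def)
    have "v \<in> cfrontier I {v. \<exists>b. v m < b \<and> b < v n \<and> v(j := b) \<in> A} \<longleftrightarrow> v \<in> frontier (X (v m) (v n))" for v
      unfolding cfrontier_section[OF I] X_def mem_Collect_eq mem ov ..
    moreover have "v \<in> cfrontier I {v. \<exists>b c. v m < b \<and> b < c \<and> c < v n \<and> v(j := b) \<in> A \<and> v(j := c) \<in> A}
        \<longleftrightarrow> v \<in> frontier (Y (v m) (v n))" for v
      unfolding cfrontier_section[OF I] Y_def mem_Collect_eq mem ov ..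
    moreover note dfn_cfrontier[OF I dfn_mem(5)[OF dfnX[of m n]]] dfn_cfrontier[OF I dfn_mem(5)[OF dfnY[of m n]]]
    ultimately show "dfn (\<lambda>v. v \<in> frontier (X (v m) (v n)))" "dfn (\<lambda>v. v \<in> frontier (Y (v m) (v n)))"
      by (simp_all only:)
  qed
  define G where "G = {v. \<forall>l u. l < u \<and> v(j := l) \<notin> A \<and> v(j := u) \<notin> A \<longrightarrow>
     v \<notin> frontier (X l u) \<and> v \<notin> frontier (Y l u)}"
  have depG: "dep J (\<lambda>v. l < u \<and> v(j := l) \<notin> A \<and> v(j := u) \<notin> A \<longrightarrow>
     v \<notin> frontier (X l u) \<and> v \<notin> frontier (Y l u))" if "I \<subseteq> J" for l u J
    using dep_mono[OF dep_frontier[OF depX] that] dep_mono[OF dep_frontier[OF depY] that]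
    by (intro dep_intros dep_upd_mem depA dep_simple that)
  have "dfn (\<lambda>v. \<forall>l u. l < u \<and> v(j := l) \<notin> A \<and> v(j := u) \<notin> A \<longrightarrow>
     v \<notin> frontier (X l u) \<and> v \<notin> frontier (Y l u))"
  proof (rule dfn_all)
    show "finite (insert j I)" using I by simp
    show "dep (insert j I) (\<lambda>v. \<forall>u. l < u \<and> v(j := l) \<notin> A \<and> v(j := u) \<notin> A \<longrightarrow>
       v \<notin> frontier (X l u) \<and> v \<notin> frontier (Y l u))" for l
      by (rule dep_intros(6)[OF depG]) auto
    fix m assume m: "m \<notin> insert j I"
    show "dfn (\<lambda>v. \<forall>u. v m < u \<and> v(j := v m) \<notin> A \<and> v(j := u) \<notin> A \<longrightarrow>
       v \<notin> frontier (X (v m) u) \<and> v \<notin> frontier (Y (v m) u))"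
    proof (rule dfn_all)
      show "finite (insert m (insert j I))" using I by simp
      show "dep (insert m (insert j I)) (\<lambda>v. v m < u \<and> v(j := v m) \<notin> A \<and> v(j := u) \<notin> A \<longrightarrow>
         v \<notin> frontier (X (v m) u) \<and> v \<notin> frontier (Y (v m) u))" for u
        unfolding dep_def
      proof (intro allI impI)
        fix v w :: "nat \<Rightarrow> real" assume eq: "\<forall>i\<in>insert m (insert j I). v i = w i"
        then have "v m = w m" by simp
        then show "(v m < u \<and> v(j := v m) \<notin> A \<and> v(j := u) \<notin> A \<longrightarrow>
            v \<notin> frontier (X (v m) u) \<and> v \<notin> frontier (Y (v m) u)) =
          (w m < u \<and> w(j := w m) \<notin> A \<and> w(j := u) \<notin> A \<longrightarrow>
            w \<notin> frontier (X (w m) u) \<and> w \<notin> frontier (Y (w m) u))"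
          using depD[OF depG[OF order_refl, of "w m" u], of v w] eq by simp
      qed
      fix n assume "n \<notin> insert m (insert j I)"
      then have n: "n \<notin> insert j I" by simp
      show "dfn (\<lambda>v. v m < v n \<and> v(j := v m) \<notin> A \<and> v(j := v n) \<notin> A \<longrightarrow>
         v \<notin> frontier (X (v m) (v n)) \<and> v \<notin> frontier (Y (v m) (v n)))"
        by (intro dfn_basic fr m n dsetD(1)[OF A])
    qed
  qed
  moreover have "dep I (\<lambda>v. \<forall>l u. l < u \<and> v(j := l) \<notin> A \<and> v(j := u) \<notin> A \<longrightarrow>
     v \<notin> frontier (X l u) \<and> v \<notin> frontier (Y l u))"
    by (rule dep_intros(6)[OF dep_intros(6)[OF depG]]) simp
  ultimately have "dset I G" unfolding G_def by (rule dset_Collect)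
  moreover have "interior (- G) = {}"
  proof -
    let ?\<F> = "range (\<lambda>(p::rat, q::rat). frontier (X (of_rat p) (of_rat q))) \<union>
        range (\<lambda>(p::rat, q::rat). frontier (Y (of_rat p) (of_rat q)))"
    have "closed T \<and> interior T = {}" if "T \<in> ?\<F>" for T
      using that interior_frontier_dfn[OF dfnXY(1)] interior_frontier_dfn[OF dfnXY(2)] by auto
    moreover have "countable ?\<F>" by simp
    ultimately have "interior (\<Union>?\<F>) = {}" using Baire_fun by blast
    moreover have "- \<Union>?\<F> \<subseteq> G"
    proof
      fix v assume "v \<in> - \<Union>?\<F>"
      then have v: "v \<notin> frontier (X (of_rat p) (of_rat q))" "v \<notin> frontier (Y (of_rat p) (of_rat q))" for p q
        by auto
      have "v \<notin> frontier (X l u) \<and> v \<notin> frontier (Y l u)"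
        if lu: "l < u" "v(j := l) \<notin> A" "v(j := u) \<notin> A" for l u
      proof -
        \<comment> \<open>The fibre over \<open>v\<close> stays at distance at least
          \<open>d\<close> from both \<open>l\<close> and \<open>u\<close>. So the windows from
          \<open>p0\<close> to \<open>p2\<close> around \<open>l\<close> and from \<open>q0\<close>
          to \<open>q2\<close> around \<open>u\<close> are empty over \<open>v\<close>, and remain
          empty nearby. There, the window from \<open>l\<close> to \<open>u\<close> and the rational
          one from \<open>p1\<close> to \<open>q1\<close> contain the same fibre points.\<close>
        obtain d1 where d1: "d1 > 0" "\<And>y. v(j := y) \<in> A \<Longrightarrow> y \<noteq> l \<Longrightarrow> d1 \<le> dist l y"
          using finite_set_avoid[OF fin[of v], of l] by blast
        obtain d2 where d2: "d2 > 0" "\<And>y. v(j := y) \<in> A \<Longrightarrow> y \<noteq> u \<Longrightarrow> d2 \<le> dist u y"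
          using finite_set_avoid[OF fin[of v], of u] by blast
        define d where "d = min (min d1 d2) (u - l)"
        have d: "0 < d" "d \<le> d1" "d \<le> d2" "d \<le> u - l" using d1(1) d2(1) lu(1) by (auto simp: d_def)
        obtain p0 where p0: "l - d < of_rat p0" "of_rat p0 < l"
          using of_rat_dense[of "l - d" l] d by auto
        obtain p1 where p1: "l < of_rat p1" "of_rat p1 < l + d / 2"
          using of_rat_dense[of l "l + d / 2"] d by auto
        obtain p2 where p2: "of_rat p1 < (of_rat p2 :: real)" "of_rat p2 < l + d"
          using of_rat_dense[of "of_rat p1" "l + d"] p1 d by auto
        obtain q2 where q2: "u < of_rat q2" "of_rat q2 < u + d"
          using of_rat_dense[of u "u + d"] d by auto
        obtain q1 where q1: "u - d / 2 < of_rat q1" "of_rat q1 < u"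
          using of_rat_dense[of "u - d / 2" u] d by auto
        obtain q0 where q0: "u - d < of_rat q0" "of_rat q0 < (of_rat q1 :: real)"
          using of_rat_dense[of "u - d" "of_rat q1"] q1 d by auto
        let ?U = "interior (- X (of_rat p0) (of_rat p2)) \<inter> interior (- X (of_rat q0) (of_rat q2))"
        have nl: "d \<le> dist l y" and nu: "d \<le> dist u y" if "v(j := y) \<in> A" for y
          using d1(2)[OF that] d2(2)[OF that] that lu d by fastforce+
        have "v \<notin> X (of_rat p0) (of_rat p2)"
        proof
          assume "v \<in> X (of_rat p0) (of_rat p2)"
          then obtain y where "of_rat p0 < y" "y < of_rat p2" "v(j := y) \<in> A" by (auto simp: X_def)
          then show False using nl[of y] p0 p2 by (auto simp: dist_real_def)
        qed
        moreover have "v \<notin> X (of_rat q0) (of_rat q2)"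
        proof
          assume "v \<in> X (of_rat q0) (of_rat q2)"
          then obtain y where "of_rat q0 < y" "y < of_rat q2" "v(j := y) \<in> A" by (auto simp: X_def)
          then show False using nu[of y] q0 q2 by (auto simp: dist_real_def)
        qed
        ultimately have vU: "v \<in> ?U"
          using not_frontierD(1)[OF v(1)] by blast
        have in_window: "of_rat p1 < b \<and> b < of_rat q1"
          if w: "w \<in> ?U" and b: "w(j := b) \<in> A" "l < b" "b < u" for w b
        proof -
          have "w \<notin> X (of_rat p0) (of_rat p2)" "w \<notin> X (of_rat q0) (of_rat q2)"
            using w interior_subset by blast+
          then have "\<not> (of_rat p0 < b \<and> b < of_rat p2)" "\<not> (of_rat q0 < b \<and> b < of_rat q2)"
            using b(1) by (auto simp: X_def)
          then show ?thesis using b(2,3) p0(2) p2(1) q2(1) q0(2) by linarith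
        qed
        have "w \<in> X l u \<longleftrightarrow> w \<in> X (of_rat p1) (of_rat q1)" if "w \<in> ?U" for w
        proof
          assume "w \<in> X l u"
          then obtain b where "l < b" "b < u" "w(j := b) \<in> A" by (auto simp: X_def)
          with in_window[OF that this(3,1,2)] show "w \<in> X (of_rat p1) (of_rat q1)" by (auto simp: X_def)
        next
          assume "w \<in> X (of_rat p1) (of_rat q1)"
          then obtain b where "of_rat p1 < b" "b < of_rat q1" "w(j := b) \<in> A" by (auto simp: X_def)
          then have "l < b" "b < u" "w(j := b) \<in> A" using p1 q1 by auto
          then show "w \<in> X l u" by (auto simp: X_def)
        qed
        moreover have "w \<in> Y l u \<longleftrightarrow> w \<in> Y (of_rat p1) (of_rat q1)" if "w \<in> ?U" for w
        proof
          assume "w \<in> Y l u"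
          then obtain b c where *: "l < b" "b < c" "c < u" "w(j := b) \<in> A" "w(j := c) \<in> A"
            by (auto simp: Y_def)
          then have "of_rat p1 < b" "c < of_rat q1"
            using in_window[OF that *(4)] in_window[OF that *(5)] by auto
          with * show "w \<in> Y (of_rat p1) (of_rat q1)" by (auto simp: Y_def)
        next
          assume "w \<in> Y (of_rat p1) (of_rat q1)"
          then obtain b c where "of_rat p1 < b" "b < c" "c < of_rat q1" "w(j := b) \<in> A" "w(j := c) \<in> A"
            by (auto simp: Y_def)
          then have "l < b" "b < c" "c < u" "w(j := b) \<in> A" "w(j := c) \<in> A" using p1 q1 by auto
          then show "w \<in> Y l u" unfolding Y_def by blast
        qed
        moreover have "open ?U" by auto
        ultimately show ?thesis using frontier_local vU v by meson
      qed
      then show "v \<in> G" by (simp add: G_def)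
    qed
    then have "- G \<subseteq> \<Union>?\<F>" by blast
    ultimately show ?thesis using interior_mono by blast
  qed
  moreover have "\<exists>U. open U \<and> v \<in> U \<and> (\<forall>w\<in>U. card (fibre j A w) = card (fibre j A v))" if v: "v \<in> G" for v
  proof -
    let ?F = "fibre j A v"
    have "\<forall>t. \<exists>d>0. \<forall>y\<in>?F. y \<noteq> t \<longrightarrow> d \<le> dist t y"
      using finite_set_avoid[OF fin] by blast
    then obtain d where d: "\<And>t. 0 < d t" "\<And>t y. y \<in> ?F \<Longrightarrow> y \<noteq> t \<Longrightarrow> d t \<le> dist t y"
      by metis
    \<comment> \<open>By the choice of \<open>d t\<close>, the only point of the fibre over
      \<open>v\<close> that can lie in this window is \<open>t\<close>. For two different centres in
      the fibre the windows are disjoint, since their half-widths add up to at most the distance of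
      the centres.\<close>
    define W where "W t = {t - d t / 2<..<t + d t / 2}" for t
    define XW YW where "XW t = X (t - d t / 2) (t + d t / 2)" and "YW t = Y (t - d t / 2) (t + d t / 2)" for t
    have XW: "w \<in> XW t \<longleftrightarrow> (\<exists>b. b \<in> fibre j A w \<inter> W t)" for w t
      by (auto simp: XW_def X_def W_def)
    have YW: "w \<in> YW t \<longleftrightarrow> (\<exists>b c. b \<in> fibre j A w \<inter> W t \<and> c \<in> fibre j A w \<inter> W t \<and> b < c)" for w t
      by (auto simp: YW_def Y_def W_def) (meson less_trans)+
    have near: "y = t" if "y \<in> ?F" "dist t y \<le> d t / 2" for y t
      using d(2)[of y t] d(1)[of t] that by fastforce
    have distW: "dist t y \<le> d t / 2" if "y \<in> W t" for y t
      using that by (auto simp: W_def dist_real_def abs_if)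
    have vX: "v \<in> XW t \<longleftrightarrow> t \<in> ?F" for t
    proof
      assume "v \<in> XW t"
      then obtain b where b: "b \<in> ?F" "b \<in> W t" using XW by blast
      then have "b = t" by (intro near distW)
      then show "t \<in> ?F" using b by simp
    next
      assume "t \<in> ?F"
      then show "v \<in> XW t" unfolding XW using d(1)[of t] by (auto simp: W_def)
    qed
    have vY: "v \<notin> YW t" for t
    proof
      assume "v \<in> YW t"
      then obtain b c where "b \<in> ?F" "b \<in> W t" "c \<in> ?F" "c \<in> W t" "b < c" using YW by blast
      then have "b = t" "c = t" using near distW by blast+
      then show False using \<open>b < c\<close> by simp
    qed
    have fXY: "v \<notin> frontier (XW t)" "v \<notin> frontier (YW t)" for t
    proof -
      have "t - d t / 2 \<notin> ?F" "t + d t / 2 \<notin> ?F"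
        using near[of "t - d t / 2" t] near[of "t + d t / 2" t] d(1)[of t] by (auto simp: dist_real_def)
      then show "v \<notin> frontier (XW t)" "v \<notin> frontier (YW t)"
        using v d(1)[of t] by (auto simp: G_def XW_def YW_def)
    qed
    have vN: "v \<in> (if t \<in> ?F then interior (XW t) else interior (- XW t)) \<inter> interior (- YW t)" for t
      using not_frontierD(1)[OF fXY(2) vY] not_frontierD(1)[OF fXY(1)] not_frontierD(2)[OF fXY(1)] vX
      by auto
    define N where "N t = (if t \<in> ?F then interior (XW t) else interior (- XW t)) \<inter> interior (- YW t)" for t
    have N: "v \<in> N t" "open (N t)" for t
      using vN by (auto simp: N_def)
    have NX: "w \<in> XW t \<longleftrightarrow> t \<in> ?F" and NY: "w \<notin> YW t" if "w \<in> N t" for w t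
      using that interior_subset[of "XW t"] interior_subset[of "- XW t"] interior_subset[of "- YW t"]
      by (auto simp: N_def split: if_splits)
    have "{-r..r} \<subseteq> (\<Union>t\<in>{-r..r}. W t)"
      using d(1) by (auto simp: W_def)
    then obtain T where T: "T \<subseteq> {-r..r}" "finite T" "{-r..r} \<subseteq> (\<Union>t\<in>T. W t)"
      by (rule compactE_image[OF compact_Icc, rotated]) (auto simp: W_def)
    \<comment> \<open>The windows with centre in \<open>T\<close> cover everything: near
      \<open>v\<close> those centred off the fibre \<open>?F\<close> stay empty. Each window centred
      in \<open>?F\<close> keeps exactly one point, so counting these windows counts the nearby
      fibre.\<close>
    let ?U = "\<Inter>t\<in>T \<union> ?F. N t"
    have "open ?U" using T(2) fin[of v] N(2) by (intro open_INT) auto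
    moreover have "v \<in> ?U" using N(1) by blast
    moreover have "card (fibre j A w) = card ?F" if w: "w \<in> ?U" for w
    proof -
      have "fibre j A w = (\<Union>y\<in>?F. fibre j A w \<inter> W y)"
      proof
        show "fibre j A w \<subseteq> (\<Union>y\<in>?F. fibre j A w \<inter> W y)"
        proof
          fix b assume b: "b \<in> fibre j A w"
          then have "w(j := b) \<in> slab {j} r" using bd by blast
          then have "b \<in> {-r..r}" by (auto simp: slab_def)
          then obtain t where t: "t \<in> T" "b \<in> W t" using T(3) by blast
          then have "w \<in> XW t" using b XW by blast
          then have "t \<in> ?F" using NX w t(1) by blast
          then show "b \<in> (\<Union>y\<in>?F. fibre j A w \<inter> W y)" using b t(2) by blast
        qed
      qed auto
      also have "card \<dots> = (\<Sum>y\<in>?F. card (fibre j A w \<inter> W y))"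
      proof (rule card_UN_disjoint)
        have "y = y'" if "y \<in> ?F" "y' \<in> ?F" "b \<in> W y" "b \<in> W y'" for y y' b
        proof (rule ccontr)
          assume "y \<noteq> y'"
          then have "d y \<le> dist y y'" "d y' \<le> dist y y'"
            using d(2)[of y' y] d(2)[of y y'] that by (auto simp: dist_commute)
          then show False using that(3,4) by (auto simp: W_def dist_real_def abs_if split: if_splits)
        qed
        then show "\<forall>y\<in>?F. \<forall>y'\<in>?F. y \<noteq> y' \<longrightarrow> (fibre j A w \<inter> W y) \<inter> (fibre j A w \<inter> W y') = {}"
          by blast
      qed (use fin in auto)
      also have "\<dots> = (\<Sum>y\<in>?F. 1)"
      proof (rule sum.cong)
        fix y assume y: "y \<in> ?F"
        then have "w \<in> N y" using w by blast
        then have "w \<in> XW y" "w \<notin> YW y" using NX NY y by blast+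
        then obtain b where b: "b \<in> fibre j A w \<inter> W y" using XW by blast
        have "c = b" if "c \<in> fibre j A w \<inter> W y" for c
          using \<open>w \<notin> YW y\<close> b that unfolding YW by (meson linorder_neqE_linordered_idom)
        then have "fibre j A w \<inter> W y = {b}" using b by blast
        then show "card (fibre j A w \<inter> W y) = 1" by simp
      qed simp
      finally show ?thesis by simp
    qed
    ultimately show ?thesis by blast
  qed
  ultimately show ?thesis by (rule that)
qed

end

lemma slab_upd:
  assumes "v(i := b) \<in> slab I r" shows "v \<in> slab (I - {i}) r"
  unfolding slab_def mem_Collect_eq
proof
  fix k assume k: "k \<in> I - {i}"
  then have "\<bar>(v(i := b)) k\<bar> \<le> r" using assms unfolding slab_def by blast
  then show "\<bar>v k\<bar> \<le> r" using k by simp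
qed

section \<open>The four statements of the simultaneous induction\<close>

context tame_definability
begin

text \<open>Here \<open>I\<close> indexes the base only: the sets concerned have one coordinate more
  than those in the other three statements for \<open>I\<close>.\<close>

definition uniform_finiteness :: "nat set \<Rightarrow> bool" where
  "uniform_finiteness I \<longleftrightarrow> (\<forall>j A r. j \<notin> I \<longrightarrow> dset (insert j I) A \<longrightarrow> A \<subseteq> slab (insert j I) r \<longrightarrow>
     (\<forall>v. finite (fibre j A v)) \<longrightarrow> (\<exists>k. \<forall>v. card (fibre j A v) \<le> k))"

definition thin_decomposition :: "nat set \<Rightarrow> bool" where
  "thin_decomposition I \<longleftrightarrow> (\<forall>A r. dset I A \<longrightarrow> A \<subseteq> slab I r \<longrightarrow> interior A = {} \<longrightarrow>
     decomp I (\<lambda>B. \<exists>i\<in>I. thin i B) A)"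

definition piecewise_continuity :: "nat set \<Rightarrow> bool" where
  "piecewise_continuity I \<longleftrightarrow> (\<forall>f A r. dfun I f \<longrightarrow> dset I A \<longrightarrow> A \<subseteq> slab I r \<longrightarrow>
     decomp I (\<lambda>B. continuous_on B f) A)"

definition path_decomposition :: "nat set \<Rightarrow> bool" where
  "path_decomposition I \<longleftrightarrow> (\<forall>A r. dset I A \<longrightarrow> A \<subseteq> slab I r \<longrightarrow> decomp I path_connected A)"

lemma decomp_mono:
  assumes "decomp I Q A" "I \<subseteq> J" "\<And>B. Q B \<Longrightarrow> R B"
  shows "decomp J R A"
  using assms(1)
proof (rule decomp_refine')
  fix B assume "dset I B" "Q B"
  then show "decomp J R B" using assms(2,3) by (intro decomp_single dset_mono[of I B J])
qed

text \<open>With a bound \<open>k\<close> on all fibres, \<open>k\<close> peelings exhaust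
  \<open>A\<close>, and the layers removed on the way are thin.\<close>

lemma thin_pieces:
  assumes U: "uniform_finiteness I" and j: "j \<notin> I" and A: "dset (insert j I) A"
    "A \<subseteq> slab (insert j I) r" "\<And>v. finite (fibre j A v)"
  shows "decomp (insert j I) (thin j) A"
proof -
  obtain k where k: "\<And>v. card (fibre j A v) \<le> k"
    using U j A unfolding uniform_finiteness_def by metis
  obtain \<A> where \<A>: "finite \<A>" "A = \<Union>\<A> \<union> (peel j ^^ k) A"
    "\<forall>L\<in>\<A>. dfn (\<lambda>v. v \<in> L) \<and> dep (insert j I) (\<lambda>v. v \<in> L) \<and> thin j L"
    using peel_decomposition[OF dsetD(1)[OF A(1)] dsetD(2)[OF A(1)] insertI1, of k] by blast
  have "(peel j ^^ k) A = {}"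
  proof (rule ccontr)
    assume "(peel j ^^ k) A \<noteq> {}"
    then obtain v where "v \<in> (peel j ^^ k) A" by blast
    then have "v j \<in> fibre j ((peel j ^^ k) A) v" by simp
    then show False using fibre_peel_funpow_empty[OF A(3) k] by blast
  qed
  then show ?thesis unfolding decomp_def using \<A> by (intro exI[of _ \<A>]) (simp add: dset_def)
qed

lemma thin_decomposition_empty: "thin_decomposition {}"
  unfolding thin_decomposition_def
proof (intro allI impI)
  fix A :: "(nat \<Rightarrow> real) set" assume "dset {} A" "interior A = {}"
  then have "A = {}" using dset_no_coordinates by force
  then show "decomp {} (\<lambda>B. \<exists>i\<in>{}. thin i B) A" by (simp add: decomp_empty)
qed

lemma path_decomposition_empty: "path_decomposition {}"
  unfolding path_decomposition_def
  using dset_no_coordinates decomp_empty decomp_single path_connected_UNIV_fun by metis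

text \<open>The base points with fat fibre form a set without interior, to which the induction
  hypothesis applies; thinness in a base direction passes to the part of \<open>A\<close> above.
  Over the other base points the fibres are finite, and uniform finiteness cuts that part into
  pieces thin in direction \<open>i\<close>.\<close>

lemma thin_decomposition_step:
  assumes i: "i \<in> I" and I: "finite I" and U: "uniform_finiteness (I - {i})"
    and T: "thin_decomposition (I - {i})"
  shows "thin_decomposition I"
  unfolding thin_decomposition_def
proof (intro allI impI)
  fix A r assume A: "dset I A" "A \<subseteq> slab I r" "interior A = {}"
  let ?I = "I - {i}"
  have ins: "insert i ?I = I" using i by blast
  define S where "S = fat i A"
  have S: "dset ?I S"
    unfolding S_def dset_def using A(1) dsetD[OF A(1)] dfn_fat[of A i] dep_fat[of i ?I A] ins by simp
  have "nowhere_dense_property ?I"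
    unfolding nowhere_dense_property_def using interior_closure_empty by blast
  then have "interior S = {}"
    unfolding S_def using interior_fat_empty[of ?I A i] A dsetD[OF A(1)] I ins by simp
  then have "interior (S \<inter> slab ?I r) = {}"
    using interior_mono[of "S \<inter> slab ?I r" S] by blast
  then have "decomp ?I (\<lambda>B. \<exists>k\<in>?I. thin k B) (S \<inter> slab ?I r)"
    using T[unfolded thin_decomposition_def, rule_format, of "S \<inter> slab ?I r" r]
      dset_Int[OF S dset_slab, of r] I by blast
  then have "decomp I (\<lambda>B. \<exists>k\<in>I. thin k B) ((S \<inter> slab ?I r) \<inter> A)"
  proof (rule decomp_refine)
    fix B assume B: "dset ?I B" "\<exists>k\<in>?I. thin k B"
    show "decomp I (\<lambda>B. \<exists>k\<in>I. thin k B) (B \<inter> A)"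
    proof (rule decomp_single)
      show "dset I (B \<inter> A)" using dset_mono[OF B(1)] A(1) by (intro dset_Int) auto
      show "\<exists>k\<in>I. thin k (B \<inter> A)" using B(2) thin_subset[of _ B "B \<inter> A"] by blast
    qed
  qed
  moreover have "decomp I (\<lambda>B. \<exists>k\<in>I. thin k B) (A - S)"
  proof -
    have "dset (insert i ?I) (A - S)" unfolding ins using A(1) dset_mono[OF S] by (intro dset_Diff) auto
    moreover have "A - S \<subseteq> slab (insert i ?I) r" unfolding ins using A(2) by blast
    moreover have "finite (fibre i (A - S) v)" for v
    proof (cases "v \<in> S")
      case True
      then have "v(i := b) \<in> S" for b using dep_upd[OF dsetD(2)[OF S], of i v b] by simp
      then show ?thesis by simp
    next
      case False
      then have "interior (fibre i A v) = {}" by (simp add: S_def fat_def)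
      moreover have "fibre i A v \<subseteq> {-r..r}"
      proof
        fix b assume "b \<in> fibre i A v"
        then have "v(i := b) \<in> slab I r" using A(2) by blast
        then show "b \<in> {-r..r}" using i by (auto simp: slab_def)
      qed
      ultimately have "finite (fibre i A v)"
        using finite_fibre_of_interior_empty[OF dsetD(1)[OF A(1)]] by blast
      then show ?thesis by (rule rev_finite_subset) auto
    qed
    ultimately have "decomp (insert i ?I) (thin i) (A - S)" by (intro thin_pieces[OF U]) auto
    then show ?thesis unfolding ins by (rule decomp_mono) (use i in auto)
  qed
  moreover have "A = (S \<inter> slab ?I r) \<inter> A \<union> (A - S)"
    using A(2) slab_mono[of ?I I r] by blast
  ultimately show "decomp I (\<lambda>B. \<exists>k\<in>I. thin k B) A" using decomp_Un by metis
qed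

text \<open>Off the good set \<open>G\<close>, the set splits into graphs of functions
  \<open>g\<close> of the coordinates other than some \<open>i\<close>. On such a graph
  \<open>f\<close> agrees with the function obtained by substituting \<open>g\<close> for coordinate
  \<open>i\<close>, which has one argument fewer.\<close>

lemma piecewise_continuity_step:
  assumes I: "finite I" and T: "thin_decomposition I"
    and C: "\<And>i. i \<in> I \<Longrightarrow> piecewise_continuity (I - {i})"
  shows "piecewise_continuity I"
  unfolding piecewise_continuity_def
proof (intro allI impI)
  fix f A r assume f: "dfun I f" and A: "dset I A" "A \<subseteq> slab I r"
  let ?Q = "\<lambda>B. continuous_on B f"
  obtain G where G: "dset I G" "continuous_on G f" "interior (- G) = {}"
    using continuity_set[OF f I] by blast
  have "decomp I ?Q (A \<inter> G)"
    using A(1) G(1) continuous_on_subset[OF G(2)] by (intro decomp_single dset_Int) auto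
  moreover have "decomp I ?Q (A - G)"
  proof -
    have "interior (A - G) = {}" using G(3) interior_mono[of "A - G" "- G"] by blast
    moreover have "A - G \<subseteq> slab I r" using A(2) by blast
    ultimately have "decomp I (\<lambda>B. \<exists>i\<in>I. thin i B) (A - G)"
      using T dset_Diff[OF A(1) G(1)] unfolding thin_decomposition_def by blast
    then show ?thesis
    proof (rule decomp_refine')
      fix B assume B: "dset I B" "\<exists>i\<in>I. thin i B" "B \<subseteq> A - G"
      then obtain i where i: "i \<in> I" "thin i B" by blast
      let ?I = "I - {i}"
      have ins: "insert i ?I = I" using i by blast
      define B' where "B' = {v. \<exists>b. v(i := b) \<in> B}"
      define g where "g = thin_fun i B"
      have g: "dfun ?I g" unfolding g_def using B(1) i I ins by (intro dfun_thin_fun) auto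
      have "dset ?I B'" unfolding B'_def using B(1) ins by (intro dset_fibre_ex) simp
      moreover have "B' \<subseteq> slab ?I r"
      proof
        fix v assume "v \<in> B'"
        then obtain b where "v(i := b) \<in> B" by (auto simp: B'_def)
        then have "v(i := b) \<in> slab I r" using A(2) B(3) by blast
        then show "v \<in> slab ?I r" by (rule slab_upd)
      qed
      moreover have "dfun ?I (\<lambda>v. f (v(i := g v)))"
        using f g I ins by (intro dfun_compose_upd) auto
      ultimately have "decomp ?I (\<lambda>E. continuous_on E (\<lambda>v. f (v(i := g v)))) B'"
        using C[OF i(1)] unfolding piecewise_continuity_def by blast
      then have "decomp I ?Q (B' \<inter> B)"
      proof (rule decomp_refine)
        fix E assume E: "dset ?I E" "continuous_on E (\<lambda>v. f (v(i := g v)))"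
        show "decomp I ?Q (E \<inter> B)"
        proof (rule decomp_single)
          show "dset I (E \<inter> B)" using dset_mono[OF E(1)] B(1) by (intro dset_Int) auto
          have "v(i := g v) = v" if "v \<in> B" for v
          proof -
            have "g v = v i" using that thin_mem_iff[OF i(2), of v] by (simp add: g_def)
            then show ?thesis by simp
          qed
          then have "f (v(i := g v)) = f v" if "v \<in> E \<inter> B" for v using that by simp
          moreover have "continuous_on (E \<inter> B) (\<lambda>v. f (v(i := g v)))"
            using E(2) by (rule continuous_on_subset) auto
          ultimately show "continuous_on (E \<inter> B) f"
            using continuous_on_cong[of "E \<inter> B" "E \<inter> B" "\<lambda>v. f (v(i := g v))" f] by blast
        qed
      qed
      moreover have "B \<subseteq> B'"
      proof
        fix v assume "v \<in> B"
        then have "v(i := v i) \<in> B" by simp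
        then show "v \<in> B'" unfolding B'_def by blast
      qed
      then have "B' \<inter> B = B" by blast
      ultimately show "decomp I ?Q B" by simp
    qed
  qed
  moreover have "A = (A \<inter> G) \<union> (A - G)" by blast
  ultimately show "decomp I ?Q A" using decomp_Un by metis
qed

lemma decomp_bound:
  assumes "decomp I Q E" "\<And>B. dset I B \<Longrightarrow> Q B \<Longrightarrow> B \<subseteq> E \<Longrightarrow> \<exists>k. \<forall>v\<in>B. (c v :: nat) \<le> k"
  shows "\<exists>k. \<forall>v\<in>E. c v \<le> k"
proof -
  obtain \<A> where \<A>: "finite \<A>" "E = \<Union>\<A>" "\<And>B. B \<in> \<A> \<Longrightarrow> dset I B \<and> Q B"
    using assms(1) unfolding decomp_def by metis
  have "\<forall>B\<in>\<A>. \<exists>k. \<forall>v\<in>B. c v \<le> k" using \<A> assms(2) by blast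
  then obtain K where K: "\<And>B v. B \<in> \<A> \<Longrightarrow> v \<in> B \<Longrightarrow> c v \<le> K B" by metis
  have "c v \<le> Max (insert 0 (K ` \<A>))" if v: "v \<in> E" for v
  proof -
    obtain B where B: "B \<in> \<A>" "v \<in> B" using v \<A>(2) by blast
    have "K B \<le> Max (insert 0 (K ` \<A>))" using \<A>(1) B(1) by (intro Max_ge) auto
    then show ?thesis using K[OF B] by simp
  qed
  then show ?thesis by blast
qed

text \<open>On a path-connected piece of \<open>G\<close> the cardinality of the fibre is locally
  constant, hence constant, and there are finitely many pieces. The rest of the base splits into
  thin pieces, on which one base coordinate is determined by the others and can be
  eliminated.\<close>

lemma uniform_finiteness_step:
  assumes I: "finite I" and P: "path_decomposition I" and T: "thin_decomposition I"
    and U: "\<And>i. i \<in> I \<Longrightarrow> uniform_finiteness (I - {i})"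
  shows "uniform_finiteness I"
  unfolding uniform_finiteness_def
proof (intro allI impI)
  fix j A r assume j: "j \<notin> I" and A: "dset (insert j I) A" "A \<subseteq> slab (insert j I) r"
    and "\<forall>v. finite (fibre j A v)"
  then have fin: "\<And>v. finite (fibre j A v)" by blast
  let ?c = "\<lambda>v. card (fibre j A v)"
  have "A \<subseteq> slab {j} r" using A(2) slab_mono[of "{j}" "insert j I" r] by blast
  then obtain G where G: "dset I G" "interior (- G) = {}"
    "\<And>v. v \<in> G \<Longrightarrow> \<exists>U. open U \<and> v \<in> U \<and> (\<forall>w\<in>U. ?c w = ?c v)"
    using window_dense_set[OF A(1) j I _ fin] by blast
  have slab: "dset I (slab I r)" using I by (rule dset_slab)
  have "decomp I path_connected (G \<inter> slab I r)"
    using P dset_Int[OF G(1) slab] unfolding path_decomposition_def by (meson Int_lower2)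
  then have "\<exists>k. \<forall>v\<in>G \<inter> slab I r. ?c v \<le> k"
  proof (rule decomp_bound)
    fix B assume B: "path_connected B" "B \<subseteq> G \<inter> slab I r"
    have "\<forall>a\<in>B. eventually (\<lambda>b. ?c a = ?c b) (at a within B)"
    proof
      fix a assume "a \<in> B"
      then have "a \<in> G" using B(2) by blast
      from G(3)[OF this] obtain U where U: "open U" "a \<in> U" "\<forall>w\<in>U. ?c w = ?c a" by blast
      have "\<forall>\<^sub>F b in at a within B. b \<in> U"
        by (rule filter_leD[OF at_within_le_nhds eventually_nhds_in_open[OF U(1,2)]])
      then show "eventually (\<lambda>b. ?c a = ?c b) (at a within B)"
        by (rule eventually_mono) (rule U(3)[rule_format, symmetric])
    qed
    then have "?c v = ?c w" if "v \<in> B" "w \<in> B" for v w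
      by (rule connected_local_const[OF path_connected_imp_connected[OF B(1)] that, of ?c])
    then have "\<forall>v\<in>B. ?c v \<le> ?c (SOME w. w \<in> B)" by (metis order_refl someI)
    then show "\<exists>k. \<forall>v\<in>B. ?c v \<le> k" by blast
  qed
  then obtain k1 where k1: "\<And>v. v \<in> G \<inter> slab I r \<Longrightarrow> ?c v \<le> k1" by blast
  have "interior (slab I r - G) = {}" using G(2) interior_mono[of "slab I r - G" "- G"] by blast
  then have "decomp I (\<lambda>B. \<exists>i\<in>I. thin i B) (slab I r - G)"
    using T dset_Diff[OF slab G(1)] unfolding thin_decomposition_def by (meson Diff_subset)
  then have "\<exists>k. \<forall>v\<in>slab I r - G. ?c v \<le> k"
  proof (rule decomp_bound)
    fix E assume E: "dset I E" "\<exists>i\<in>I. thin i E" "E \<subseteq> slab I r - G"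
    then obtain i where i: "i \<in> I" "thin i E" by blast
    let ?I = "I - {i}"
    \<comment> \<open>Projecting along \<open>i\<close> merges no fibres, because over each point
      the thin set \<open>E\<close> offers at most one value of coordinate \<open>i\<close>; so
      fibres stay finite and the hypothesis for \<open>I - {i}\<close> applies.\<close>
    define A' where "A' = {v. \<exists>b. v(i := b) \<in> E \<inter> A}"
    have ij: "i \<noteq> j" using i j by blast
    have "insert i (insert j ?I) = insert j I" using i by blast
    then have "dset (insert i (insert j ?I)) (E \<inter> A)"
      using A(1) dset_mono[OF E(1), of "insert j I"] by (auto intro: dset_Int)
    then have "dset (insert j ?I) A'" unfolding A'_def by (rule dset_fibre_ex)
    moreover have "A' \<subseteq> slab (insert j ?I) r"
    proof
      fix v assume "v \<in> A'"
      then obtain b where "v(i := b) \<in> A" by (auto simp: A'_def)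
      then have b: "v(i := b) \<in> slab (insert j I) r" using A(2) by blast
      have "insert j I - {i} = insert j ?I" using ij by blast
      then show "v \<in> slab (insert j ?I) r" using slab_upd[OF b] by simp
    qed
    moreover have fin': "finite (fibre j A' v)" for v
    proof (cases "\<exists>b. v(i := b) \<in> E")
      case True
      then obtain b0 where b0: "v(i := b0) \<in> E" by blast
      have "fibre j A' v \<subseteq> fibre j A (v(i := b0))"
      proof
        fix c assume "c \<in> fibre j A' v"
        then obtain b where b: "v(j := c, i := b) \<in> E" "v(j := c, i := b) \<in> A" by (auto simp: A'_def)
        have eq: "v(j := c, i := b) = v(i := b, j := c)" using ij by (simp add: fun_upd_twist)
        then have "v(i := b) \<in> E" using b(1) dep_upd[OF dsetD(2)[OF E(1)] j] by simp
        then have "b = b0" using thin_unique[OF i(2) b0] by blast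
        then show "c \<in> fibre j A (v(i := b0))" using b(2) eq by simp
      qed
      then show ?thesis using fin finite_subset by blast
    next
      case False
      have "v(j := c, i := b) \<notin> E" for b c
        using False dep_upd[OF dsetD(2)[OF E(1)] j, of "v(i := b)" c] ij by (simp add: fun_upd_twist)
      then have "fibre j A' v = {}" by (simp add: A'_def)
      then show ?thesis by (metis finite.emptyI)
    qed
    ultimately obtain k where k: "\<And>v. card (fibre j A' v) \<le> k"
      using U[OF i(1)] j unfolding uniform_finiteness_def by (metis Diff_iff)
    have "?c v \<le> k" if v: "v \<in> E" for v
    proof -
      have "fibre j A v \<subseteq> fibre j A' v"
      proof
        fix c assume c: "c \<in> fibre j A v"
        have "v(j := c, i := v i) = v(j := c)" using ij by auto
        moreover have "v(j := c) \<in> E" using v dep_upd[OF dsetD(2)[OF E(1)] j] by simp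
        ultimately have "v(j := c, i := v i) \<in> E \<inter> A" using c by simp
        then show "c \<in> fibre j A' v" unfolding A'_def by blast
      qed
      then show ?thesis using card_mono[OF fin'] k le_trans by blast
    qed
    then show "\<exists>k. \<forall>v\<in>E. ?c v \<le> k" by blast
  qed
  then obtain k2 where k2: "\<And>v. v \<in> slab I r - G \<Longrightarrow> ?c v \<le> k2" by blast
  have "?c v \<le> max k1 k2" for v
  proof (cases "v \<in> slab I r")
    case True
    then show ?thesis using k1[of v] k2[of v] by (cases "v \<in> G") auto
  next
    case False
    have "v(j := b) \<notin> A" for b
    proof
      assume "v(j := b) \<in> A"
      then have "v(j := b) \<in> slab I r" using A(2) slab_mono[of I "insert j I" r] by blast
      then have "v \<in> slab (I - {j}) r" by (rule slab_upd)
      then have "v \<in> slab I r" using j by simp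
      then show False using False by blast
    qed
    then show ?thesis by simp
  qed
  then show "\<exists>k. \<forall>v. ?c v \<le> k" by blast
qed

text \<open>Continuity is inherited by subsets and path connectedness is not, so the latter has to
  come in the last refinement.\<close>

lemma decomp_path_connected_continuous:
  assumes C: "piecewise_continuity I" and P: "path_decomposition I"
    and g: "dfun I g" and h: "dfun I h" and B: "dset I B" "B \<subseteq> slab I r"
  shows "decomp I (\<lambda>E. path_connected E \<and> continuous_on E g \<and> continuous_on E h) B"
proof -
  have "decomp I (\<lambda>E. continuous_on E g) B"
    using C g B unfolding piecewise_continuity_def by blast
  then show ?thesis
  proof (rule decomp_refine')
    fix E assume E: "dset I E" "continuous_on E g" "E \<subseteq> B"
    then have "decomp I (\<lambda>E. continuous_on E h) E"
      using C h B(2) unfolding piecewise_continuity_def by (meson subset_trans)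
    then show "decomp I (\<lambda>E. path_connected E \<and> continuous_on E g \<and> continuous_on E h) E"
    proof (rule decomp_refine')
      fix D assume D: "dset I D" "continuous_on D h" "D \<subseteq> E"
      then have "decomp I path_connected D"
        using P E(3) B(2) unfolding path_decomposition_def by (meson subset_trans)
      then show "decomp I (\<lambda>E. path_connected E \<and> continuous_on E g \<and> continuous_on E h) D"
      proof (rule decomp_refine')
        fix K assume K: "dset I K" "path_connected K" "K \<subseteq> D"
        then show "decomp I (\<lambda>E. path_connected E \<and> continuous_on E g \<and> continuous_on E h) K"
          using D(2,3) E(2) by (intro decomp_single) (auto intro: continuous_on_subset)
      qed
    qed
  qed
qed

end

lemma cint_single:
  "cint {i} A = {v. \<exists>l u. l < v i \<and> v i < u \<and> (\<forall>b. l < b \<and> b < u \<longrightarrow> v(i := b) \<in> A)}"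
proof -
  have "v \<in> cint {i} A \<longleftrightarrow> (\<exists>l u. l < v i \<and> v i < u \<and> (\<forall>b. l < b \<and> b < u \<longrightarrow> v(i := b) \<in> A))" for v
  proof
    assume "v \<in> cint {i} A"
    then obtain l u where lu: "l i < v i" "v i < u i"
      "\<And>w. (\<forall>k. k \<noteq> i \<longrightarrow> w k = v k) \<Longrightarrow> l i < w i \<Longrightarrow> w i < u i \<Longrightarrow> w \<in> A"
      by (auto simp: cint_def)
    have "v(i := b) \<in> A" if "l i < b \<and> b < u i" for b
      using that by (intro lu(3)) auto
    then show "\<exists>l u. l < v i \<and> v i < u \<and> (\<forall>b. l < b \<and> b < u \<longrightarrow> v(i := b) \<in> A)"
      using lu(1,2) by blast
  next
    assume "\<exists>l u. l < v i \<and> v i < u \<and> (\<forall>b. l < b \<and> b < u \<longrightarrow> v(i := b) \<in> A)"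
    then obtain l u where lu: "l < v i" "v i < u" "\<And>b. l < b \<and> b < u \<Longrightarrow> v(i := b) \<in> A" by blast
    have "w \<in> A" if "\<forall>k. k \<noteq> i \<longrightarrow> w k = v k" "l < w i" "w i < u" for w
    proof -
      have "w = v(i := w i)" using that(1) by auto
      then show ?thesis using lu(3)[of "w i"] that by simp
    qed
    then show "v \<in> cint {i} A"
      unfolding cint_def mem_Collect_eq
      using lu(1,2) by - (rule exI[of _ "\<lambda>_. l"], rule exI[of _ "\<lambda>_. u"], simp)
  qed
  then show ?thesis by blast
qed

lemma fibre_cint: "fibre i (cint {i} A) v = interior (fibre i A v)"
proof -
  have "b \<in> interior S \<longleftrightarrow> (\<exists>l u. l < b \<and> b < u \<and> {l<..<u} \<subseteq> S)" for b and S :: "real set"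
  proof
    assume "b \<in> interior S"
    then obtain e where "0 < e" "ball b e \<subseteq> S" using mem_interior by blast
    then show "\<exists>l u. l < b \<and> b < u \<and> {l<..<u} \<subseteq> S"
      by - (rule exI[of _ "b - e"], rule exI[of _ "b + e"], auto simp: ball_eq_greaterThanLessThan)
  next
    assume "\<exists>l u. l < b \<and> b < u \<and> {l<..<u} \<subseteq> S"
    then obtain l u where "l < b" "b < u" "{l<..<u} \<subseteq> S" by blast
    then show "b \<in> interior S" using interiorI[of "{l<..<u}" b S] by auto
  qed
  then show ?thesis unfolding cint_single by (intro set_eqI) (simp add: subset_iff)
qed

section \<open>Bands cut out by the end points of fibre intervals\<close>

context tame_definability
begin

lemma dset_cint_single:
  assumes "dset I A" "i \<in> I" shows "dset I (cint {i} A)"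
proof -
  have "dfn (\<lambda>v. v \<in> cint {i} A)" using dsetD(1)[OF assms(1)] by (intro dfn_cint) simp
  moreover have "dep (insert i I) (\<lambda>v. v \<in> A)"
    using dsetD(2)[OF assms(1)] assms(2) by (simp add: insert_absorb)
  then have "dep I (\<lambda>v. v \<in> cint {i} A)"
    unfolding cint_single mem_Collect_eq using assms(2)
    by (intro dep_intros dep_upd_mem dep_simple)
  ultimately show ?thesis by (simp add: dset_def)
qed

definition left_ends :: "nat \<Rightarrow> (nat \<Rightarrow> real) set \<Rightarrow> (nat \<Rightarrow> real) set" where
  "left_ends i Op = {v. v \<notin> Op \<and> (\<exists>u. v i < u \<and> (\<forall>b. v i < b \<and> b < u \<longrightarrow> v(i := b) \<in> Op))}"

text \<open>Right end points are tied to left end points in \<open>L\<close>. This matches the two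
  ends of one interval, and makes the set thin whenever \<open>L\<close> is.\<close>

definition right_ends :: "nat \<Rightarrow> (nat \<Rightarrow> real) set \<Rightarrow> (nat \<Rightarrow> real) set \<Rightarrow> (nat \<Rightarrow> real) set" where
  "right_ends i Op L = {v. v \<notin> Op \<and> (\<exists>l. l < v i \<and> v(i := l) \<in> L \<and>
     (\<forall>b. l < b \<and> b < v i \<longrightarrow> v(i := b) \<in> Op))}"

lemma dset_left_ends:
  assumes Op: "dset I Op" and i: "i \<in> I" and I: "finite I"
  shows "dset I (left_ends i Op)"
  unfolding left_ends_def
proof (rule dset_Collect)
  have depOp: "dep (insert i J) (\<lambda>v. v \<in> Op)" if "I \<subseteq> J" for J
    using that by (intro dep_mono[OF dsetD(2)[OF Op]]) auto
  show "dep I (\<lambda>v. v \<notin> Op \<and> (\<exists>u. v i < u \<and> (\<forall>b. v i < b \<and> b < u \<longrightarrow> v(i := b) \<in> Op)))"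
    using i by (intro dep_intros dep_upd_mem depOp dep_simple dsetD(2)[OF Op] order_refl)
  have "dfn (\<lambda>v. \<exists>u. v i < u \<and> (\<forall>b. v i < b \<and> b < u \<longrightarrow> v(i := b) \<in> Op))"
  proof (rule dfn_ex)
    show "dep I (\<lambda>v. v i < u \<and> (\<forall>b. v i < b \<and> b < u \<longrightarrow> v(i := b) \<in> Op))" for u
      using i by (intro dep_intros dep_upd_mem depOp dep_simple order_refl)
    fix m
    have "dfn (\<lambda>v. \<forall>b. v i < b \<and> b < v m \<longrightarrow> v(i := b) \<in> Op)"
    proof (rule dfn_all)
      show "finite (insert m I)" using I by simp
      show "dep (insert m I) (\<lambda>v. v i < b \<and> b < v m \<longrightarrow> v(i := b) \<in> Op)" for b
        using i by (intro dep_intros dep_upd_mem depOp dep_simple) auto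
      show "dfn (\<lambda>v. v i < v n \<and> v n < v m \<longrightarrow> v(i := v n) \<in> Op)" for n
        by (intro dfn_basic dsetD(1)[OF Op])
    qed
    then show "dfn (\<lambda>v. v i < v m \<and> (\<forall>b. v i < b \<and> b < v m \<longrightarrow> v(i := b) \<in> Op))"
      by (intro dfn_conj dfn_less)
  qed (rule I)
  then show "dfn (\<lambda>v. v \<notin> Op \<and> (\<exists>u. v i < u \<and> (\<forall>b. v i < b \<and> b < u \<longrightarrow> v(i := b) \<in> Op)))"
    by (intro dfn_conj dfn_not dsetD(1)[OF Op])
qed

lemma dset_right_ends:
  assumes Op: "dset I Op" and L: "dset I L" and i: "i \<in> I" and I: "finite I"
  shows "dset I (right_ends i Op L)"
  unfolding right_ends_def
proof (rule dset_Collect)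
  have depOp: "dep (insert i J) (\<lambda>v. v \<in> Op)" if "I \<subseteq> J" for J
    using that by (intro dep_mono[OF dsetD(2)[OF Op]]) auto
  have depL: "dep (insert i J) (\<lambda>v. v \<in> L)" if "I \<subseteq> J" for J
    using that by (intro dep_mono[OF dsetD(2)[OF L]]) auto
  show "dep I (\<lambda>v. v \<notin> Op \<and> (\<exists>l. l < v i \<and> v(i := l) \<in> L \<and> (\<forall>b. l < b \<and> b < v i \<longrightarrow> v(i := b) \<in> Op)))"
    using i by (intro dep_intros dep_upd_mem depOp depL dep_simple dsetD(2)[OF Op] order_refl)
  have "dfn (\<lambda>v. \<exists>l. l < v i \<and> v(i := l) \<in> L \<and> (\<forall>b. l < b \<and> b < v i \<longrightarrow> v(i := b) \<in> Op))"
  proof (rule dfn_ex)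
    show "dep I (\<lambda>v. l < v i \<and> v(i := l) \<in> L \<and> (\<forall>b. l < b \<and> b < v i \<longrightarrow> v(i := b) \<in> Op))" for l
      using i by (intro dep_intros dep_upd_mem depOp depL dep_simple order_refl)
    fix m
    have "dfn (\<lambda>v. \<forall>b. v m < b \<and> b < v i \<longrightarrow> v(i := b) \<in> Op)"
    proof (rule dfn_all)
      show "finite (insert m I)" using I by simp
      show "dep (insert m I) (\<lambda>v. v m < b \<and> b < v i \<longrightarrow> v(i := b) \<in> Op)" for b
        using i by (intro dep_intros dep_upd_mem depOp dep_simple) auto
      show "dfn (\<lambda>v. v m < v n \<and> v n < v i \<longrightarrow> v(i := v n) \<in> Op)" for n
        by (intro dfn_basic dsetD(1)[OF Op])
    qed
    then show "dfn (\<lambda>v. v m < v i \<and> v(i := v m) \<in> L \<and> (\<forall>b. v m < b \<and> b < v i \<longrightarrow> v(i := b) \<in> Op))"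
      by (intro dfn_conj dfn_less dfn_subst_mem dsetD(1)[OF L])
  qed (rule I)
  then show "dfn (\<lambda>v. v \<notin> Op \<and> (\<exists>l. l < v i \<and> v(i := l) \<in> L \<and> (\<forall>b. l < b \<and> b < v i \<longrightarrow> v(i := b) \<in> Op)))"
    by (intro dfn_conj dfn_not dsetD(1)[OF Op])
qed

text \<open>Two right end points over one base point share their left end point because
  \<open>L\<close> is thin. The smaller one would then lie in the interval that ends at the larger
  one, although it is outside \<open>Op\<close>.\<close>

lemma thin_right_ends:
  assumes "thin i L" shows "thin i (right_ends i Op L)"
  unfolding thin_def
proof (intro allI impI, elim conjE)
  fix v c assume "v \<in> right_ends i Op L" "v(i := c) \<in> right_ends i Op L"
  then obtain l l' where l: "v \<notin> Op" "l < v i" "v(i := l) \<in> L" "\<And>b. l < b \<Longrightarrow> b < v i \<Longrightarrow> v(i := b) \<in> Op"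
    and l': "v(i := c) \<notin> Op" "l' < c" "v(i := l') \<in> L" "\<And>b. l' < b \<Longrightarrow> b < c \<Longrightarrow> v(i := b) \<in> Op"
    by (auto simp: right_ends_def)
  have "l = l'" using thin_unique[OF assms l(3) l'(3)] .
  moreover have "v(i := v i) = v" by simp
  ultimately show "c = v i"
    using l l' by (metis linorder_neqE_linordered_idom)
qed

text \<open>A left end point is a limit of points of \<open>Op\<close>, and the slab is
  closed.\<close>

lemma left_ends_bounded:
  assumes "Op \<subseteq> slab I r" shows "left_ends i Op \<subseteq> slab I r"
proof
  fix v assume "v \<in> left_ends i Op"
  then obtain u where u: "v i < u" "\<And>b. v i < b \<Longrightarrow> b < u \<Longrightarrow> v(i := b) \<in> slab I r"
    using assms by (auto simp: left_ends_def)
  have b: "\<bar>(v(i := b)) k\<bar> \<le> r" if "v i < b" "b < u" "k \<in> I" for b k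
    using u(2)[OF that(1,2)] that(3) by (simp add: slab_def)
  have "\<bar>v k\<bar> \<le> r" if k: "k \<in> I" for k
  proof (cases "k = i")
    case False
    obtain c where "v i < c" "c < u" using dense[OF u(1)] by blast
    from b[OF this k] show ?thesis using False by simp
  next
    case True
    have *: "\<bar>c\<bar> \<le> r" if "v i < c" "c < u" for c using b[OF that k] True by simp
    show ?thesis
    proof (rule ccontr)
      assume "\<not> \<bar>v k\<bar> \<le> r"
      then have r: "r < \<bar>v i\<bar>" using True by simp
      define c where "c = v i + min (u - v i) (\<bar>v i\<bar> - r) / 2"
      have "0 < min (u - v i) (\<bar>v i\<bar> - r)" using u(1) r by simp
      then have "v i < c" "c < u" "r < \<bar>c\<bar>" unfolding c_def by (auto simp: min_def field_simps abs_if)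
      then show False using *[of c] by simp
    qed
  qed
  then show "v \<in> slab I r" by (simp add: slab_def)
qed

lemma fibre_left_ends_subset: "fibre i (left_ends i Op) v \<subseteq> frontier (fibre i Op v)"
proof
  fix c assume "c \<in> fibre i (left_ends i Op) v"
  then obtain u where u: "v(i := c) \<notin> Op" "c < u" "\<And>b. c < b \<and> b < u \<Longrightarrow> v(i := b) \<in> Op"
    by (auto simp: left_ends_def)
  have "{c<..<u} \<subseteq> fibre i Op v" using u(3) by auto
  then have "{c..u} \<subseteq> closure (fibre i Op v)"
    using closure_mono closure_greaterThanLessThan[OF u(2)] by metis
  moreover have "c \<notin> interior (fibre i Op v)" using u(1) interior_subset by blast
  ultimately show "c \<in> frontier (fibre i Op v)" using u(2) by (auto simp: frontier_def)
qed

lemma fibre_in_slab: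
  assumes "A \<subseteq> slab I r" "i \<in> I" shows "fibre i A v \<subseteq> {-r..r}"
proof
  fix b assume "b \<in> fibre i A v"
  then have "v(i := b) \<in> slab I r" using assms(1) by blast
  then show "b \<in> {-r..r}" using assms(2) by (auto simp: slab_def)
qed

text \<open>\<open>Op\<close> consists of the interiors of the fibres. What remains of
  \<open>A\<close> has finite fibres and falls into graphs; \<open>Op\<close> falls into bands
  between a left and a right end function. Over path-connected base pieces on which these functions
  are continuous, graphs and bands are path connected.\<close>

lemma path_decomposition_step:
  assumes i: "i \<in> I" and I: "finite I" and U: "uniform_finiteness (I - {i})"
    and C: "piecewise_continuity (I - {i})" and P: "path_decomposition (I - {i})"
  shows "path_decomposition I"
  unfolding path_decomposition_def
proof (intro allI impI)
  fix A r assume A: "dset I A" "A \<subseteq> slab I r"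
  let ?I = "I - {i}"
  have ins: "insert i ?I = I" and nI: "i \<notin> ?I" and fI: "finite ?I" using i I by auto
  have thin_pieces_I: "decomp I (thin i) B"
    if "dset I B" "B \<subseteq> slab I r" "\<And>v. finite (fibre i B v)" for B
    using thin_pieces[OF U nI, of B r] that ins by simp
  have shadow: "dset ?I {v. \<exists>b. v(i := b) \<in> B}" if "dset I B" for B
    using dset_fibre_ex[of i ?I B] that ins by simp
  have shadow_slab: "{v. \<exists>b. v(i := b) \<in> B} \<subseteq> slab ?I r" if "B \<subseteq> slab I r" for B
    using slab_upd that by blast
  define Op where "Op = cint {i} A"
  have Op: "dset I Op" unfolding Op_def by (rule dset_cint_single[OF A(1) i])
  have fibOp: "fibre i Op v = interior (fibre i A v)" for v unfolding Op_def by (rule fibre_cint)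
  have OpA: "Op \<subseteq> A"
  proof
    fix v assume "v \<in> Op"
    then have "v i \<in> fibre i Op v" by simp
    then have "v i \<in> fibre i A v" unfolding fibOp using interior_subset by blast
    then show "v \<in> A" by simp
  qed
  have finite_frontier: "finite (frontier (fibre i B v) \<inter> {-r..r})" if "dset I B" for B v
    using finite_frontier_fibre[OF dsetD(1)[OF that]] .

  have "decomp I path_connected (A - Op)"
  proof -
    have "finite (fibre i (A - Op) v)" for v
    proof (rule finite_subset[OF _ finite_frontier[OF A(1)]])
      have "fibre i (A - Op) v = fibre i A v - fibre i Op v" by auto
      then show "fibre i (A - Op) v \<subseteq> frontier (fibre i A v) \<inter> {-r..r}"
        using fibOp[of v] fibre_in_slab[OF A(2) i] closure_subset by (fastforce simp: frontier_def)
    qed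
    then have "decomp I (thin i) (A - Op)"
      using A(2) by (intro thin_pieces_I dset_Diff A Op) auto
    then show ?thesis
    proof (rule decomp_refine')
      fix L assume L: "dset I L" "thin i L" "L \<subseteq> A - Op"
      define B where "B = {v. \<exists>b. v(i := b) \<in> L}"
      define g where "g = thin_fun i L"
      have g: "dfun ?I g" unfolding g_def using L(1,2) ins fI by (intro dfun_thin_fun) auto
      have "decomp ?I (\<lambda>E. path_connected E \<and> continuous_on E g \<and> continuous_on E g) B"
        using shadow[OF L(1)] shadow_slab[of L] L(3) A(2) unfolding B_def
        by (intro decomp_path_connected_continuous[OF C P g g, of _ r]) auto
      then have "decomp I path_connected (B \<inter> L)"
      proof (rule decomp_refine)
        fix E assume E: "dset ?I E" "path_connected E \<and> continuous_on E g \<and> continuous_on E g" "E \<subseteq> B"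
        have "E \<inter> L = {v \<in> E. v i = g v}"
          using thin_mem_iff[OF L(2)] E(3) unfolding B_def g_def by blast
        then have "path_connected (E \<inter> L)"
          using thin_graph_image[of E g ?I i] E(1,2) dsetD(2)[OF E(1)] dfunD(1)[OF g] nI by simp
        moreover have "dset I (E \<inter> L)" using dset_mono[OF E(1)] L(1) by (intro dset_Int) auto
        ultimately show "decomp I path_connected (E \<inter> L)" by (rule decomp_single[rotated])
      qed
      moreover have "B \<inter> L = L" using thin_mem_iff[OF L(2)] unfolding B_def by blast
      ultimately show "decomp I path_connected L" by simp
    qed
  qed
  moreover have "decomp I path_connected Op"
  proof -
    define Le where "Le = left_ends i Op"
    have OpS: "Op \<subseteq> slab I r" using OpA A(2) by blast
    have "dset I Le" unfolding Le_def by (rule dset_left_ends[OF Op i I])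
    moreover have LeS: "Le \<subseteq> slab I r" unfolding Le_def by (rule left_ends_bounded[OF OpS])
    moreover have "finite (fibre i Le v)" for v
      using fibre_left_ends_subset[of v i Op] fibre_in_slab[OF LeS i, of v]
      unfolding Le_def by (intro finite_subset[OF _ finite_frontier[OF Op, of v]]) blast
    ultimately have "decomp I (thin i) Le" by (rule thin_pieces_I)
    then obtain \<L> where \<L>: "finite \<L>" "Le = \<Union>\<L>" "\<And>L. L \<in> \<L> \<Longrightarrow> dset I L \<and> thin i L"
      unfolding decomp_def by metis
    define B where "B L = {v. \<exists>b. v(i := b) \<in> L} \<inter> {v. \<exists>b. v(i := b) \<in> right_ends i Op L}" for L
    define band where "band L = B L \<inter> {v. thin_fun i L v < v i \<and> v i < thin_fun i (right_ends i Op L) v}" for L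
    have ends: "v(i := thin_fun i L v) \<in> L \<and> thin_fun i L v < thin_fun i (right_ends i Op L) v \<and>
        (\<forall>b. thin_fun i L v < b \<and> b < thin_fun i (right_ends i Op L) v \<longrightarrow> v(i := b) \<in> Op)"
      if L: "L \<in> \<L>" and v: "v \<in> B L" for L v
    proof -
      have thL: "thin i L" using \<L>(3) L by blast
      obtain u where u: "v(i := u) \<in> right_ends i Op L" using v by (auto simp: B_def)
      then obtain l where l: "l < u" "v(i := l) \<in> L" "\<And>b. l < b \<Longrightarrow> b < u \<Longrightarrow> v(i := b) \<in> Op"
        by (auto simp: right_ends_def)
      have "thin_fun i L v = l" "thin_fun i (right_ends i Op L) v = u"
        using thin_fun_eq[OF thL l(2)] thin_fun_eq[OF thin_right_ends[OF thL] u] by auto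
      then show ?thesis using l by simp
    qed
    have "decomp I path_connected (band L)" if L: "L \<in> \<L>" for L
    proof -
      let ?R = "right_ends i Op L"
      let ?g = "thin_fun i L" and ?h = "thin_fun i ?R"
      have dL: "dset I L" "thin i L" using \<L>(3) L by auto
      have R: "dset I ?R" "thin i ?R"
        using dset_right_ends[OF Op dL(1) i I] thin_right_ends[OF dL(2)] by auto
      have g: "dfun ?I ?g" using dL ins fI by (intro dfun_thin_fun) auto
      have h: "dfun ?I ?h" using R ins fI by (intro dfun_thin_fun) auto
      have "dset ?I (B L)" unfolding B_def by (intro dset_Int shadow dL R)
      moreover have "L \<subseteq> slab I r" using LeS \<L>(2) L by blast
      then have "B L \<subseteq> slab ?I r" using shadow_slab[of L] unfolding B_def by blast
      ultimately have "decomp ?I (\<lambda>E. path_connected E \<and> continuous_on E ?g \<and> continuous_on E ?h) (B L)"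
        by (rule decomp_path_connected_continuous[OF C P g h])
      then show ?thesis
        unfolding band_def
      proof (rule decomp_refine)
        fix E assume E: "dset ?I E" "path_connected E \<and> continuous_on E ?g \<and> continuous_on E ?h" "E \<subseteq> B L"
        have "path_connected {v \<in> E. ?g v < v i \<and> v i < ?h v}"
          using E ends[OF L] dsetD(2)[OF E(1)] dfunD(1)[OF g] dfunD(1)[OF h] nI
          by (intro path_connected_band[of E ?I ?g ?h i]) auto
        moreover have "E \<inter> {v. ?g v < v i \<and> v i < ?h v} = {v \<in> E. ?g v < v i \<and> v i < ?h v}" by blast
        moreover have "dset I (E \<inter> ({v. ?g v < v i} \<inter> {v. v i < ?h v}))"
          using dset_mono[OF E(1), of I] dfun_mono[OF g, of I] dfun_mono[OF h, of I] i I
          by (intro dset_Int dset_less_dfun dfun_coordinate) auto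
        moreover have "{v. ?g v < v i} \<inter> {v. v i < ?h v} = {v. ?g v < v i \<and> v i < ?h v}" by blast
        ultimately show "decomp I path_connected (E \<inter> {v. ?g v < v i \<and> v i < ?h v})"
          by (intro decomp_single) simp_all
      qed
    qed
    then have "decomp I path_connected (\<Union>(band ` \<L>))"
      using \<L>(1) by (intro decomp_Union) auto
    moreover have "Op = \<Union>(band ` \<L>)"
    proof
      show "Op \<subseteq> \<Union>(band ` \<L>)"
      proof
        fix v assume v: "v \<in> Op"
        \<comment> \<open>The fibre is open and bounded, so \<open>v i\<close> lies in an interval
          of it with both end points outside. The left one belongs to some \<open>L\<close>, and
          thereby the right one to \<open>right_ends i Op L\<close>.\<close>
        have "open (fibre i Op v)" unfolding fibOp by (rule open_interior)
        moreover have "v i \<in> fibre i Op v" using v by simp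
        ultimately obtain l u where lu: "l < v i" "v i < u" "l \<notin> fibre i Op v" "u \<notin> fibre i Op v"
            "{l<..<u} \<subseteq> fibre i Op v"
          using component_interval_open_real[OF _ fibre_in_slab[OF OpS i, of v]] by metis
        have between: "v(i := b) \<in> Op" if "l < b" "b < u" for b using lu(5) that by auto
        have "v(i := l) \<in> Le"
          using lu(1-3) between unfolding Le_def left_ends_def
          by (auto intro: exI[of _ u])
        then obtain L where L: "L \<in> \<L>" "v(i := l) \<in> L" using \<L>(2) by blast
        have thL: "thin i L" using \<L>(3) L(1) by blast
        have R: "v(i := u) \<in> right_ends i Op L"
          using lu(1,2,4) between L(2) unfolding right_ends_def by (auto intro: exI[of _ l])
        have "v \<in> B L" using L(2) R unfolding B_def by blast
        moreover have "thin_fun i L v = l" "thin_fun i (right_ends i Op L) v = u"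
          using thin_fun_eq[OF thL L(2)] thin_fun_eq[OF thin_right_ends[OF thL] R] by auto
        ultimately have "v \<in> band L" using lu(1,2) by (simp add: band_def)
        then show "v \<in> \<Union>(band ` \<L>)" using L(1) by blast
      qed
      show "\<Union>(band ` \<L>) \<subseteq> Op"
      proof
        fix v assume "v \<in> \<Union>(band ` \<L>)"
        then obtain L where L: "L \<in> \<L>" "v \<in> B L" "thin_fun i L v < v i" "v i < thin_fun i (right_ends i Op L) v"
          by (auto simp: band_def)
        then have "v(i := v i) \<in> Op" using ends[OF L(1,2)] by blast
        then show "v \<in> Op" by simp
      qed
    qed
    ultimately show ?thesis by simp
  qed
  moreover have "A = (A - Op) \<union> Op" using OpA by blast
  ultimately show "decomp I path_connected A" using decomp_Un by metis
qed

text \<open>For a given coordinate set, thin and path decomposition use smaller sets only; piecewise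
  continuity then needs the thin decomposition of the same set, and uniform finiteness needs both
  decompositions.\<close>

theorem path_decomposition:
  assumes "finite I" shows "path_decomposition I"
proof -
  have "uniform_finiteness I \<and> thin_decomposition I \<and> piecewise_continuity I \<and> path_decomposition I"
    using assms
  proof (induction rule: finite_psubset_induct)
    case (psubset I)
    have IH: "uniform_finiteness (I - {i})" "thin_decomposition (I - {i})" "piecewise_continuity (I - {i})"
      "path_decomposition (I - {i})" if "i \<in> I" for i
      using psubset.IH[of "I - {i}"] that by auto
    have T: "thin_decomposition I"
    proof (cases "I = {}")
      case False
      then obtain i where "i \<in> I" by blast
      then show ?thesis using thin_decomposition_step psubset.hyps IH by blast
    qed (simp add: thin_decomposition_empty)
    moreover have P: "path_decomposition I"
    proof (cases "I = {}")
      case False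
      then obtain i where "i \<in> I" by blast
      then show ?thesis using path_decomposition_step psubset.hyps IH by blast
    qed (simp add: path_decomposition_empty)
    moreover have "piecewise_continuity I"
      using piecewise_continuity_step[OF psubset.hyps T] IH by blast
    moreover have "uniform_finiteness I"
      using uniform_finiteness_step[OF psubset.hyps P T] IH by blast
    ultimately show ?case by blast
  qed
  then show ?thesis by blast
qed

end

section \<open>Local path connectedness\<close>

text \<open>Choosing a point in each \<open>D k\<close> and joining consecutive ones by paths
  \<gamma> k inside \<open>D k\<close> gives a map \<open>h\<close> on the half-line. The
  substitution of 1 / s - 1 moves infinity to s = 0, where continuity holds because the sets
  \<open>D k\<close> shrink to \<open>x\<close>.\<close>

lemma path_to_limit:
  fixes D :: "nat \<Rightarrow> 'a::topological_space set"
  assumes pc: "\<And>k. path_connected (D k)" and ne: "\<And>k. D k \<noteq> {}"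
    and dec: "\<And>k. D (Suc k) \<subseteq> D k"
    and lim: "\<And>U. open U \<Longrightarrow> x \<in> U \<Longrightarrow> \<exists>k. D k \<subseteq> U"
  shows "\<exists>g. path g \<and> pathstart g = x \<and> pathfinish g \<in> D 0 \<and> path_image g \<subseteq> insert x (D 0)"
proof -
  have mono: "D n \<subseteq> D m" if "m \<le> n" for m n
    using lift_Suc_antimono_le[of D, OF dec that] .
  from ne have "\<forall>k. \<exists>a. a \<in> D k" by blast
  then obtain a where a: "\<And>k. a k \<in> D k" by metis
  have "\<exists>g. path g \<and> path_image g \<subseteq> D k \<and> pathstart g = a k \<and> pathfinish g = a (Suc k)" for k
    using pc[of k] a[of k] a[of "Suc k"] dec[of k] unfolding path_connected_def by blast
  then obtain \<gamma> where \<gamma>: "\<And>k. path (\<gamma> k)" "\<And>k. path_image (\<gamma> k) \<subseteq> D k"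
      "\<And>k. pathstart (\<gamma> k) = a k" "\<And>k. pathfinish (\<gamma> k) = a (Suc k)"
    by metis
  define h where "h t = \<gamma> (nat \<lfloor>t\<rfloor>) (t - of_int \<lfloor>t\<rfloor>)" for t :: real
  \<comment> \<open>At the right end point the floor already selects the next path, which starts
    where this one finishes.\<close>
  have h_eq: "h t = \<gamma> n (t - real n)" if "t \<in> {real n..real n + 1}" for t n
  proof (cases "t = real n + 1")
    case True
    then have "\<lfloor>t\<rfloor> = int (Suc n)" by simp
    then show ?thesis
      using \<gamma>(3)[of "Suc n"] \<gamma>(4)[of n] True unfolding h_def pathstart_def pathfinish_def
      by (simp only:) (simp add: nat_add_distrib)
  next
    case False
    then have "\<lfloor>t\<rfloor> = int n" using that by (auto simp: floor_eq_iff)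
    then show ?thesis by (simp add: h_def)
  qed
  have h_in: "h t \<in> D n" if "real n \<le> t" for t n
  proof -
    define m where "m = nat \<lfloor>t\<rfloor>"
    have m: "real m \<le> t" "t < real m + 1" and "n \<le> m"
      using that unfolding m_def by (auto simp: le_nat_iff le_floor_iff)
    have "t - real m \<in> {0..1}" using m by auto
    then have "\<gamma> m (t - real m) \<in> D m" using \<gamma>(2)[of m] by (auto simp: path_image_def)
    then show ?thesis using h_eq[of t m] m mono[OF \<open>n \<le> m\<close>] by auto
  qed
  have cont_step: "continuous_on {real n..real n + 1} h" for n
  proof -
    have "continuous_on {real n..real n + 1} (\<lambda>t. \<gamma> n (t - real n))"
      using \<gamma>(1)[of n] unfolding path_def
      by (rule continuous_on_compose2) (auto intro!: continuous_intros)
    then show ?thesis by (rule continuous_on_eq) (rule h_eq[symmetric])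
  qed
  have cont_upto: "continuous_on {0..real n} h" for n
  proof (induction n)
    case 0
    then show ?case by simp
  next
    case (Suc n)
    have "{0..real (Suc n)} = {0..real n} \<union> {real n..real n + 1}" by auto
    then show ?case using continuous_on_closed_Un[OF _ _ Suc.IH cont_step] by simp
  qed
  \<comment> \<open>Extending \<open>h\<close> by a constant to the negative axis lets continuity be
    checked on open half-lines that cover the line.\<close>
  have "continuous_on (\<Union>n\<in>UNIV. {..<real n}) (\<lambda>t. h (max 0 t))"
  proof (rule continuous_on_open_UN)
    show "continuous_on {..<real n} (\<lambda>t. h (max 0 t))" for n
      by (rule continuous_on_compose2[OF cont_upto[of n]]) (auto intro!: continuous_intros)
  qed auto
  moreover have "(\<Union>n\<in>UNIV. {..<real n}) = UNIV"
    using reals_Archimedean2 by (auto simp: set_eq_iff)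
  ultimately have cont: "continuous_on UNIV (\<lambda>t. h (max 0 t))" by simp
  define g where "g s = (if s = 0 then x else h (max 0 (1 / s - 1)))" for s :: real
  have cont_pos: "continuous_on {0<..} g"
  proof -
    have "continuous_on {0<..} (\<lambda>s. h (max 0 (1 / s - 1)))"
      by (rule continuous_on_compose2[OF cont]) (auto intro!: continuous_intros)
    then show ?thesis by (rule continuous_on_eq) (auto simp: g_def)
  qed
  have "path g"
    unfolding path_def continuous_on_topological
  proof (intro ballI allI impI)
    fix s B assume s: "s \<in> {0..1::real}" and B: "open B" "g s \<in> B"
    show "\<exists>A. open A \<and> s \<in> A \<and> (\<forall>y\<in>{0..1}. y \<in> A \<longrightarrow> g y \<in> B)"
    proof (cases "s = 0")
      case True
      then have "x \<in> B" using B(2) by (simp add: g_def)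
      then obtain k where k: "D k \<subseteq> B" using lim B(1) by blast
      have "g y \<in> B" if y: "y \<in> {0..1}" "y \<in> {..<1 / (real k + 1)}" for y
      proof (cases "y = 0")
        case False
        then have "0 < y" using y by simp
        then have "real k \<le> 1 / y - 1" using y(2) by (simp add: field_simps)
        then have "h (max 0 (1 / y - 1)) \<in> D k" by (intro h_in) auto
        then show ?thesis using False k by (auto simp: g_def)
      qed (use \<open>x \<in> B\<close> in \<open>simp add: g_def\<close>)
      moreover have "open {..<1 / (real k + 1)}" "s \<in> {..<1 / (real k + 1)}" using True by auto
      ultimately show ?thesis by blast
    next
      case False
      then have "s \<in> {0<..}" using s by simp
      then obtain A where "open A" "s \<in> A" "\<And>y. y \<in> {0<..} \<Longrightarrow> y \<in> A \<Longrightarrow> g y \<in> B"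
        using cont_pos B unfolding continuous_on_topological by metis
      then have "open (A \<inter> {0<..})" "s \<in> A \<inter> {0<..}" "\<forall>y\<in>{0..1}. y \<in> A \<inter> {0<..} \<longrightarrow> g y \<in> B"
        using \<open>s \<in> {0<..}\<close> by auto
      then show ?thesis by blast
    qed
  qed
  moreover have in_D: "g s \<in> D 0" if "s \<noteq> 0" for s
    using that h_in[of 0 "max 0 (1 / s - 1)"] by (simp add: g_def)
  have "g s \<in> insert x (D 0)" for s using in_D[of s] by (cases "s = 0") (auto simp: g_def)
  then have "path_image g \<subseteq> insert x (D 0)" unfolding path_image_def by blast
  moreover have "pathstart g = x" by (simp add: pathstart_def g_def)
  moreover have "pathfinish g \<in> D 0" using in_D[of 1] by (simp add: pathfinish_def)
  ultimately show ?thesis by blast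
qed

lemma finite_frontier_real_interval:
  fixes S :: "real set"
  assumes "is_interval S" shows "finite (frontier S)"
proof (rule ccontr)
  assume "infinite (frontier S)"
  then obtain T where T: "T \<subseteq> frontier S" "card T = 3" using infinite_arbitrarily_large by metis
  \<comment> \<open>Among three frontier points the middle one has points of the interval
    \<open>S\<close> on both sides and is therefore interior.\<close>
  have no: False if "x \<in> frontier S" "y \<in> frontier S" "z \<in> frontier S" "x < y" "y < z" for x y z
  proof -
    have "{..<y} \<inter> S \<noteq> {}" "{y<..} \<inter> S \<noteq> {}"
      using that open_Int_closure_eq_empty[of "{..<y}" S] open_Int_closure_eq_empty[of "{y<..}" S]
      by (auto simp: frontier_def)
    then obtain s t where st: "s \<in> S" "s < y" "t \<in> S" "y < t" by auto
    have "{s<..<t} \<subseteq> S" using mem_is_interval_1_I[OF assms st(1,3)] by auto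
    then have "y \<in> interior S" using st(2,4) by (intro interiorI[of "{s<..<t}"]) auto
    then show False using that(2) by (simp add: frontier_def)
  qed
  obtain x y z where xyz: "T = {x, y, z}" "x \<noteq> y" "y \<noteq> z" "x \<noteq> z"
    using T(2) by (auto simp: card_3_iff)
  then have fr: "x \<in> frontier S" "y \<in> frontier S" "z \<in> frontier S" using T(1) by auto
  from xyz have "x < y \<and> y < z \<or> x < z \<and> z < y \<or> y < x \<and> x < z \<or> y < z \<and> z < x \<or>
      z < x \<and> x < y \<or> z < y \<and> y < x" by linarith
  then show False
    using no[OF fr(1,2,3)] no[OF fr(1,3,2)] no[OF fr(2,1,3)] no[OF fr(2,3,1)]
      no[OF fr(3,1,2)] no[OF fr(3,2,1)] by blast
qed

text \<open>Near each point the frontier of \<open>S\<close> lies in the frontier of a finite union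
  of points and intervals; compactness turns this into finiteness on a bounded interval.\<close>

lemma finite_frontier_compact_interval:
  fixes S :: "real set"
  assumes "\<And>x. \<exists>U. open U \<and> x \<in> U \<and>
    (\<exists>F. finite F \<and> (\<forall>I\<in>F. (\<exists>a. I = {a}) \<or> (open I \<and> is_interval I)) \<and> S \<inter> U = \<Union>F)"
  shows "finite (frontier S \<inter> {-r..r})"
proof -
  have "\<exists>U. open U \<and> x \<in> U \<and> finite (frontier S \<inter> U)" for x
  proof -
    obtain U F where U: "open U" "x \<in> U" and F: "finite F"
      "\<forall>I\<in>F. (\<exists>a. I = {a}) \<or> (open I \<and> is_interval I)" "S \<inter> U = \<Union>F"
      using assms[of x] by blast
    have "frontier (\<Union>F) \<subseteq> (\<Union>I\<in>F. frontier I)"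
      using F(1) by (induction F) (use frontier_Un_subset in fastforce)+
    moreover have "finite (frontier I)" if "I \<in> F" for I
    proof (rule finite_frontier_real_interval)
      have "(\<exists>a. I = {a}) \<or> is_interval I" using F(2) that by blast
      then show "is_interval I"
      proof
        assume "\<exists>a. I = {a}"
        then obtain a where "I = {a}" by blast
        then show "is_interval I" by (simp add: is_interval_1)
      qed
    qed
    ultimately have "finite (frontier (S \<inter> U))"
      unfolding F(3) using F(1) by (meson finite_UN_I finite_subset)
    moreover have "frontier S \<inter> U \<subseteq> frontier (S \<inter> U)"
    proof
      fix y assume y: "y \<in> frontier S \<inter> U"
      then have "y \<in> closure (S \<inter> U)"
        using open_Int_closure_subset[OF U(1), of S] by (auto simp: frontier_def Int_commute)
      moreover have "y \<notin> interior (S \<inter> U)" using y by (auto simp: frontier_def)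
      ultimately show "y \<in> frontier (S \<inter> U)" by (simp add: frontier_def)
    qed
    ultimately show ?thesis using U finite_subset by blast
  qed
  then obtain U where U: "\<And>x. open (U x)" "\<And>x. x \<in> U x" "\<And>x. finite (frontier S \<inter> U x)" by metis
  obtain T where T: "T \<subseteq> {-r..r}" "finite T" "{-r..r} \<subseteq> (\<Union>x\<in>T. U x)"
    using compactE_image[OF compact_Icc[of "-r" r], of "{-r..r}" U] U(1,2) by blast
  have "frontier S \<inter> {-r..r} \<subseteq> (\<Union>x\<in>T. frontier S \<inter> U x)" using T(3) by blast
  then show ?thesis using T(2) U(3) by (meson finite_UN_I finite_subset)
qed

section \<open>Local path connectedness of definable cylinders\<close>

context tame_definability
begin

lemma path_decomposition_box:
  assumes A: "dset I A" and I: "finite I"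
  obtains \<A> where "finite \<A>" "A \<inter> cbox_on I e x = \<Union>\<A>" "\<And>B. B \<in> \<A> \<Longrightarrow> dset I B \<and> path_connected B"
proof -
  define r where "r = (\<Sum>i\<in>I. \<bar>x i\<bar>) + \<bar>e\<bar>"
  have "cbox_on I e x \<subseteq> slab I r"
  proof
    fix v assume v: "v \<in> cbox_on I e x"
    have "\<bar>v i\<bar> \<le> r" if i: "i \<in> I" for i
    proof -
      have "\<bar>x i\<bar> \<le> (\<Sum>i\<in>I. \<bar>x i\<bar>)" using i I by (intro member_le_sum) auto
      moreover have "\<bar>v i - x i\<bar> < e" using v i by (simp add: cbox_on_def)
      ultimately show ?thesis unfolding r_def by linarith
    qed
    then show "v \<in> slab I r" by (simp add: slab_def)
  qed
  then have "A \<inter> cbox_on I e x \<subseteq> slab I r" by blast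
  moreover have "dset I (cbox_on I e x)"
    unfolding dset_def using dfn_cbox_on[OF I] dep_cbox_on[of I I] by simp
  ultimately have "decomp I path_connected (A \<inter> cbox_on I e x)"
    using path_decomposition[OF I] dset_Int[OF A] unfolding path_decomposition_def by blast
  then show ?thesis unfolding decomp_def using that by metis
qed

text \<open>Closure commutes with finite unions, so \<open>x\<close> adheres to one of the finitely
  many pieces of \<open>C\<close> in a small box. Growing \<open>k\<close> both adds constrained
  coordinates and shrinks the box, as convergence in the product topology requires.\<close>

lemma path_connected_refinement:
  assumes C: "dfn (\<lambda>v. v \<in> C)" and x: "x \<in> closure C"
  shows "\<exists>D. dfn (\<lambda>v. v \<in> D) \<and> path_connected D \<and> x \<in> closure D \<and> D \<subseteq> C \<and>
    D \<subseteq> cbox_on {..<k} (1 / Suc k) x"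
proof -
  obtain J where J: "finite J" "dep J (\<lambda>v. v \<in> C)" using dfn_dep[OF C] by blast
  define I where "I = J \<union> {..<k}"
  let ?W = "cbox_on I (1 / Suc k) x"
  have I: "finite I" using J(1) by (simp add: I_def)
  have "dset I C" unfolding dset_def I_def using C dep_mono[OF J(2)] by simp
  then obtain \<A> where \<A>: "finite \<A>" "C \<inter> ?W = \<Union>\<A>" "\<And>B. B \<in> \<A> \<Longrightarrow> dset I B \<and> path_connected B"
    using path_decomposition_box I by metis
  have "x \<in> ?W" by (rule centre_in_cbox_on) simp
  then have "x \<in> closure (C \<inter> ?W)"
    using open_Int_closure_subset[OF open_cbox_on[OF I], of "1 / Suc k" x C] x by (auto simp: Int_commute)
  moreover have "closure (\<Union>\<A>) \<subseteq> \<Union>(closure ` \<A>)"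
  proof (rule closure_minimal)
    show "\<Union>\<A> \<subseteq> \<Union>(closure ` \<A>)" by (meson UN_upper Union_least closure_subset order_trans)
    show "closed (\<Union>(closure ` \<A>))" using \<A>(1) by (intro closed_Union) auto
  qed
  ultimately obtain D where D: "D \<in> \<A>" "x \<in> closure D" using \<A>(2) by auto
  have "?W \<subseteq> cbox_on {..<k} (1 / Suc k) x" by (auto simp: cbox_on_def I_def)
  then have "D \<subseteq> C" "D \<subseteq> cbox_on {..<k} (1 / Suc k) x" using D(1) \<A>(2) by blast+
  then show ?thesis using D \<A>(3)[OF D(1)] dsetD(1) by blast
qed

text \<open>Curve selection without definable choice: a shrinking sequence of path-connected definable
  subsets near \<open>x\<close> is traversed by infinitely many consecutive paths.\<close>

lemma path_into_definable:
  assumes C: "dfn (\<lambda>v. v \<in> C)" and x: "x \<in> closure C"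
  shows "\<exists>g. path g \<and> pathstart g = x \<and> pathfinish g \<in> C \<and> path_image g \<subseteq> insert x C"
proof -
  define P where "P k D \<longleftrightarrow> dfn (\<lambda>v. v \<in> D) \<and> path_connected D \<and> x \<in> closure D \<and> D \<subseteq> C \<and>
    D \<subseteq> cbox_on {..<k} (1 / Suc k) x" for k D
  \<comment> \<open>Definability and adherence of \<open>x\<close> are part of \<open>P\<close>, so
    the next piece can be chosen inside the present one.\<close>
  have "\<exists>D. \<forall>k. P k (D k) \<and> D (Suc k) \<subseteq> D k"
  proof (rule dependent_nat_choice)
    show "\<exists>D. P 0 D" unfolding P_def by (rule path_connected_refinement[OF C x])
    fix D k assume "P k D"
    then have D: "dfn (\<lambda>v. v \<in> D)" "x \<in> closure D" "D \<subseteq> C" by (auto simp: P_def)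
    from path_connected_refinement[OF D(1,2), of "Suc k"] D(3)
    show "\<exists>D'. P (Suc k) D' \<and> D' \<subseteq> D" unfolding P_def by blast
  qed
  then obtain D where D: "\<And>k. P k (D k)" "\<And>k. D (Suc k) \<subseteq> D k" by blast
  have "\<exists>g. path g \<and> pathstart g = x \<and> pathfinish g \<in> D 0 \<and> path_image g \<subseteq> insert x (D 0)"
  proof (rule path_to_limit)
    show "path_connected (D k)" "D k \<noteq> {}" for k using D(1)[of k] unfolding P_def by auto
    fix U assume "open U" "x \<in> U"
    then obtain F e where F: "finite F" "0 < e" "cbox_on F e x \<subseteq> U" by (rule open_contains_cbox_on)
    obtain n0 where n0: "\<And>k. k \<in> F \<Longrightarrow> k < n0" using F(1) finite_nat_set_iff_bounded by auto
    obtain n1 where n1: "1 / Suc n1 < e" using reals_Archimedean[OF F(2)] by (auto simp: inverse_eq_divide)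
    \<comment> \<open>Beyond \<open>n0\<close> the box constrains every coordinate in
      \<open>F\<close>, and beyond \<open>n1\<close> it is narrower than \<open>e\<close>.\<close>
    let ?n = "max n0 n1"
    have "1 / real (Suc ?n) \<le> 1 / Suc n1" by (intro divide_left_mono) auto
    then have "1 / real (Suc ?n) < e" using n1 by linarith
    moreover have "F \<subseteq> {..<?n}" using n0 by (fastforce simp: less_max_iff_disj)
    ultimately have "cbox_on {..<?n} (1 / Suc ?n) x \<subseteq> cbox_on F e x"
      unfolding cbox_on_def by (blast intro: less_trans)
    then have "D ?n \<subseteq> U" using D(1)[of ?n] F(3) unfolding P_def by blast
    then show "\<exists>k. D k \<subseteq> U" by blast
  qed (rule D(2))
  moreover have "D 0 \<subseteq> C" using D(1)[of 0] by (simp add: P_def)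
  ultimately show ?thesis by blast
qed

text \<open>It suffices that points near \<open>x\<close> can be joined to \<open>x\<close> within a
  given neighbourhood, if this is known at every \<open>x\<close>. Such a point lies in a
  path-connected piece that adheres to \<open>x\<close>, and a path from \<open>x\<close> into that
  piece makes the connection.\<close>

theorem locally_path_connected_definable:
  assumes "dfn (\<lambda>v. v \<in> A)"
  shows "locally_path_connected_space (top_of_set A)"
  unfolding locally_path_connected_space_im_kleinen
proof (intro allI impI)
  fix V x assume V: "openin (top_of_set A) V \<and> x \<in> V"
  then obtain G where G: "open G" "V = A \<inter> G" by (auto simp: openin_open)
  then have "x \<in> G" "x \<in> A" using V by auto
  obtain F e where F: "finite F" "0 < e" "cbox_on F e x \<subseteq> G"
    using open_contains_cbox_on[OF G(1) \<open>x \<in> G\<close>] .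
  obtain J where J: "finite J" "dep J (\<lambda>v. v \<in> A)" using dfn_dep[OF assms] by blast
  define I where "I = J \<union> F"
  let ?W = "cbox_on I e x"
  have I: "finite I" using J(1) F(1) by (simp add: I_def)
  have "dset I A" unfolding dset_def I_def using assms dep_mono[OF J(2)] by simp
  then obtain \<A> where \<A>: "finite \<A>" "A \<inter> ?W = \<Union>\<A>" "\<And>B. B \<in> \<A> \<Longrightarrow> dset I B \<and> path_connected B"
    using path_decomposition_box I by metis
  have W: "open ?W" "x \<in> ?W" "?W \<subseteq> G"
    using open_cbox_on[OF I] centre_in_cbox_on[OF F(2)] F(3) by (auto simp: cbox_on_def I_def)
  \<comment> \<open>Only finitely many closures are removed, so \<open>N\<close> is open, and every
    piece that meets it adheres to \<open>x\<close>.\<close>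
  define N where "N = ?W - \<Union>(closure ` {B \<in> \<A>. x \<notin> closure B})"
  have "open N" unfolding N_def using \<A>(1) by (intro open_Diff W closed_Union) auto
  then have "openin (top_of_set A) (A \<inter> N)" by (rule openin_open_Int)
  moreover have "x \<in> A \<inter> N" using \<open>x \<in> A\<close> W(2) by (auto simp: N_def)
  moreover have "A \<inter> N \<subseteq> V" using W(3) G(2) by (auto simp: N_def)
  moreover have "\<exists>C. path_connectedin (top_of_set A) C \<and> C \<subseteq> V \<and> x \<in> C \<and> y \<in> C" if y: "y \<in> A \<inter> N" for y
  proof -
    have "y \<in> A \<inter> ?W" using y by (auto simp: N_def)
    then obtain B where B: "B \<in> \<A>" "y \<in> B" using \<A>(2) by blast
    have "x \<in> closure B" using y B closure_subset[of B] by (auto simp: N_def)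
    then obtain g where g: "path g" "pathstart g = x" "pathfinish g \<in> B" "path_image g \<subseteq> insert x B"
      using path_into_definable \<A>(3)[OF B(1)] dsetD(1) by meson
    let ?C = "path_image g \<union> B"
    have "path_connected ?C"
      using path_connected_path_image[OF g(1)] \<A>(3)[OF B(1)] g(3) pathfinish_in_path_image[of g]
      by (intro path_connected_Un) auto
    moreover have "?C \<subseteq> A \<inter> ?W"
      using g(4) \<A>(2) B(1) \<open>x \<in> A\<close> W(2) by blast
    moreover have "x \<in> ?C" using pathstart_in_path_image[of g] g(2) by simp
    ultimately show ?thesis
      using B(2) W(3) G(2) by (intro exI[of _ ?C]) (auto simp: path_connectedin_subtopology)
  qed
  ultimately show "\<exists>U. openin (top_of_set A) U \<and> x \<in> U \<and> U \<subseteq> V \<and>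
      (\<forall>y\<in>U. \<exists>C. path_connectedin (top_of_set A) C \<and> C \<subseteq> V \<and> x \<in> C \<and> y \<in> C)"
    by blast
qed

end

section \<open>Structures on the real line\<close>

primrec rename_term :: "(nat \<Rightarrow> nat) \<Rightarrow> 'f fo_term \<Rightarrow> 'f fo_term" where
  "rename_term \<sigma> (Var i) = Var (\<sigma> i)"
| "rename_term \<sigma> (Fun f ts) = Fun f (map (rename_term \<sigma>) ts)"

primrec rename_formula :: "(nat \<Rightarrow> nat) \<Rightarrow> ('f, 'r) fo_formula \<Rightarrow> ('f, 'r) fo_formula" where
  "rename_formula \<sigma> (Eq s t) = Eq (rename_term \<sigma> s) (rename_term \<sigma> t)"
| "rename_formula \<sigma> (Rel r ts) = Rel r (map (rename_term \<sigma>) ts)"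
| "rename_formula \<sigma> (Neg \<phi>) = Neg (rename_formula \<sigma> \<phi>)"
| "rename_formula \<sigma> (Conj \<phi> \<psi>) = Conj (rename_formula \<sigma> \<phi>) (rename_formula \<sigma> \<psi>)"
| "rename_formula \<sigma> (Ex i \<phi>) = Ex (\<sigma> i) (rename_formula \<sigma> \<phi>)"

lemma term_of_language_rename: "term_of_language M (rename_term \<sigma> t) = term_of_language M t"
  by (induction t) (auto simp: list_all_iff)

lemma formula_of_language_rename:
  "formula_of_language M (rename_formula \<sigma> \<phi>) = formula_of_language M \<phi>"
  by (induction \<phi>) (auto simp: term_of_language_rename list_all_iff)

lemma term_value_rename: "term_value M v (rename_term \<sigma> t) = term_value M (v \<circ> \<sigma>) t"
  by (induction t) (auto intro!: arg_cong[where f = "fun_interp M _"])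

text \<open>Bound variables are renamed too; injectivity ensures that updating the image of a bound
  variable affects no other variable.\<close>

lemma satisfies_rename:
  assumes "inj \<sigma>"
  shows "satisfies M v (rename_formula \<sigma> \<phi>) = satisfies M (v \<circ> \<sigma>) \<phi>"
proof (induction \<phi> arbitrary: v)
  case (Rel r ts)
  then show ?case by (simp add: term_value_rename comp_def)
next
  case (Ex i \<phi>)
  have "(v(\<sigma> i := a)) \<circ> \<sigma> = (v \<circ> \<sigma>)(i := a)" for a
    using assms by (auto simp: fun_eq_iff inj_eq)
  then show ?case by (simp only: rename_formula.simps satisfies.simps Ex.IH)
qed (simp_all add: term_value_rename)

text \<open>The counterpart of \<open>definable\<close> for cylinders in the sequence space: the
  dimension \<open>K\<close> is existential, and the sequences are unrestricted.\<close>

definition definable_pred :: "('f, 'r) real_structure \<Rightarrow> ((nat \<Rightarrow> real) \<Rightarrow> bool) \<Rightarrow> bool" where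
  "definable_pred M P \<longleftrightarrow> (\<exists>\<phi> p K. formula_of_language M \<phi> \<and>
     (\<forall>v. P v \<longleftrightarrow> satisfies M (\<lambda>i. if i < K then v i else p i) \<phi>))"

lemma definable_predI:
  "formula_of_language M \<phi> \<Longrightarrow> (\<And>v. P v \<longleftrightarrow> satisfies M (\<lambda>i. if i < K then v i else p i) \<phi>) \<Longrightarrow>
    definable_pred M P"
  unfolding definable_pred_def by blast

lemma definable_pred_conj:
  assumes "definable_pred M P" "definable_pred M Q"
  shows "definable_pred M (\<lambda>v. P v \<and> Q v)"
proof -
  obtain \<phi>1 p1 K1 where 1: "formula_of_language M \<phi>1"
      "\<And>v. P v \<longleftrightarrow> satisfies M (\<lambda>i. if i < K1 then v i else p1 i) \<phi>1"
    using assms(1) unfolding definable_pred_def by blast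
  obtain \<phi>2 p2 K2 where 2: "formula_of_language M \<phi>2"
      "\<And>v. Q v \<longleftrightarrow> satisfies M (\<lambda>i. if i < K2 then v i else p2 i) \<phi>2"
    using assms(2) unfolding definable_pred_def by blast
  define K where "K = max K1 K2"
  \<comment> \<open>Both formulas may use one variable for different parameters. Coordinates stay in
    place, while the parameters move to even and odd offsets from \<open>K\<close>, where
    \<open>p\<close> interleaves \<open>p1\<close> and \<open>p2\<close>.\<close>
  define \<sigma>1 \<sigma>2 where "\<sigma>1 i = (if i < K1 then i else K + 2 * i)"
    and "\<sigma>2 i = (if i < K2 then i else K + 2 * i + 1)" for i
  define p where "p m = (if even (m - K) then p1 ((m - K) div 2) else p2 ((m - K) div 2))" for m
  have inj: "inj \<sigma>1" "inj \<sigma>2"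
    by (auto simp: inj_def \<sigma>1_def \<sigma>2_def K_def split: if_splits)
  let ?v = "\<lambda>v i. if i < K then v i else p i"
  have eq: "?v v \<circ> \<sigma>1 = (\<lambda>i. if i < K1 then v i else p1 i)"
    "?v v \<circ> \<sigma>2 = (\<lambda>i. if i < K2 then v i else p2 i)" for v
    by (auto simp: fun_eq_iff \<sigma>1_def \<sigma>2_def p_def K_def)
  have "P v \<and> Q v \<longleftrightarrow> satisfies M (?v v) (Conj (rename_formula \<sigma>1 \<phi>1) (rename_formula \<sigma>2 \<phi>2))" for v
    unfolding satisfies.simps satisfies_rename[OF inj(1)] satisfies_rename[OF inj(2)] eq 1(2) 2(2) ..
  moreover have "formula_of_language M (Conj (rename_formula \<sigma>1 \<phi>1) (rename_formula \<sigma>2 \<phi>2))"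
    using 1(1) 2(1) by (simp add: formula_of_language_rename)
  ultimately show ?thesis by (intro definable_predI)
qed

lemma definable_pred_not:
  assumes "definable_pred M P" shows "definable_pred M (\<lambda>v. \<not> P v)"
proof -
  obtain \<phi> p K where "formula_of_language M \<phi>"
      "\<And>v. P v \<longleftrightarrow> satisfies M (\<lambda>i. if i < K then v i else p i) \<phi>"
    using assms unfolding definable_pred_def by blast
  then show ?thesis by (intro definable_predI[of M "Neg \<phi>" _ K p]) auto
qed

lemma definable_pred_ex_upd:
  assumes "definable_pred M P" shows "definable_pred M (\<lambda>v. \<exists>a. P (v(i := a)))"
proof -
  obtain \<phi> p K where \<phi>: "formula_of_language M \<phi>"
      "\<And>v. P v \<longleftrightarrow> satisfies M (\<lambda>i. if i < K then v i else p i) \<phi>"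
    using assms unfolding definable_pred_def by blast
  show ?thesis
  proof (cases "i < K")
    case True
    have "(\<lambda>k. if k < K then v k else p k)(i := a) = (\<lambda>k. if k < K then (v(i := a)) k else p k)" for v a
      using True by (auto simp: fun_eq_iff)
    then have "(\<exists>a. P (v(i := a))) \<longleftrightarrow> satisfies M (\<lambda>k. if k < K then v k else p k) (Ex i \<phi>)" for v
      unfolding satisfies.simps \<phi>(2) by simp
    moreover have "formula_of_language M (Ex i \<phi>)" using \<phi>(1) by simp
    ultimately show ?thesis by (intro definable_predI)
  next
    case False
    then have "(\<lambda>k. if k < K then (v(i := a)) k else p k) = (\<lambda>k. if k < K then v k else p k)" for v a
      by (auto simp: fun_eq_iff)
    then have "P (v(i := a)) \<longleftrightarrow> P v" for v a
      unfolding \<phi>(2) by simp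
    then show ?thesis using assms by simp
  qed
qed

lemma definable_pred_order:
  assumes "expansion_of_real_order M"
  shows "definable_pred M (\<lambda>v. v i < v j)" "definable_pred M (\<lambda>v. v i < c)" "definable_pred M (\<lambda>v. c < v i)"
proof -
  obtain r where r: "(r, 2) \<in> rels M" "\<And>x y. rel_interp M r [x, y] \<longleftrightarrow> x < y"
    using assms unfolding expansion_of_real_order_def by blast
  have less: "formula_of_language M (Rel r [Var i, Var j])" for i j
    using r(1) by (simp add: numeral_2_eq_2)
  show "definable_pred M (\<lambda>v. v i < v j)"
    by (rule definable_predI[OF less[of i j], where K = "Suc (max i j)" and p = "\<lambda>_. 0"])
      (auto simp: r(2))
  \<comment> \<open>With \<open>K\<close> equal to \<open>Suc i\<close>, the variable
    \<open>Suc i\<close> is no coordinate and reads the parameter \<open>c\<close>.\<close>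
  show "definable_pred M (\<lambda>v. v i < c)"
    by (rule definable_predI[OF less[of i "Suc i"], where K = "Suc i" and p = "\<lambda>_. c"])
      (auto simp: r(2))
  show "definable_pred M (\<lambda>v. c < v i)"
    by (rule definable_predI[OF less[of "Suc i" i], where K = "Suc i" and p = "\<lambda>_. c"])
      (auto simp: r(2))
qed

lemma definable_pred_dep:
  assumes "definable_pred M P" shows "\<exists>I. finite I \<and> dep I P"
proof -
  obtain \<phi> p K where \<phi>: "\<And>v. P v \<longleftrightarrow> satisfies M (\<lambda>i. if i < K then v i else p i) \<phi>"
    using assms unfolding definable_pred_def by blast
  have "dep {..<K} P"
    unfolding dep_def
  proof (intro allI impI)
    fix v w :: "nat \<Rightarrow> real" assume "\<forall>i\<in>{..<K}. v i = w i"
    then have "(\<lambda>i. if i < K then v i else p i) = (\<lambda>i. if i < K then w i else p i)"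
      by (auto simp: fun_eq_iff)
    then show "P v = P w" unfolding \<phi> by simp
  qed
  then show ?thesis by blast
qed

lemma finite_frontier_definable_fibre:
  assumes "locally_o_minimal M" "definable_pred M P"
  shows "finite (frontier {a. P (v(i := a))} \<inter> {-r..r})"
proof -
  obtain \<phi> p K where \<phi>: "formula_of_language M \<phi>"
      "\<And>v. P v \<longleftrightarrow> satisfies M (\<lambda>i. if i < K then v i else p i) \<phi>"
    using assms(2) unfolding definable_pred_def by blast
  show ?thesis
  proof (cases "i < K")
    case True
    \<comment> \<open>Variable \<open>i\<close> becomes the only coordinate of a one-dimensional
      set. All others shift up by one and turn into parameters, which take over the values of
      \<open>v\<close> and \<open>p\<close>.\<close>
    define \<sigma> where "\<sigma> k = (if k = i then 0 else Suc k)" for k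
    define q where "q m = (if m - 1 < K then v (m - 1) else p (m - 1))" for m
    define E where "E = {x \<in> topspace (Euclidean_space 1). P (v(i := x 0))}"
    have "inj \<sigma>" by (auto simp: inj_def \<sigma>_def split: if_splits)
    moreover have "(\<lambda>m. if m < 1 then x m else q m) \<circ> \<sigma> = (\<lambda>k. if k < K then (v(i := x 0)) k else p k)" for x
      using True by (auto simp: fun_eq_iff \<sigma>_def q_def)
    ultimately have "P (v(i := x 0)) \<longleftrightarrow>
        satisfies M (\<lambda>m. if m < 1 then x m else q m) (rename_formula \<sigma> \<phi>)" for x
      by (simp only: \<phi>(2) satisfies_rename)
    then have "E = {x \<in> topspace (Euclidean_space 1).
        satisfies M (\<lambda>m. if m < 1 then x m else q m) (rename_formula \<sigma> \<phi>)}"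
      unfolding E_def by simp
    moreover have "formula_of_language M (rename_formula \<sigma> \<phi>)"
      using \<phi>(1) by (simp add: formula_of_language_rename)
    ultimately have "definable M 1 E"
      unfolding definable_def by blast
    then have lom: "\<exists>U. open U \<and> x \<in> U \<and> (\<exists>F. finite F \<and>
        (\<forall>I\<in>F. (\<exists>a. I = {a}) \<or> (open I \<and> is_interval I)) \<and> (\<lambda>e. e 0) ` E \<inter> U = \<Union>F)" for x
      using assms(1) unfolding locally_o_minimal_def by simp
    have "(\<lambda>e. e 0) ` E = {a. P (v(i := a))}"
    proof
      show "{a. P (v(i := a))} \<subseteq> (\<lambda>e. e 0) ` E"
      proof
        fix a assume "a \<in> {a. P (v(i := a))}"
        then have "(\<lambda>_. 0)(0 := a) \<in> E" by (simp add: E_def topspace_Euclidean_space)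
        then show "a \<in> (\<lambda>e. e 0) ` E" by (rule rev_image_eqI) simp
      qed
    qed (auto simp: E_def)
    then show ?thesis
      using finite_frontier_compact_interval[OF lom, of r] by simp
  next
    case False
    then have "(\<lambda>k. if k < K then (v(i := a)) k else p k) = (\<lambda>k. if k < K then v k else p k)" for a
      by (auto simp: fun_eq_iff)
    then have "{a. P (v(i := a))} = {} \<or> {a. P (v(i := a))} = UNIV"
      unfolding \<phi>(2) by auto
    then show ?thesis by auto
  qed
qed

lemma tame_definability_structure:
  assumes "expansion_of_real_order M" "locally_o_minimal M"
  shows "tame_definability (definable_pred M)"
  by unfold_locales
    (use assms in \<open>blast intro: definable_pred_conj definable_pred_not definable_pred_ex_upd
       definable_pred_order definable_pred_dep finite_frontier_definable_fibre\<close>)+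

text \<open>The return from cylinders to \<open>Euclidean_space n\<close>: setting the coordinates
  from \<open>n\<close> on to 0 retracts the cylinder \<open>A\<close> onto \<open>E\<close>, and
  local path connectedness passes to retracts.\<close>

lemma locally_path_connected_definable_set:
  assumes M: "expansion_of_real_order M" "locally_o_minimal M" and E: "definable M n E"
  shows "locally_path_connected_space (subtopology (Euclidean_space n) E)"
proof -
  obtain \<phi> p where \<phi>: "formula_of_language M \<phi>"
      "E = {x \<in> topspace (Euclidean_space n). satisfies M (\<lambda>i. if i < n then x i else p i) \<phi>}"
    using E unfolding definable_def by blast
  define A where "A = {v. satisfies M (\<lambda>i. if i < n then v i else p i) \<phi>}"
  have "definable_pred M (\<lambda>v. v \<in> A)"
    unfolding A_def mem_Collect_eq by (rule definable_predI[OF \<phi>(1)]) simp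
  then have lpc: "locally_path_connected_space (top_of_set A)"
    by (rule tame_definability.locally_path_connected_definable[OF tame_definability_structure[OF M]])
  define \<rho> :: "(nat \<Rightarrow> real) \<Rightarrow> nat \<Rightarrow> real" where "\<rho> v = (\<lambda>i. if i < n then v i else 0)" for v
  have eq: "(\<lambda>i. if i < n then \<rho> v i else p i) = (\<lambda>i. if i < n then v i else p i)" for v
    by (auto simp: \<rho>_def)
  have \<rho>: "\<rho> v \<in> E" if "v \<in> A" for v
  proof -
    have "satisfies M (\<lambda>i. if i < n then \<rho> v i else p i) \<phi>"
      unfolding eq using that by (simp add: A_def)
    moreover have "\<rho> v \<in> topspace (Euclidean_space n)"
      by (simp add: topspace_Euclidean_space \<rho>_def)
    ultimately show ?thesis unfolding \<phi>(2) by blast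
  qed
  have "continuous_on A \<rho>"
    unfolding \<rho>_def
  proof (rule continuous_on_coordinatewise_then_product)
    show "continuous_on A (\<lambda>v. if i < n then v i else 0)" for i
      by (cases "i < n") (auto intro: continuous_intros)
  qed
  moreover have "E \<subseteq> A" by (auto simp: \<phi>(2) A_def)
  moreover have "\<rho> x = x" if "x \<in> E" for x
    using that by (auto simp: \<phi>(2) \<rho>_def topspace_Euclidean_space fun_eq_iff)
  ultimately have "retraction_maps (top_of_set A) (top_of_set E) \<rho> id"
    using \<rho> by (auto simp: retraction_maps_def Abstract_Topology.continuous_map_in_subtopology)
  then have "retraction_map (top_of_set A) (top_of_set E) \<rho>"
    unfolding retraction_map_def by blast
  then have "locally_path_connected_space (top_of_set E)"
    using lpc locally_path_connected_space_retraction_map_image by blast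
  moreover have "subtopology (Euclidean_space n) E = top_of_set E"
  proof -
    have "topspace (Euclidean_space n) \<inter> E = E" using \<phi>(2) by blast
    then show ?thesis
      unfolding Euclidean_space_def euclidean_product_topology subtopology_subtopology
      by (simp add: topspace_Euclidean_space)
  qed
  ultimately show ?thesis by simp
qed

theorem corollary1p7:
  fixes M :: "('f, 'r) real_structure"
  assumes "expansion_of_real_order M"
    and "locally_o_minimal M"
  shows "(PCC M \<longleftrightarrow> CC M) \<and> (CC M \<longleftrightarrow> QCC M)"
proof -
  have "path_components_of (subtopology (Euclidean_space n) E) =
          connected_components_of (subtopology (Euclidean_space n) E) \<and>
        quasi_components_of (subtopology (Euclidean_space n) E) =
          connected_components_of (subtopology (Euclidean_space n) E)"
    if "definable M n E" for n E
    using locally_path_connected_definable_set[OF assms that]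
      path_components_eq_connected_components_of quasi_eq_connected_components_of
      locally_path_connected_imp_locally_connected_space by blast
  then show ?thesis unfolding PCC_def CC_def QCC_def by simp
qed

end
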